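(* Let $N\ge9$. Let $\mathcal{I}\subset\mathcal{B}_N^d$ with reconstructing rank-1 lattice $\Lambda(\mathbf z,M)$, let $f\in\mathcal{W}(\mathbb{T}^d)\cap C(\mathbb{T}^d)$ with Fourier coefficients $c=c(f)$, and let each function sample be possibly corrupted by noise at most $e_\infty\ge0$ in absolute magnitude. Using the discrete sublinear-time SFT algorithm $\mathcal{A}^{\mathrm{disc}}_{2s,M}$ or its Monte Carlo variant $\mathcal{A}^{\mathrm{disc,MC}}_{2s,M}$ with parameter $1\le r\le\frac M{36}$ as the univariate SFT, the Phase Encoding algorithm produces $\mathbf b=(b_{\mathbf k})_{\mathbf k\in\mathcal{B}_N^d}$, a $2s$-sparse approximation of $c$ satisfying the error estimate $$\|\mathbf b-c\|_2\le\|c-c|_{\mathcal{I}}\|_2+(48+4N)\frac{\|c|_{\mathcal{I}}-(c|_{\mathcal{I}})_s^{\mathrm{opt}}\|_1}{\sqrt s}+(188+16N)\sqrt s\,\big(\|f\|_\infty M^{-r}+\|c-c|_{\mathcal{I}}\|_1+e_\infty\big),$$ albeit with probability $1-\sigma\in[0,1)$ for the Monte Carlo version. The total number of evaluations of $f$ and the computational complexity are $$\mathcal{O}\left(\frac{ds^2r^{3/2}\log^{11/2}M}{\log s}\right)\quad\text{or}\quad\mathcal{O}\left(ds\,r^{3/2}\log^{9/2}M\,\log\left(\frac{dM}\sigma\right)\right)$$ for $\mathcal{A}^{\mathrm{disc}}_{2s,M}$ or $\mathcal{A}^{\mathrm{disc,MC}}_{2s,M}$ respectively (in the latter case with the failure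 probability of the individual univariate SFTs chosen suitably in terms of $\sigma$ and $d$).
   Context: Notation. $\mathbb{T}=[0,1]$ with endpoints identified; $[n]=\{0,\dots,n-1\}$; $\mathcal{B}_N:=(-\lceil N/2\rceil,\lfloor N/2\rfloor]\cap\mathbb{Z}$. For $f:\mathbb{T}^d\to\mathbb{C}$, $c_{\mathbf k}(f)=\int_{\mathbb{T}^d}f(\mathbf x)e^{-2\pi i\mathbf k\cdot\mathbf x}\,d\mathbf x$ and $c(f)=(c_{\mathbf k}(f))_{\mathbf k\in\mathbb{Z}^d}$; $\mathcal{W}(\mathbb{T}^d)=\{f\in L^1(\mathbb{T}^d):\sum_{\mathbf k}|c_{\mathbf k}(f)|<\infty\}$ and $C(\mathbb{T}^d)$ is the space of continuous functions. $c|_{\mathcal{I}}$ is the restriction to $\mathcal{I}$; finite vectors and restrictions are extended by zero when compared with sequences on larger index sets, and norms of sequences are those of $\ell^p(\mathbb{Z}^d)$. For a vector $\mathbf y$, $\mathbf y_s^{\mathrm{opt}}$ is $\mathbf y$ restricted to its $s$ largest-magnitude entries. "$s$-sparse" means at most $s$ nonzero entries; $s$ is a positive integer, and sparsity parameters $s$ are always assumed to be at most half the size of the vectors under consideration. Coordinates are indexed by $\ell\in[d]$. For univariate $a$, $\mathbf a=(a(j/M))_{j\in[M]}$ and $(\mathbf F_M\mathbf a)_\omega=\frac1M\sum_{j\in[M]}a(j/M)e^{-2\pi i\omega j/M}$; vectors in $\mathbb{C}^M$ are indexed by $\mathcal{B}_M$, indices being taken modulo $M$. The shift operator is $S_{\ell,\alpha}(f)(\mathbf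 x)=f(x_0,\dots,(x_\ell+\alpha)\bmod1,\dots,x_{d-1})$. Reconstructing lattice. For $\mathbf z\in[M]^d$, $\Lambda(\mathbf z,M)=\{\frac jM\mathbf z\bmod1\mid j\in[M]\}$; it is reconstructing for $\mathcal{I}$ if $\mathbf k\mapsto\mathbf k\cdot\mathbf z\bmod M$ is injective on $\mathcal{I}$. Phase Encoding algorithm (with univariate SFT $\mathcal{A}$, an algorithm that takes point samples of a univariate function and returns a sparse vector in $\mathbb{C}^M$). (i) Apply $\mathcal{A}$ to $a(t)=f(t\mathbf z)$ to produce $\mathbf v$. (ii) For every $\ell\in[d]$ apply $\mathcal{A}$ to $a^\ell(t)=(S_{\ell,1/N}f)(t\mathbf z)$ to produce $\mathbf v^\ell$. (iii) Set $\mathbf b=(b_{\mathbf k})_{\mathbf k\in\mathcal{B}_N^d}\leftarrow\mathbf 0$. For every $\omega\in\operatorname{supp}(\mathbf v)\subset\mathcal{B}_M$: for every $\ell\in[d]$ set $(k_\omega)_\ell\leftarrow\operatorname{round}(N\arg(v^\ell_\omega/v_\omega)/(2\pi))$, taken as the representative modulo $N$ in $\mathcal{B}_N$ (with an arbitrary value if $v_\omega^\ell=0$); then, if $\mathbf k_\omega\cdot\mathbf z\equiv\omega\pmod M$, set $b_{\mathbf k_\omega}\leftarrow b_{\mathbf k_\omega}+v_\omega$. Output $\mathbf b$. The univariate SFT. $\mathcal{A}^{\mathrm{disc}}_{2s,M}$ with parameter $r$ is a deterministic algorithm which, for every $a\in\mathcal{W}(\mathbb{T})\cap C(\mathbb{T})$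 with noise $\mu:\mathbb{T}\to\mathbb{C}$, from equispaced samples of $a+\mu$ at points $j/M$ outputs a $2s$-sparse $\mathbf v\in\mathbb{C}^M$ such that, with $\boldsymbol\mu=(\mu(j/M))_{j\in[M]}$ and $\delta:=\frac{\|\mathbf F_M\mathbf a-(\mathbf F_M\mathbf a)_s^{\mathrm{opt}}\|_1}{2s}+2(\|\mathbf a\|_\infty M^{-r}+\|\boldsymbol\mu\|_\infty)$: (1) every $\omega\in\mathcal{B}_M$ with $|(\mathbf F_M\mathbf a)_\omega|>12(1+\sqrt2)\delta$ lies in $\operatorname{supp}(\mathbf v)$; (2) $\|(\mathbf F_M\mathbf a-\mathbf v)|_{\operatorname{supp}(\mathbf v)}\|_\infty\le3\sqrt2\,\delta$; (3) $\|\mathbf F_M\mathbf a-\mathbf v\|_2\le\|\mathbf F_M\mathbf a-(\mathbf F_M\mathbf a)_{2s}^{\mathrm{opt}}\|_2+38\|\mathbf F_M\mathbf a-(\mathbf F_M\mathbf a)_s^{\mathrm{opt}}\|_1/\sqrt s+152\sqrt s(\|\mathbf a\|_\infty M^{-r}+\|\boldsymbol\mu\|_\infty)$; (4) the number of samples and operations is $\mathcal{O}(s^2r^{3/2}\log^{11/2}M/\log s)$. $\mathcal{A}^{\mathrm{disc,MC}}_{2s,M}$ is a randomized variant which, for prescribed $\sigma'\in(0,1/3]$, satisfies (1)–(3) simultaneously with probability $1-\sigma'$ using $\mathcal{O}(s\,r^{3/2}\log^{9/2}(M)\log(M/\sigma'))$ samples and operations. *)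

theory Defs
  imports
    "HOL-Probability.Probability"
    "HOL-Number_Theory.Cong"
    "HOL-Library.Discrete_Functions"
    "HOL-Library.Monad_Syntax"
begin

section \<open>Sequences and finite vectors\<close>

text \<open>Vectors and sequences are functions extended by zero outside their index set.\<close>

definition supp :: "('i \<Rightarrow> complex) \<Rightarrow> 'i set" where
  "supp y = {i. y i \<noteq> 0}"

definition restr :: "'i set \<Rightarrow> ('i \<Rightarrow> complex) \<Rightarrow> 'i \<Rightarrow> complex" where
  "restr I y = (\<lambda>i. if i \<in> I then y i else 0)"

definition sparse_on :: "'i set \<Rightarrow> nat \<Rightarrow> ('i \<Rightarrow> complex) \<Rightarrow> bool" where
  "sparse_on A m y \<longleftrightarrow> supp y \<subseteq> A \<and> finite (supp y) \<and> card (supp y) \<le> m"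

text \<open>
  Norms over an index set. \<open>infsum\<close> is 0 for families that are not summable; below, the norms are
  applied only to finite vectors and to absolutely summable families.
\<close>

definition norm1 :: "'i set \<Rightarrow> ('i \<Rightarrow> complex) \<Rightarrow> real" where
  "norm1 A y = (\<Sum>\<^sub>\<infinity>i\<in>A. norm (y i))"

definition norm2 :: "'i set \<Rightarrow> ('i \<Rightarrow> complex) \<Rightarrow> real" where
  "norm2 A y = sqrt (\<Sum>\<^sub>\<infinity>i\<in>A. (norm (y i))\<^sup>2)"

text \<open>
  \<open>opt A s y\<close> keeps \<open>s\<close> largest entries of the finite vector \<open>(y i)\<close>, \<open>i \<in> A\<close>, or all of them if
  there are at most \<open>s\<close>. Ties are broken arbitrarily, which does not affect the norm of the remainder.
\<close>

definition opt :: "'i set \<Rightarrow> nat \<Rightarrow> ('i \<Rightarrow> complex) \<Rightarrow> 'i \<Rightarrow> complex" where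
  "opt A s y = restr (SOME S. S \<subseteq> A \<and> finite S \<and> (card S = s \<or> card S < s \<and> S = A) \<and>
                        (\<forall>i\<in>S. \<forall>j\<in>A - S. norm (y j) \<le> norm (y i))) y"


section \<open>Functions on the torus and Fourier coefficients\<close>

text \<open>
  As the dimension \<open>d\<close> is quantified inside the statement, points are functions \<open>nat \<Rightarrow> real\<close> of which
  only the coordinates below \<open>d\<close> matter. A function on the \<open>d\<close>-dimensional torus is one that respects
  equality modulo 1 of these coordinates; for such functions, continuity in the product topology is
  continuity on the torus.
\<close>

definition torus_fun :: "nat \<Rightarrow> ((nat \<Rightarrow> real) \<Rightarrow> complex) \<Rightarrow> bool" where
  "torus_fun d f \<longleftrightarrow> (\<forall>x y. (\<forall>l<d. x l - y l \<in> \<int>) \<longrightarrow> f x = f y)"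

definition torus :: "nat \<Rightarrow> (nat \<Rightarrow> real) measure" where
  "torus d = PiM {..<d} (\<lambda>_. restrict_space lborel {0..1})"

definition freqs :: "nat \<Rightarrow> (nat \<Rightarrow> int) set" where
  "freqs d = {..<d} \<rightarrow>\<^sub>E UNIV"

definition fourier_coeff :: "nat \<Rightarrow> ((nat \<Rightarrow> real) \<Rightarrow> complex) \<Rightarrow> (nat \<Rightarrow> int) \<Rightarrow> complex" where
  "fourier_coeff d f k = (LINT x|torus d. f x * cis (- 2 * pi * (\<Sum>l<d. real_of_int (k l) * x l)))"

definition continuous_torus :: "nat \<Rightarrow> ((nat \<Rightarrow> real) \<Rightarrow> complex) set" where
  "continuous_torus d = {f. torus_fun d f \<and> continuous_on UNIV f}"

definition wiener :: "nat \<Rightarrow> ((nat \<Rightarrow> real) \<Rightarrow> complex) set" where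
  "wiener d = {f. torus_fun d f \<and> integrable (torus d) f \<and>
                  (\<lambda>k. norm (fourier_coeff d f k)) summable_on freqs d}"

definition sup_norm :: "((nat \<Rightarrow> real) \<Rightarrow> complex) \<Rightarrow> real" where
  "sup_norm f = (SUP x. norm (f x))"

definition band :: "nat \<Rightarrow> int set" where
  "band N = {- \<lceil>real N / 2\<rceil> <.. \<lfloor>real N / 2\<rfloor>}"

definition cube :: "nat \<Rightarrow> nat \<Rightarrow> (nat \<Rightarrow> int) set" where
  "cube d N = {..<d} \<rightarrow>\<^sub>E band N"

definition wrap :: "nat \<Rightarrow> int \<Rightarrow> int" where
  "wrap N j = (THE k. k \<in> band N \<and> [k = j] (mod int N))"

text \<open>\<open>(z, M)\<close> generates a reconstructing rank-1 lattice for \<open>I\<close>.\<close>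

definition reconstructing :: "nat \<Rightarrow> (nat \<Rightarrow> nat) \<Rightarrow> nat \<Rightarrow> (nat \<Rightarrow> int) set \<Rightarrow> bool" where
  "reconstructing d z M I \<longleftrightarrow>
     (\<forall>l<d. z l < M) \<and> inj_on (\<lambda>k. (\<Sum>l<d. k l * int (z l)) mod int M) I"


section \<open>Algorithms with access to function samples\<close>

text \<open>
  An algorithm is a decision tree. \<open>Sample p k\<close> requests the value at \<open>p\<close> and continues with
  \<open>k\<close> applied to the answer, \<open>Tick n q\<close> spends \<open>n\<close> elementary operations (real or complex arithmetic,
  argument, rounding, comparison, each at unit cost), and \<open>Rand D k\<close> makes a random choice. Forming the
  argument of a sample is part of the evaluation, which counts as one operation, as does a random
  choice.
\<close>

datatype (points: 'p, results: 'a) prog =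
    Return 'a
  | Sample 'p "complex \<Rightarrow> ('p, 'a) prog"
  | Tick nat "('p, 'a) prog"
  | Rand "nat pmf" "nat \<Rightarrow> ('p, 'a) prog"
  for map: map_prog

primrec bind_prog :: "('p, 'a) prog \<Rightarrow> ('a \<Rightarrow> ('p, 'b) prog) \<Rightarrow> ('p, 'b) prog" where
  "bind_prog (Return x) g = g x"
| "bind_prog (Sample p k) g = Sample p (\<lambda>y. bind_prog (k y) g)"
| "bind_prog (Tick n q) g = Tick n (bind_prog q g)"
| "bind_prog (Rand D k) g = Rand D (\<lambda>i. bind_prog (k i) g)"

adhoc_overloading Monad_Syntax.bind \<rightleftharpoons> bind_prog

primrec deterministic :: "('p, 'a) prog \<Rightarrow> bool" where
  "deterministic (Return x) \<longleftrightarrow> True"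
| "deterministic (Sample p k) \<longleftrightarrow> (\<forall>y. deterministic (k y))"
| "deterministic (Tick n q) \<longleftrightarrow> deterministic q"
| "deterministic (Rand D k) \<longleftrightarrow> False"

text \<open>
  The joint distribution of the output, the number of samples and the number of operations when
  samples are answered by \<open>y\<close>.
\<close>

primrec run :: "('p \<Rightarrow> complex) \<Rightarrow> ('p, 'a) prog \<Rightarrow> ('a \<times> nat \<times> nat) pmf" where
  "run y (Return x) = return_pmf (x, 0, 0)"
| "run y (Sample p k) = map_pmf (\<lambda>(x, n, t). (x, Suc n, Suc t)) (run y (k (y p)))"
| "run y (Tick m q) = map_pmf (\<lambda>(x, n, t). (x, n, m + t)) (run y q)"
| "run y (Rand D k) = bind_pmf D (\<lambda>i. map_pmf (\<lambda>(x, n, t). (x, n, Suc t)) (run y (k i)))"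

primrec mapM :: "('b \<Rightarrow> ('p, 'a) prog) \<Rightarrow> 'b list \<Rightarrow> ('p, 'a list) prog" where
  "mapM g [] = Return []"
| "mapM g (x # xs) = do { y \<leftarrow> g x; ys \<leftarrow> mapM g xs; Return (y # ys) }"

primrec foldM :: "('b \<Rightarrow> 's \<Rightarrow> ('p, 's) prog) \<Rightarrow> 'b list \<Rightarrow> 's \<Rightarrow> ('p, 's) prog" where
  "foldM g [] s = Return s"
| "foldM g (x # xs) s = do { s' \<leftarrow> g x s; foldM g xs s' }"


section \<open>The univariate sparse Fourier transform\<close>

definition dft :: "nat \<Rightarrow> (real \<Rightarrow> complex) \<Rightarrow> int \<Rightarrow> complex" where
  "dft M a \<omega> =
     (\<Sum>j<M. a (real j / real M) * cis (- 2 * pi * real_of_int \<omega> * real j / real M)) / of_nat M"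

definition max_norm :: "nat \<Rightarrow> (real \<Rightarrow> complex) \<Rightarrow> real" where
  "max_norm M a = (MAX j\<in>{..<M}. norm (a (real j / real M)))"

definition sft_delta :: "nat \<Rightarrow> nat \<Rightarrow> real \<Rightarrow> (real \<Rightarrow> complex) \<Rightarrow> (real \<Rightarrow> complex) \<Rightarrow> real" where
  "sft_delta s M r a \<mu> =
     norm1 (band M) (\<lambda>\<omega>. dft M a \<omega> - opt (band M) s (dft M a) \<omega>) / (2 * real s)
     + 2 * (max_norm M a * real M powr (- r) + max_norm M \<mu>)"

definition sft_guarantee ::
  "nat \<Rightarrow> nat \<Rightarrow> real \<Rightarrow> (real \<Rightarrow> complex) \<Rightarrow> (real \<Rightarrow> complex) \<Rightarrow> (int \<Rightarrow> complex) \<Rightarrow> bool" where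
  "sft_guarantee s M r a \<mu> v \<longleftrightarrow>
     (\<forall>\<omega>\<in>band M. norm (dft M a \<omega>) > 12 * (1 + sqrt 2) * sft_delta s M r a \<mu> \<longrightarrow> \<omega> \<in> supp v) \<and>
     (\<forall>\<omega>\<in>supp v. norm (dft M a \<omega> - v \<omega>) \<le> 3 * sqrt 2 * sft_delta s M r a \<mu>) \<and>
     norm2 (band M) (\<lambda>\<omega>. dft M a \<omega> - v \<omega>)
       \<le> norm2 (band M) (\<lambda>\<omega>. dft M a \<omega> - opt (band M) (2 * s) (dft M a) \<omega>)
         + 38 * norm1 (band M) (\<lambda>\<omega>. dft M a \<omega> - opt (band M) s (dft M a) \<omega>) / sqrt (real s)
         + 152 * sqrt (real s) * (max_norm M a * real M powr (- r) + max_norm M \<mu>)"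

definition sft_params :: "nat \<Rightarrow> nat \<Rightarrow> real \<Rightarrow> bool" where
  "sft_params s M r \<longleftrightarrow> 1 \<le> s \<and> 2 * s \<le> M \<and> 1 \<le> r \<and> r \<le> real M / 36"

definition wiener_continuous1 :: "(real \<Rightarrow> complex) \<Rightarrow> bool" where
  "wiener_continuous1 a \<longleftrightarrow> (\<lambda>x. a (x 0)) \<in> wiener 1 \<inter> continuous_torus 1"

text \<open>
  In the next two definitions the samples are answered by \<open>a + \<mu>\<close>. The asymptotic bound of the
  deterministic variant has \<open>log s\<close> as denominator and hence makes no claim for \<open>s = 1\<close>.
\<close>

definition disc_sft :: "(nat \<Rightarrow> nat \<Rightarrow> real \<Rightarrow> (real, int \<Rightarrow> complex) prog) \<Rightarrow> bool" where
  "disc_sft A \<longleftrightarrow>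
     (\<forall>s M r. sft_params s M r \<longrightarrow>
        deterministic (A s M r) \<and> points (A s M r) \<subseteq> (\<lambda>j. real j / real M) ` {..<M} \<and>
        (\<forall>a \<mu>. wiener_continuous1 a \<longrightarrow>
           (\<forall>(v, n, t) \<in> set_pmf (run (\<lambda>x. a x + \<mu> x) (A s M r)).
              sparse_on (band M) (2 * s) v \<and> sft_guarantee s M r a \<mu> v))) \<and>
     (\<exists>C. \<forall>s M r a \<mu>. sft_params s M r \<and> 2 \<le> s \<and> wiener_continuous1 a \<longrightarrow>
        (\<forall>(v, n, t) \<in> set_pmf (run (\<lambda>x. a x + \<mu> x) (A s M r)).
           (let bound = C * ((real s)\<^sup>2 * r powr (3/2) * ln (real M) powr (11/2) / ln (real s))
            in real n \<le> bound \<and> real t \<le> bound)))"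

text \<open>The last argument of the Monte Carlo variant is its failure probability.\<close>

definition mc_sft :: "(nat \<Rightarrow> nat \<Rightarrow> real \<Rightarrow> real \<Rightarrow> (real, int \<Rightarrow> complex) prog) \<Rightarrow> bool" where
  "mc_sft A \<longleftrightarrow>
     (\<forall>s M r p. sft_params s M r \<and> 0 < p \<and> p \<le> 1/3 \<longrightarrow>
        points (A s M r p) \<subseteq> (\<lambda>j. real j / real M) ` {..<M} \<and>
        (\<forall>a \<mu>. wiener_continuous1 a \<longrightarrow>
           (\<forall>(v, n, t) \<in> set_pmf (run (\<lambda>x. a x + \<mu> x) (A s M r p)). sparse_on (band M) (2 * s) v) \<and>
           measure_pmf.prob (run (\<lambda>x. a x + \<mu> x) (A s M r p))
             {(v, n, t). sft_guarantee s M r a \<mu> v} \<ge> 1 - p)) \<and>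
     (\<exists>C. \<forall>s M r p a \<mu>. sft_params s M r \<and> 0 < p \<and> p \<le> 1/3 \<and> wiener_continuous1 a \<longrightarrow>
        (\<forall>(v, n, t) \<in> set_pmf (run (\<lambda>x. a x + \<mu> x) (A s M r p)).
           (let bound = C * (real s * r powr (3/2) * ln (real M) powr (9/2) * ln (real M / p))
            in real n \<le> bound \<and> real t \<le> bound)))"


section \<open>Phase encoding\<close>

text \<open>
  Every evaluation of \<open>f\<close> carries, besides its point, a label: the number of the univariate transform
  (0 for the unshifted one, \<open>Suc l\<close> for the shift in coordinate \<open>l\<close>) and the univariate node. The label
  only serves to let the noise differ between evaluations at the same point.
\<close>

type_synonym query = "(nat \<times> real) \<times> (nat \<Rightarrow> real)"

definition noisy :: "((nat \<Rightarrow> real) \<Rightarrow> complex) \<Rightarrow> (nat \<times> real \<Rightarrow> complex) \<Rightarrow> query \<Rightarrow> complex" where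
  "noisy f e = (\<lambda>(q, x). f x + e q)"

definition shift_point :: "nat \<Rightarrow> real \<Rightarrow> (nat \<Rightarrow> real) \<Rightarrow> nat \<Rightarrow> real" where
  "shift_point l \<alpha> x = x(l := frac (x l + \<alpha>))"

definition lattice_line :: "(nat \<Rightarrow> nat) \<Rightarrow> real \<Rightarrow> nat \<Rightarrow> real" where
  "lattice_line z t = (\<lambda>l. t * real (z l))"

definition query0 :: "(nat \<Rightarrow> nat) \<Rightarrow> real \<Rightarrow> query" where
  "query0 z t = ((0, t), lattice_line z t)"

definition query_shifted :: "nat \<Rightarrow> (nat \<Rightarrow> nat) \<Rightarrow> nat \<Rightarrow> real \<Rightarrow> query" where
  "query_shifted N z l t = ((Suc l, t), shift_point l (1 / real N) (lattice_line z t))"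

text \<open>
  Sparse vectors are kept in balanced search trees: access to an entry costs one key comparison per
  level, and comparing two keys of length \<open>d\<close> costs \<open>d\<close> operations.
\<close>

definition access_cost :: "(int \<Rightarrow> complex) \<Rightarrow> nat" where
  "access_cost v = Suc (floor_log (card (supp v)))"

definition lookup :: "(int \<Rightarrow> complex) \<Rightarrow> int \<Rightarrow> ('p, complex) prog" where
  "lookup v \<omega> = Tick (access_cost v) (Return (v \<omega>))"

text \<open>\<open>u\<close> is the entry \<open>v\<^sub>\<omega>\<close>, and \<open>arb\<close> supplies the arbitrary value used if the shifted entry is 0.\<close>

definition freq_coordinate ::
  "nat \<Rightarrow> (nat \<Rightarrow> int \<Rightarrow> int) \<Rightarrow> (int \<Rightarrow> complex) list \<Rightarrow> int \<Rightarrow> complex \<Rightarrow> nat \<Rightarrow> ('p, int) prog" where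
  "freq_coordinate N arb vs \<omega> u l = do {
     w \<leftarrow> lookup (vs ! l) \<omega>;
     if w = 0 then Tick 1 (Return (arb l \<omega>))
     else Tick 8 (Return (wrap N (round (real N * Arg (w / u) / (2 * pi))))) }"

text \<open>
  The congruence test takes \<open>d\<close> multiplications, \<open>d\<close> additions, a reduction and a comparison. As \<open>b\<close>
  never has more entries than \<open>v\<close>, the size of \<open>v\<close> bounds the cost of updating \<open>b\<close>.
\<close>

definition add_frequency ::
  "nat \<Rightarrow> nat \<Rightarrow> (nat \<Rightarrow> nat) \<Rightarrow> nat \<Rightarrow> (nat \<Rightarrow> int \<Rightarrow> int) \<Rightarrow> (int \<Rightarrow> complex) \<Rightarrow>
   (int \<Rightarrow> complex) list \<Rightarrow> int \<Rightarrow> ((nat \<Rightarrow> int) \<Rightarrow> complex) \<Rightarrow> ('p, (nat \<Rightarrow> int) \<Rightarrow> complex) prog" where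
  "add_frequency d N z M arb v vs \<omega> b = do {
     u \<leftarrow> lookup v \<omega>;
     ks \<leftarrow> mapM (freq_coordinate N arb vs \<omega> u) [0..<d];
     let k = restrict (\<lambda>l. ks ! l) {..<d};
     Tick (2 * d + 2)
       (if [(\<Sum>l<d. k l * int (z l)) = \<omega>] (mod int M)
        then Tick (d * access_cost v + 2) (Return (b(k := b k + u)))
        else Return b) }"

definition phase_encoding ::
  "nat \<Rightarrow> nat \<Rightarrow> (nat \<Rightarrow> nat) \<Rightarrow> nat \<Rightarrow> (nat \<Rightarrow> int \<Rightarrow> int) \<Rightarrow> (real, int \<Rightarrow> complex) prog \<Rightarrow>
   (query, (nat \<Rightarrow> int) \<Rightarrow> complex) prog" where
  "phase_encoding d N z M arb sft = do {
     v \<leftarrow> map_prog (query0 z) id sft;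
     vs \<leftarrow> mapM (\<lambda>l. map_prog (query_shifted N z l) id sft) [0..<d];
     foldM (add_frequency d N z M arb v vs) (sorted_list_of_set (supp v)) (\<lambda>_. 0) }"

definition pe_setting ::
  "nat \<Rightarrow> nat \<Rightarrow> (nat \<Rightarrow> nat) \<Rightarrow> nat \<Rightarrow> (nat \<Rightarrow> int) set \<Rightarrow> ((nat \<Rightarrow> real) \<Rightarrow> complex) \<Rightarrow>
   (nat \<times> real \<Rightarrow> complex) \<Rightarrow> real \<Rightarrow> (nat \<Rightarrow> int \<Rightarrow> int) \<Rightarrow> bool" where
  "pe_setting d N z M I f e \<eta> arb \<longleftrightarrow>
     1 \<le> d \<and> 9 \<le> N \<and> I \<subseteq> cube d N \<and> reconstructing d z M I \<and>
     f \<in> wiener d \<inter> continuous_torus d \<and>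
     0 \<le> \<eta> \<and> (\<forall>q. norm (e q) \<le> \<eta>) \<and>
     (\<forall>l \<omega>. arb l \<omega> \<in> band N)"

definition pe_error_bound ::
  "nat \<Rightarrow> nat \<Rightarrow> nat \<Rightarrow> (nat \<Rightarrow> int) set \<Rightarrow> ((nat \<Rightarrow> real) \<Rightarrow> complex) \<Rightarrow> real \<Rightarrow> nat \<Rightarrow> real \<Rightarrow>
   ((nat \<Rightarrow> int) \<Rightarrow> complex) \<Rightarrow> bool" where
  "pe_error_bound d N M I f \<eta> s r b \<longleftrightarrow>
     (let c = fourier_coeff d f; c\<^sub>I = restr I c in
      norm2 (freqs d) (\<lambda>k. b k - c k)
        \<le> norm2 (freqs d) (\<lambda>k. c k - c\<^sub>I k)
          + (48 + 4 * real N) * (norm1 (freqs d) (\<lambda>k. c\<^sub>I k - opt I s c\<^sub>I k) / sqrt (real s))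
          + (188 + 16 * real N) * sqrt (real s)
            * (sup_norm f * real M powr (- r) + norm1 (freqs d) (\<lambda>k. c k - c\<^sub>I k) + \<eta>))"

end

theory Submission
  imports Defs
begin

text \<open>
  By Fourier inversion, the restriction of \<open>f\<close> to the lattice line has the Fourier coefficients of \<open>f\<close>
  transported along \<open>k \<mapsto> k \<cdot> z\<close>, and a shift by \<open>1 / N\<close> in coordinate \<open>l\<close> multiplies the coefficient of
  \<open>k\<close> by \<open>cis (2 pi k\<^sub>l / N)\<close>. The lattice is reconstructing, so up to an aliasing error of total mass
  \<open>\<parallel>c - c\<^sub>I\<parallel>\<^sub>1\<close> the discrete transforms are injective images of \<open>c\<^sub>I\<close> and its modulations. Where a
  coefficient exceeds a threshold of order \<open>N\<close> times the accuracy of the univariate transforms, the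
  quotient of shifted and unshifted entry determines the phase up to less than \<open>pi / N\<close>, and rounding
  returns \<open>k\<^sub>l\<close>. The at most \<open>2 s\<close> entries of \<open>v\<close> below the threshold contribute the terms with factor
  \<open>N\<close> to the error. For the Monte Carlo variant, a union bound over the \<open>d + 1\<close> transforms with failure
  probability \<open>\<sigma> / (3 d)\<close> each gives \<open>\<sigma>\<close>.
\<close>

section \<open>Runs of programs\<close>

text \<open>Samples are point values, so the inversion formula is needed at every point and not
  merely almost everywhere; hence the uniqueness of Fourier coefficients for continuous functions on
  the product model of the torus. All \<open>d + 1\<close> transforms see coefficients of the same
  magnitudes, so one estimate for a family \<open>g\<close> with
  \<open>norm (g k) = norm (c k)\<close> covers them. The obstacle in the assembly is that a small
  coefficient may be recovered at any frequency, even outside \<open>I\<close>. A misplaced entry of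
  \<open>v\<close> can cost twice: where it appears and where it is missing. These two sets have at
  most \<open>2 * s\<close> members each, whence the factor \<open>sqrt (4 * s)\<close>; the rest of
  the error is a copy of part of the univariate error, because the lattice values involved are
  distinct. The tolerance \<open>3 / N\<close> is a rational lower bound of
  \<open>sin (pi / N)\<close>, the distance of 1 from the rays of angle \<open>pi / N\<close>. Both
  variants share one argument: a sure event is one of failure probability 0.\<close>

lemma run_bind:
  "run y (bind_prog p g) = bind_pmf (run y p)
     (\<lambda>(x, n, t). map_pmf (\<lambda>(x', n', t'). (x', n + n', t + t')) (run y (g x)))"
proof (induction p)
  case (Return x)
  then show ?case by (simp add: bind_return_pmf case_prod_unfold pmf.map_ident)
next
  case (Sample p k)
  then show ?case
    by (simp add: map_bind_pmf bind_map_pmf pmf.map_comp o_def case_prod_unfold)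
next
  case (Tick n q)
  then show ?case
    by (simp add: map_bind_pmf bind_map_pmf pmf.map_comp o_def case_prod_unfold add.assoc)
next
  case (Rand D k)
  then show ?case
    by (simp add: map_bind_pmf bind_map_pmf bind_assoc_pmf pmf.map_comp o_def case_prod_unfold)
qed

lemma run_map_prog:
  "run y (map_prog h g p) = map_pmf (\<lambda>(x, n, t). (g x, n, t)) (run (y \<circ> h) p)"
  by (induction p)
     (simp_all add: map_bind_pmf bind_map_pmf pmf.map_comp o_def case_prod_unfold)

text \<open>The support of a run contains every outcome of the random choices, so this is a
  worst-case statement. It carries the claims on sparsity and cost, which must also hold on runs of
  the Monte Carlo variant that miss the error bound.\<close>

definition always :: "('p \<Rightarrow> complex) \<Rightarrow> ('p, 'a) prog \<Rightarrow> ('a \<Rightarrow> nat \<Rightarrow> nat \<Rightarrow> bool) \<Rightarrow> bool" where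
  "always y p P \<longleftrightarrow> (\<forall>(x, n, t) \<in> set_pmf (run y p). P x n t)"

lemma always_mono: "always y p P \<Longrightarrow> (\<And>x n t. P x n t \<Longrightarrow> Q x n t) \<Longrightarrow> always y p Q"
  by (auto simp: always_def)

lemma always_bind:
  assumes "always y p P"
    and "\<And>x n t. P x n t \<Longrightarrow> always y (g x) (\<lambda>x' n' t'. Q x' (n + n') (t + t'))"
  shows "always y (bind_prog p g) Q"
  using assms by (fastforce simp: always_def run_bind)

lemma always_mapM:
  fixes B :: real
  assumes "\<And>x. x \<in> set xs \<Longrightarrow> always y (g x) (\<lambda>v n t. P x v \<and> real n \<le> B \<and> real t \<le> B)"
  shows "always y (mapM g xs)
           (\<lambda>vs n t. list_all2 P xs vs \<and> real n \<le> length xs * B \<and> real t \<le> length xs * B)"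
  using assms
proof (induction xs)
  case Nil
  then show ?case by (simp add: always_def)
next
  case (Cons x xs)
  show ?case unfolding mapM.simps
    by (rule always_bind[OF Cons.prems[of x]], simp,
        rule always_bind[OF Cons.IH[OF Cons.prems]])
       (auto simp: always_def algebra_simps)
qed

text \<open>The complementary event is measured because bounds on bad events add up along a
  program.\<close>

definition failure :: "('p \<Rightarrow> complex) \<Rightarrow> ('p, 'a) prog \<Rightarrow> ('a \<Rightarrow> bool) \<Rightarrow> real" where
  "failure y p Q = measure_pmf.prob (run y p) {(x, n, t). \<not> Q x}"

lemma failure_mono: "(\<And>x. P x \<Longrightarrow> Q x) \<Longrightarrow> failure y p Q \<le> failure y p P"
  unfolding failure_def by (rule measure_pmf.finite_measure_mono) auto

text \<open>Every point in the support of a \<open>pmf\<close> has positive mass, so probability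
  zero means never. Sure statements thereby become the case \<open>\<epsilon> = 0\<close> of the
  probabilistic rules.\<close>

lemma failure_le_zero_iff: "failure y p Q \<le> 0 \<longleftrightarrow> always y p (\<lambda>x n t. Q x)"
proof -
  have "failure y p Q \<le> 0 \<longleftrightarrow> failure y p Q = 0"
    unfolding failure_def by (smt (verit) measure_nonneg)
  also have "\<dots> \<longleftrightarrow> always y p (\<lambda>x n t. Q x)"
    unfolding failure_def always_def by (subst measure_pmf_zero_iff) auto
  finally show ?thesis .
qed

lemma prob_success: "measure_pmf.prob (run y p) {(x, n, t). Q x} = 1 - failure y p Q"
proof -
  have "measure_pmf.prob (run y p) {(x, n, t). Q x} =
        measure_pmf.prob (run y p) (- {(x, n, t). \<not> Q x})"
    by (rule arg_cong[where f = "measure_pmf.prob _"]) auto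
  then show ?thesis
    unfolding failure_def
    using measure_pmf.prob_compl[of "{(x, n, t). \<not> Q x}" "run y p"]
    by (simp add: Compl_eq_Diff_UNIV)
qed

text \<open>Union bound: a failing run either fails \<open>P\<close> in the first stage, or meets
  \<open>P\<close> there and fails in the continuation. Pointwise, the continuation fails with
  probability at most 1 on the bad event and at most \<open>\<epsilon>2\<close> off it; integrating
  over the first stage gives the sum.\<close>

lemma failure_bind:
  assumes P: "failure y p P \<le> \<epsilon>1" and "0 \<le> \<epsilon>2"
    and Q: "\<And>x. P x \<Longrightarrow> failure y (g x) Q \<le> \<epsilon>2"
  shows "failure y (bind_prog p g) Q \<le> \<epsilon>1 + \<epsilon>2"
proof -
  let ?B = "{(x, n::nat, t::nat). \<not> P x}" and ?C = "{(x, n::nat, t::nat). \<not> Q x}"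
  let ?f = "\<lambda>(x, n, t). map_pmf (\<lambda>(x', n', t'). (x', n + n', t + t')) (run y (g x))"
  have *: "emeasure (measure_pmf (?f \<omega>)) ?C \<le> indicator ?B \<omega> + ennreal \<epsilon>2" for \<omega>
  proof (cases "\<omega> \<in> ?B")
    case True
    then show ?thesis
      using measure_pmf.emeasure_le_1[of "?f \<omega>" ?C] by (simp add: add_increasing2)
  next
    case False
    obtain x n t where \<omega>: "\<omega> = (x, n, t)" by (cases \<omega>)
    have "emeasure (measure_pmf (?f \<omega>)) ?C = ennreal (failure y (g x) Q)"
      unfolding \<omega> failure_def
      by (simp add: measure_pmf.emeasure_eq_measure vimage_def case_prod_unfold)
    with False Q[of x] \<omega> show ?thesis by (simp add: ennreal_leI)
  qed
  have "ennreal (failure y (bind_prog p g) Q) = (\<integral>\<^sup>+\<omega>. emeasure (measure_pmf (?f \<omega>)) ?C \<partial>run y p)"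
    unfolding failure_def run_bind by (simp flip: measure_pmf.emeasure_eq_measure)
  also have "\<dots> \<le> (\<integral>\<^sup>+\<omega>. indicator ?B \<omega> + ennreal \<epsilon>2 \<partial>run y p)"
    by (intro nn_integral_mono *)
  also have "\<dots> = ennreal (failure y p P) + ennreal \<epsilon>2"
    by (subst nn_integral_add) (simp_all add: failure_def measure_pmf.emeasure_eq_measure)
  also have "\<dots> = ennreal (failure y p P + \<epsilon>2)"
    using assms(2) by (intro ennreal_plus[symmetric]) (auto simp: failure_def)
  also have "\<dots> \<le> ennreal (\<epsilon>1 + \<epsilon>2)"
    using P by (intro ennreal_leI add_mono) auto
  finally have "ennreal (failure y (bind_prog p g) Q) \<le> ennreal (\<epsilon>1 + \<epsilon>2)" .
  \<comment> \<open>\<open>ennreal\<close> maps negative numbers to 0, so the comparison returns to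
    the reals only for a nonnegative right-hand side; \<open>\<epsilon>1\<close> is nonnegative as
    it bounds a probability.\<close>
  moreover have "0 \<le> \<epsilon>1 + \<epsilon>2"
    using order_trans[OF _ P, of 0] assms(2) by (simp add: failure_def)
  ultimately show ?thesis by (rule ennreal_le_iff[THEN iffD1, rotated])
qed

lemma failure_Return: "Q x \<Longrightarrow> failure y (Return x) Q = 0"
  by (simp add: failure_def)

lemma failure_mapM:
  fixes \<epsilon> :: real
  assumes "0 \<le> \<epsilon>" and "\<And>x. x \<in> set xs \<Longrightarrow> failure y (g x) (P x) \<le> \<epsilon>"
  shows "failure y (mapM g xs) (list_all2 P xs) \<le> length xs * \<epsilon>"
  using assms(2)
proof (induction xs)
  case Nil
  then show ?case by (simp add: failure_Return)
next
  case (Cons x xs)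
  have "failure y (mapM g xs \<bind> (\<lambda>vs. Return (v # vs))) (list_all2 P (x # xs)) \<le> length xs * \<epsilon> + 0"
    if "P x v" for v
    using Cons that by (intro failure_bind[where P = "list_all2 P xs"]) (auto simp: failure_Return)
  then have "failure y (mapM g (x # xs)) (list_all2 P (x # xs)) \<le> \<epsilon> + length xs * \<epsilon>"
    unfolding mapM.simps using Cons.prems assms(1)
    by (intro failure_bind[where P = "P x"]) auto
  then show ?case by (simp add: algebra_simps)
qed

text \<open>Decoding the phases neither samples nor randomizes, so its run is a point mass. This
  predicate yields the matching \<open>always\<close> and \<open>failure\<close> statements;
  \<open>m\<close> is only an upper bound for the operations.\<close>

definition computes :: "('p \<Rightarrow> complex) \<Rightarrow> ('p, 'a) prog \<Rightarrow> 'a \<Rightarrow> nat \<Rightarrow> bool" where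
  "computes y p x m \<longleftrightarrow> (\<exists>t\<le>m. run y p = return_pmf (x, 0, t))"

lemma computes_Return: "computes y (Return x) x m"
  by (simp add: computes_def)

lemma computes_Tick: "computes y p x m \<Longrightarrow> computes y (Tick n p) x (n + m)"
  by (auto simp: computes_def)

lemma computes_mono: "computes y p x m \<Longrightarrow> m \<le> m' \<Longrightarrow> computes y p x m'"
  by (auto simp: computes_def)

lemma computes_bind:
  "computes y p x m \<Longrightarrow> computes y (g x) x' m' \<Longrightarrow> computes y (bind_prog p g) x' (m + m')"
  by (auto simp: computes_def run_bind bind_return_pmf intro: add_mono)

lemma computes_mapM:
  assumes "\<And>x. x \<in> set xs \<Longrightarrow> computes y (g x) (h x) m"
  shows "computes y (mapM g xs) (map h xs) (length xs * m)"
  using assms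
proof (induction xs)
  case Nil
  then show ?case by (simp add: computes_Return)
next
  case (Cons x xs)
  have "computes y (mapM g (x # xs)) (map h (x # xs)) (m + (length xs * m + 0))"
    unfolding mapM.simps list.map using Cons
    by (intro computes_bind[where x = "h x"] computes_bind[where x = "map h xs"] computes_Return) auto
  then show ?case by simp
qed

lemma computes_foldM:
  assumes "\<And>x s. x \<in> set xs \<Longrightarrow> computes y (g x s) (h x s) m"
  shows "computes y (foldM g xs s) (fold h xs s) (length xs * m)"
  using assms
proof (induction xs arbitrary: s)
  case Nil
  then show ?case by (simp add: computes_Return)
next
  case (Cons x xs)
  then have "computes y (foldM g (x # xs) s) (fold h (x # xs) s) (m + length xs * m)"
    unfolding foldM.simps fold.simps o_def
    by (intro computes_bind[where x = "h x s"]) auto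
  then show ?case by simp
qed

lemma always_computes: "computes y p x m \<Longrightarrow> always y p (\<lambda>x' n t. x' = x \<and> n = 0 \<and> t \<le> m)"
  by (auto simp: computes_def always_def)

lemma failure_computes: "computes y p x m \<Longrightarrow> Q x \<Longrightarrow> failure y p Q = 0"
  by (auto simp: computes_def failure_def)

section \<open>Best sparse approximation and sequence norms\<close>

lemma norm1_finite: "finite A \<Longrightarrow> norm1 A y = (\<Sum>i\<in>A. norm (y i))"
  by (simp add: norm1_def)

lemma norm2_finite: "finite A \<Longrightarrow> norm2 A y = L2_set (\<lambda>i. norm (y i)) A"
  by (simp add: norm2_def L2_set_def)

text \<open>Justifies the \<open>SOME\<close> in \<open>opt\<close>. Adding a largest remaining
  entry to a dominating set keeps it dominating.\<close>

lemma largest_entries_exist: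
  fixes y :: "'i \<Rightarrow> complex"
  assumes "finite A"
  shows "\<exists>S. S \<subseteq> A \<and> finite S \<and> (card S = s \<or> card S < s \<and> S = A) \<and>
             (\<forall>i\<in>S. \<forall>j\<in>A - S. norm (y j) \<le> norm (y i))"
proof (induction s)
  case 0
  then show ?case by (intro exI[of _ "{}"]) auto
next
  case (Suc s)
  then obtain S where S: "S \<subseteq> A" "finite S" "card S = s \<or> card S < s \<and> S = A"
    "\<forall>i\<in>S. \<forall>j\<in>A - S. norm (y j) \<le> norm (y i)" by blast
  show ?case
  proof (cases "S = A")
    case True
    then show ?thesis using S by (intro exI[of _ S]) auto
  next
    case False
    define m where "m = Max ((\<lambda>j. norm (y j)) ` (A - S))"
    have ne: "(\<lambda>j. norm (y j)) ` (A - S) \<noteq> {}" and fin: "finite ((\<lambda>j. norm (y j)) ` (A - S))"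
      using False S assms by auto
    obtain i where i: "i \<in> A - S" "norm (y i) = m"
      using Max_in[OF fin ne] by (auto simp: m_def)
    have "norm (y j) \<le> norm (y i)" if "j \<in> A - S" for j
      unfolding i(2) m_def using that fin by (intro Max_ge) auto
    then show ?thesis using i S False
      by (intro exI[of _ "insert i S"]) (auto simp: card_insert_disjoint)
  qed
qed

lemma optE:
  assumes "finite A"
  obtains S where "opt A s y = restr S y" "S \<subseteq> A" "card S = s \<or> card S < s \<and> S = A"
    "\<And>i j. i \<in> S \<Longrightarrow> j \<in> A - S \<Longrightarrow> norm (y j) \<le> norm (y i)"
  unfolding opt_def using someI_ex[OF largest_entries_exist[OF assms, of s y]] by blast

lemma sum_diff_restr:
  fixes g :: "real \<Rightarrow> real"
  assumes "finite A" "S \<subseteq> A" "g 0 = 0"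
  shows "(\<Sum>i\<in>A. g (norm (y i - restr S y i))) = (\<Sum>i\<in>A - S. g (norm (y i)))"
  using assms by (intro sum.mono_neutral_cong_right) (auto simp: restr_def)

text \<open>Exchange argument: \<open>T\<close> has no more elements than the chosen set
  \<open>S\<close>, so \<open>T - S\<close> injects into \<open>S - T\<close>, and every entry in
  \<open>S\<close> dominates every entry outside.\<close>

lemma opt_best:
  assumes "finite A" "T \<subseteq> A" "card T \<le> s"
  shows "norm1 A (\<lambda>i. y i - opt A s y i) \<le> (\<Sum>i\<in>A - T. norm (y i))"
proof -
  obtain S where S: "opt A s y = restr S y" "S \<subseteq> A" "card S = s \<or> card S < s \<and> S = A"
    "\<And>i j. i \<in> S \<Longrightarrow> j \<in> A - S \<Longrightarrow> norm (y j) \<le> norm (y i)"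
    using optE[OF assms(1)] by blast
  have fin: "finite S" "finite T" using assms S finite_subset by blast+
  have "norm1 A (\<lambda>i. y i - opt A s y i) = (\<Sum>i\<in>A - S. norm (y i))"
    using sum_diff_restr[of A S "\<lambda>x. x" y] S assms(1) by (simp add: norm1_finite)
  also have "\<dots> \<le> (\<Sum>i\<in>A - T. norm (y i))"
  proof (cases "S = A")
    case True
    then show ?thesis by (simp add: sum_nonneg)
  next
    case False
    then have "card T \<le> card S" using S assms by auto
    then have "card (T - S) \<le> card (S - T)"
      using fin by (metis card_le_sym_Diff)
    then obtain g where g: "inj_on g (T - S)" "g ` (T - S) \<subseteq> S - T"
      using fin card_le_inj[of "T - S" "S - T"] by auto
    have "(\<Sum>i\<in>T - S. norm (y i)) \<le> (\<Sum>i\<in>T - S. norm (y (g i)))"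
      using S(4) g assms by (intro sum_mono) blast
    also have "\<dots> = (\<Sum>i\<in>g ` (T - S). norm (y i))"
      using g by (simp add: sum.reindex)
    also have "\<dots> \<le> (\<Sum>i\<in>S - T. norm (y i))"
      using g fin by (intro sum_mono2) auto
    finally have *: "(\<Sum>i\<in>T - S. norm (y i)) \<le> (\<Sum>i\<in>S - T. norm (y i))" .
    have eq: "A - S = (A - S - T) \<union> (T - S)" "A - T = (A - S - T) \<union> (S - T)"
      using assms S by auto
    have "(\<Sum>i\<in>A - S. norm (y i)) = (\<Sum>i\<in>A - S - T. norm (y i)) + (\<Sum>i\<in>T - S. norm (y i))"
      by (subst eq(1), rule sum.union_disjoint) (use assms(1) fin in auto)
    moreover have "(\<Sum>i\<in>A - T. norm (y i)) = (\<Sum>i\<in>A - S - T. norm (y i)) + (\<Sum>i\<in>S - T. norm (y i))"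
      by (subst eq(2), rule sum.union_disjoint) (use assms(1) fin in auto)
    ultimately show ?thesis using * by linarith
  qed
  finally show ?thesis .
qed

text \<open>A Stechkin inequality. Let \<open>t\<close> be the \<open>s\<close>-term tail. At least
  \<open>s\<close> of the \<open>2 * s\<close> largest entries count towards \<open>t\<close>, so
  each entry beyond them is at most \<open>t / s\<close>. The sum of squares is then at most
  \<open>t / s\<close> times the remaining \<open>norm1\<close>, which is at most
  \<open>t\<close>.\<close>

lemma opt_tail:
  assumes "finite A" "1 \<le> s"
  shows "norm2 A (\<lambda>i. y i - opt A (2 * s) y i)
           \<le> norm1 A (\<lambda>i. y i - opt A s y i) / sqrt (real s)"
proof -
  obtain S where S: "opt A s y = restr S y" "S \<subseteq> A" "card S = s \<or> card S < s \<and> S = A"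
    using optE[OF assms(1)] by metis
  obtain S' where S': "opt A (2 * s) y = restr S' y" "S' \<subseteq> A"
    "card S' = 2 * s \<or> card S' < 2 * s \<and> S' = A"
    "\<And>i j. i \<in> S' \<Longrightarrow> j \<in> A - S' \<Longrightarrow> norm (y j) \<le> norm (y i)"
    using optE[OF assms(1)] by blast
  have fin: "finite S" "finite S'" using assms S S' finite_subset by blast+
  define t where "t = norm1 A (\<lambda>i. y i - opt A s y i)"
  have t: "t = (\<Sum>i\<in>A - S. norm (y i))"
    using sum_diff_restr[of A S "\<lambda>x. x" y] S assms(1) by (simp add: norm1_finite t_def)
  have t0: "0 \<le> t" by (simp add: t sum_nonneg)
  have small: "norm (y j) \<le> t / s" if j: "j \<in> A - S'" for j
  proof -
    have "card S' = 2 * s" using S'(3) j by auto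
    moreover have "card S \<le> s" using S by auto
    ultimately have "s \<le> card (S' - S)"
      using fin diff_card_le_card_Diff[of S S'] by linarith
    then have "real s * norm (y j) \<le> real (card (S' - S)) * norm (y j)"
      by (intro mult_right_mono) auto
    also have "\<dots> = (\<Sum>i\<in>S' - S. norm (y j))" by simp
    also have "\<dots> \<le> (\<Sum>i\<in>S' - S. norm (y i))" using S'(4) j by (intro sum_mono) auto
    also have "\<dots> \<le> t" unfolding t using S' assms by (intro sum_mono2) auto
    finally show ?thesis using assms(2) by (simp add: field_simps)
  qed
  have "(\<Sum>i\<in>A. (norm (y i - opt A (2 * s) y i))\<^sup>2) = (\<Sum>i\<in>A - S'. (norm (y i))\<^sup>2)"
    unfolding S'(1) using sum_diff_restr[of A S' "\<lambda>x. x\<^sup>2" y] S' assms(1) by simp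
  also have "\<dots> \<le> (\<Sum>i\<in>A - S'. t / s * norm (y i))"
    unfolding power2_eq_square using small by (intro sum_mono mult_right_mono) auto
  also have "\<dots> = t / s * (\<Sum>i\<in>A - S'. norm (y i))" by (simp add: sum_distrib_left)
  also have "(\<Sum>i\<in>A - S'. norm (y i)) = norm1 A (\<lambda>i. y i - opt A (2 * s) y i)"
    using sum_diff_restr[of A S' "\<lambda>x. x" y] S' assms(1) by (simp add: norm1_finite)
  also have "t / s * \<dots> \<le> t / s * t"
    unfolding t using S assms by (intro mult_left_mono opt_best) (auto simp: sum_nonneg)
  also have "\<dots> = (t / sqrt s)\<^sup>2" by (simp add: power_divide power2_eq_square)
  finally show ?thesis
    unfolding norm2_def t_def[symmetric] using assms(1) t0
    by (intro real_le_lsqrt) auto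
qed

lemma norm2_triangle:
  assumes x: "(\<lambda>i. (norm (x i))\<^sup>2) summable_on A" and y: "(\<lambda>i. (norm (y i))\<^sup>2) summable_on A"
  shows "norm2 A (\<lambda>i. x i + y i) \<le> norm2 A x + norm2 A y"
proof -
  have nonneg: "0 \<le> norm2 A x + norm2 A y"
    by (simp add: norm2_def infsum_nonneg)
  have "(\<Sum>\<^sub>\<infinity>i\<in>A. (norm (x i + y i))\<^sup>2) \<le> (norm2 A x + norm2 A y)\<^sup>2"
  proof (cases "(\<lambda>i. (norm (x i + y i))\<^sup>2) summable_on A")
    \<comment> \<open>A family that is not summable has \<open>infsum\<close> equal to 0, so the
      bound is trivial here.\<close>
    case False
    then show ?thesis by (simp add: infsum_not_exists)
  next
    case True
    then show ?thesis
    proof (rule infsum_le_finite_sums)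
      fix F assume F: "finite F" "F \<subseteq> A"
      have le: "L2_set (\<lambda>i. norm (w i)) F \<le> norm2 A w"
        if "(\<lambda>i. (norm (w i))\<^sup>2) summable_on A" for w :: "'a \<Rightarrow> complex"
        unfolding L2_set_def norm2_def using F that
        by (intro real_sqrt_le_mono finite_sum_le_infsum) auto
      have "L2_set (\<lambda>i. norm (x i + y i)) F \<le> L2_set (\<lambda>i. norm (x i) + norm (y i)) F"
        by (intro L2_set_mono norm_triangle_ineq) auto
      also have "\<dots> \<le> norm2 A x + norm2 A y"
        using L2_set_triangle_ineq[of "\<lambda>i. norm (x i)" "\<lambda>i. norm (y i)" F] le[OF x] le[OF y]
        by linarith
      finally show "(\<Sum>i\<in>F. (norm (x i + y i))\<^sup>2) \<le> (norm2 A x + norm2 A y)\<^sup>2"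
        unfolding L2_set_def by (rule sqrt_le_D)
    qed
  qed
  then show ?thesis
    using nonneg unfolding norm2_def[of A "\<lambda>i. x i + y i"] by (intro real_le_lsqrt)
qed

text \<open>An absolutely summable family is bounded by its norm \<open>B\<close>, so its squares
  are dominated by \<open>B\<close> times its magnitudes.\<close>

lemma square_summable:
  assumes "(\<lambda>i. norm (x i)) summable_on A"
  shows "(\<lambda>i. (norm (x i :: complex))\<^sup>2) summable_on A"
proof -
  define B where "B = norm1 A x"
  have "norm (x i) \<le> B" if "i \<in> A" for i
    using finite_sum_le_infsum[OF assms, of "{i}"] that by (simp add: B_def norm1_def)
  then have "(norm (x i))\<^sup>2 \<le> B * norm (x i)" if "i \<in> A" for i
    using that by (simp add: power2_eq_square mult_right_mono)
  then show ?thesis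
    using summable_on_comparison_test[OF summable_on_cmult_right[OF assms, of B],
        of "\<lambda>i. (norm (x i))\<^sup>2"] by simp
qed

section \<open>Fourier series on the torus\<close>

definition wave :: "nat \<Rightarrow> (nat \<Rightarrow> int) \<Rightarrow> (nat \<Rightarrow> real) \<Rightarrow> complex" where
  "wave d k x = cis (2 * pi * (\<Sum>l<d. real_of_int (k l) * x l))"

lemma norm_wave [simp]: "norm (wave d k x) = 1"
  by (simp add: wave_def)

lemma wave_add: "wave d k x * wave d k' x = wave d (\<lambda>l. k l + k' l) x"
  by (simp add: wave_def cis_mult sum.distrib algebra_simps)

lemma continuous_wave: "continuous_on UNIV (wave d k)"
  unfolding wave_def by (intro continuous_intros continuous_on_product_coordinates)

lemma cis_2pi_int_add: "x - y \<in> \<int> \<Longrightarrow> cis (2 * pi * x) = cis (2 * pi * y)"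
proof -
  assume "x - y \<in> \<int>"
  then obtain j :: int where "x = y + j" by (auto simp: Ints_def algebra_simps)
  then have "cis (2 * pi * x) = cis (2 * pi * y) * cis (2 * pi * j)"
    by (simp add: cis_mult algebra_simps)
  then show ?thesis by (simp add: cis_multiple_2pi)
qed

lemma torus_fun_wave: "torus_fun d (wave d k)"
  unfolding torus_fun_def wave_def
proof (intro allI impI cis_2pi_int_add)
  fix x y :: "nat \<Rightarrow> real" assume "\<forall>l<d. x l - y l \<in> \<int>"
  then have "(\<Sum>l<d. real_of_int (k l) * (x l - y l)) \<in> \<int>"
    by (intro Ints_sum Ints_mult) auto
  then show "(\<Sum>l<d. real_of_int (k l) * x l) - (\<Sum>l<d. real_of_int (k l) * y l) \<in> \<int>"
    by (simp add: sum_subtractf right_diff_distrib)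
qed

section \<open>Integration over the torus and orthogonality of the waves\<close>

lemma prob_space_unit_interval: "prob_space (restrict_space lborel {0..1::real})"
  by (rule prob_space_restrict_space) auto

lemma product_prob_space_unit_interval:
  "product_prob_space (\<lambda>_::nat. restrict_space lborel {0..1::real})"
  unfolding product_prob_space_def product_prob_space_axioms_def product_sigma_finite_def
  using prob_space_unit_interval prob_space_imp_sigma_finite by blast

lemma prob_space_torus: "prob_space (torus d)"
  unfolding torus_def by (rule prob_space_PiM) (rule prob_space_unit_interval)

text \<open>The measure lives on the finite product over \<open>{..<d}\<close>, whereas continuity
  refers to the space of all sequences. The identity between them is measurable coordinate by
  coordinate.\<close>

lemma measurable_torus:
  fixes F :: "(nat \<Rightarrow> real) \<Rightarrow> 'b::topological_space"
  assumes "continuous_on UNIV F"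
  shows "F \<in> borel_measurable (torus d)"
proof -
  have "(\<lambda>x. x) \<in> measurable (torus d) (borel :: (nat \<Rightarrow> real) measure)"
  proof (rule measurable_coordinatewise_then_product)
    fix l
    show "(\<lambda>x. x l) \<in> borel_measurable (torus d)"
    proof (cases "l < d")
      case True
      have "(\<lambda>x. x l) \<in> measurable (torus d) (restrict_space lborel {0..1::real})"
        unfolding torus_def using True by (intro measurable_component_singleton) auto
      then show ?thesis by (auto simp: measurable_restrict_space2_iff)
    next
      \<comment> \<open>Points of the finite product are extensional, so this coordinate is
        constantly \<open>undefined\<close>.\<close>
      case False
      have "(\<lambda>x. undefined) \<in> borel_measurable (torus d)" by simp
      then show ?thesis
        by (rule measurable_cong[THEN iffD1, rotated])
           (use False in \<open>auto simp: torus_def space_PiM PiE_def extensional_def\<close>)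
    qed
  qed
  from measurable_compose[OF this borel_measurable_continuous_onI[OF assms]]
  show ?thesis by simp
qed

lemma integrable_torus_bounded:
  fixes F :: "(nat \<Rightarrow> real) \<Rightarrow> complex"
  assumes "continuous_on UNIV F" "\<And>x. norm (F x) \<le> B"
  shows "integrable (torus d) F"
proof -
  interpret prob_space "torus d" by (rule prob_space_torus)
  show ?thesis
    by (rule integrable_const_bound[of _ B]) (use assms measurable_torus in auto)
qed

lemma integral_cis_unit:
  "(LINT x|restrict_space lborel {0..1}. cis (2 * pi * real_of_int m * x)) = (if m = 0 then 1 else 0)"
proof -
  have "(LINT x|restrict_space lborel {0..1}. cis (2 * pi * real_of_int m * x))
      = (LINT x|lborel. indicator {0..1} x *\<^sub>R cis (2 * pi * real_of_int m * x))"
    by (subst integral_restrict_space) auto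
  also have "\<dots> = (if m = 0 then 1 else 0)"
  proof (cases "m = 0")
    case True
    then show ?thesis by simp
  next
    case False
    define F where "F = (\<lambda>x. cis (2 * pi * real_of_int m * x) / (\<i> * (2 * pi * m)))"
    have "(LINT x|lborel. indicator {0..1} x *\<^sub>R cis (2 * pi * real_of_int m * x)) = F 1 - F 0"
    proof (rule integral_FTC_atLeastAtMost)
      fix x :: real
      have "((\<lambda>z. exp (\<i> * (2 * pi * m) * z) / (\<i> * (2 * pi * m))) has_field_derivative
              exp (\<i> * (2 * pi * m) * complex_of_real x)) (at (complex_of_real x))"
        using False by (auto intro!: derivative_eq_intros)
      from has_vector_derivative_real_field[OF this]
      show "(F has_vector_derivative cis (2 * pi * real_of_int m * x)) (at x within {0..1})"
        by (simp add: F_def cis_conv_exp mult_ac)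
    qed (auto intro!: continuous_intros)
    also have "\<dots> = 0"
      using cis_multiple_2pi[of "real_of_int m"] by (simp add: F_def mult_ac)
    finally show ?thesis using False by simp
  qed
  finally show ?thesis .
qed

lemma integrable_cis_unit:
  "integrable (restrict_space lborel {0..1}) (\<lambda>x::real. cis (2 * pi * real_of_int m * x))"
proof -
  interpret prob_space "restrict_space lborel {0..1::real}" by (rule prob_space_unit_interval)
  have "(\<lambda>x::real. cis (2 * pi * real_of_int m * x)) \<in> borel_measurable lborel"
    unfolding measurable_lborel2 by (intro borel_measurable_continuous_onI continuous_intros)
  then show ?thesis
    by (intro integrable_const_bound[of _ 1] measurable_restrict_space1) auto
qed

lemma integral_wave:
  "(LINT x|torus d. wave d k x) = (if \<forall>l<d. k l = 0 then 1 else 0)"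
proof -
  interpret product_prob_space "\<lambda>_::nat. restrict_space lborel {0..1::real}" "{..<d}"
    by (rule product_prob_space_unit_interval)
  have prod: "wave d k x = (\<Prod>l<d. cis (2 * pi * real_of_int (k l) * x l))" for x
  proof -
    have "cis (\<Sum>l<n. g l) = (\<Prod>l<n. cis (g l))" for n and g :: "nat \<Rightarrow> real"
      by (induction n) (auto simp: cis_mult[symmetric])
    then show ?thesis by (simp add: wave_def sum_distrib_left mult.assoc)
  qed
  have "(LINT x|torus d. wave d k x) = (\<Prod>l<d. if k l = 0 then 1 else 0)"
    unfolding prod torus_def
    by (subst product_integral_prod) (auto simp: integral_cis_unit integrable_cis_unit)
  also have "\<dots> = (if \<forall>l<d. k l = 0 then 1 else 0)"
    by auto
  finally show ?thesis .
qed

lemma fourier_coeff_wave_eq: "fourier_coeff d f k = (LINT x|torus d. f x * wave d (\<lambda>l. - k l) x)"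
  unfolding fourier_coeff_def wave_def by (simp add: sum_negf)

lemma fourier_coeff_wave:
  assumes "k \<in> freqs d" "m \<in> freqs d"
  shows "fourier_coeff d (wave d k) m = (if m = k then 1 else 0)"
proof -
  have "(\<forall>l<d. k l + - m l = 0) \<longleftrightarrow> m = k"
  proof
    assume *: "\<forall>l<d. k l + - m l = 0"
    show "m = k"
      by (rule PiE_ext[OF assms(2,1)[unfolded freqs_def]]) (use * in auto)
  qed auto
  then show ?thesis
    by (simp add: fourier_coeff_wave_eq wave_add integral_wave)
qed

section \<open>Uniqueness of Fourier coefficients\<close>

text \<open>Transfers continuity in the product topology to closeness modulo 1 in the first
  \<open>d\<close> coordinates, which is what the periodic bump can detect.\<close>

lemma torus_fun_near:
  fixes h :: "(nat \<Rightarrow> real) \<Rightarrow> complex" and x :: "nat \<Rightarrow> real"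
  assumes h: "torus_fun d h" "continuous_on UNIV h" and "0 < \<epsilon>"
  obtains \<delta> where "0 < \<delta>" "\<delta> < 1/2"
    "\<And>y. (\<And>l. l < d \<Longrightarrow> \<exists>j::int. \<bar>y l - x l - j\<bar> < \<delta>) \<Longrightarrow> norm (h y - h x) < \<epsilon>"
proof -
  let ?V = "h -` ball (h x) \<epsilon>"
  have "open ?V" using h(2) by (rule open_vimage[rotated]) simp
  then have "openin (product_topology (\<lambda>_. euclidean) UNIV) ?V"
    by (simp add: open_fun_def)
  moreover have "x \<in> ?V" using assms(3) by simp
  ultimately obtain X where X: "x \<in> (\<Pi>\<^sub>E i\<in>UNIV. X i)" "\<forall>i. openin euclidean (X i)"
    "(\<Pi>\<^sub>E i\<in>UNIV. X i) \<subseteq> ?V"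
    using product_topology_open_contains_basis[of "\<lambda>_. euclidean" UNIV ?V x] by blast
  have "\<exists>r>0. ball (x l) r \<subseteq> X l" for l
    using X(1,2) open_contains_ball[of "X l"] by (auto simp: PiE_iff)
  then obtain r where r: "\<And>l. 0 < r l" "\<And>l. ball (x l) (r l) \<subseteq> X l" by metis
  \<comment> \<open>The entry 1/4 keeps the radius below 1/2 and the set nonempty for
    \<open>d = 0\<close>.\<close>
  define \<delta> where "\<delta> = Min (insert (1/4) (r ` {..<d}))"
  have \<delta>: "0 < \<delta>" "\<delta> \<le> 1/4" "\<And>l. l < d \<Longrightarrow> \<delta> \<le> r l"
  proof -
    show "0 < \<delta>" unfolding \<delta>_def using r(1) by (subst Min_gr_iff) auto
    show "\<delta> \<le> 1/4" unfolding \<delta>_def by (rule Min_le) auto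
    show "\<delta> \<le> r l" if "l < d" for l unfolding \<delta>_def using that by (intro Min_le) auto
  qed
  show ?thesis
  proof
    show "0 < \<delta>" "\<delta> < 1/2" using \<delta> by auto
    fix y assume "\<And>l. l < d \<Longrightarrow> \<exists>j::int. \<bar>y l - x l - j\<bar> < \<delta>"
    then obtain j :: "nat \<Rightarrow> int" where j: "\<And>l. l < d \<Longrightarrow> \<bar>y l - x l - j l\<bar> < \<delta>" by metis
    \<comment> \<open>Integer shifts bring \<open>y\<close> close to \<open>x\<close> below
      \<open>d\<close>, and the other coordinates are copied from \<open>x\<close>; a torus function
      does not notice either change.\<close>
    define y' where "y' = (\<lambda>l. if l < d then y l - j l else x l)"
    have "y' l \<in> X l" for l
    proof (cases "l < d")
      case True
      then have "y' l \<in> ball (x l) (r l)"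
        using j[OF True] \<delta>(3)[OF True] by (auto simp: y'_def dist_real_def)
      then show ?thesis using r(2) by blast
    next
      case False
      then show ?thesis using X(1) by (auto simp: y'_def)
    qed
    then have "y' \<in> ?V" by (intro subsetD[OF X(3)]) (simp add: PiE_iff)
    moreover have "h y = h y'"
      using h(1) unfolding torus_fun_def by (auto simp: y'_def)
    ultimately show "norm (h y - h x) < \<epsilon>" by (simp add: dist_norm norm_minus_commute)
  qed
qed

text \<open>
  The powers of the product of \<open>(1 + cos (2 pi (y l - x l))) / 2\<close> concentrate at \<open>x\<close>. Testing against
  them only involves Fourier coefficients.
\<close>

definition bump :: "nat \<Rightarrow> (nat \<Rightarrow> real) \<Rightarrow> (nat \<Rightarrow> real) \<Rightarrow> real" where
  "bump d x y = (\<Prod>l<d. (1 + cos (2 * pi * (y l - x l))) / 2)"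

lemma half_cos_bounds:
  fixes t :: real
  shows "0 \<le> (1 + cos t) / 2" "(1 + cos t) / 2 \<le> 1"
proof -
  have "-1 \<le> c \<Longrightarrow> 0 \<le> (1 + c) / 2" "c \<le> 1 \<Longrightarrow> (1 + c) / 2 \<le> 1" for c :: real
    by auto
  then show "0 \<le> (1 + cos t) / 2" "(1 + cos t) / 2 \<le> 1"
    using cos_ge_minus_one cos_le_one by blast+
qed

lemma bump_bounds: "0 \<le> bump d x y" "bump d x y \<le> 1"
  unfolding bump_def using half_cos_bounds by (auto intro!: prod_nonneg prod_le_1)

lemma bump_le: "l < d \<Longrightarrow> bump d x y \<le> (1 + cos (2 * pi * (y l - x l))) / 2"
proof -
  assume l: "l < d"
  have "bump d x y = (1 + cos (2 * pi * (y l - x l))) / 2 *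
          (\<Prod>i\<in>{..<d} - {l}. (1 + cos (2 * pi * (y i - x i))) / 2)"
    unfolding bump_def using l by (intro prod.remove) auto
  also have "\<dots> \<le> (1 + cos (2 * pi * (y l - x l))) / 2 * 1"
    using half_cos_bounds by (intro mult_left_mono prod_le_1) auto
  finally show ?thesis by simp
qed

lemma continuous_coordinate [continuous_intros]: "continuous_on A (\<lambda>y::nat \<Rightarrow> real. y l)"
  using continuous_on_product_coordinates[of l] continuous_on_subset by blast

lemma continuous_bump: "continuous_on UNIV (bump d x)"
  unfolding bump_def by (auto intro!: continuous_intros)

text \<open>Orthogonality to all waves, not only to the constant, makes the property stable under
  multiplication by a cosine, which shifts frequencies. The bound by 1 keeps the products
  integrable.\<close>

definition annihilates :: "nat \<Rightarrow> ((nat \<Rightarrow> real) \<Rightarrow> complex) \<Rightarrow> ((nat \<Rightarrow> real) \<Rightarrow> real) \<Rightarrow> bool" where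
  "annihilates d h g \<longleftrightarrow> continuous_on UNIV g \<and> (\<forall>y. \<bar>g y\<bar> \<le> 1) \<and>
     (\<forall>k. (LINT y|torus d. h y * g y * wave d k y) = 0)"

text \<open>By Euler's formula the new factor is 1/2 plus two waves with frequencies 1 and -1 in
  coordinate \<open>l\<close>. The integral is a combination of three integrals that vanish by
  assumption.\<close>

lemma annihilates_cos:
  assumes h: "continuous_on UNIV h" "integrable (torus d) h" and g: "annihilates d h g" and "l < d"
  shows "annihilates d h (\<lambda>y. (1 + cos (2 * pi * (y l - t))) / 2 * g y)"
proof -
  let ?c = "\<lambda>y::nat \<Rightarrow> real. (1 + cos (2 * pi * (y l - t))) / 2"
  have cont: "continuous_on UNIV (\<lambda>y. ?c y * g y)"
    using g unfolding annihilates_def by (auto intro!: continuous_intros)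
  have bound: "\<bar>?c y * g y\<bar> \<le> 1" for y
    using g half_cos_bounds[of "2 * pi * (y l - t)"] unfolding annihilates_def abs_mult
    by (intro mult_le_one) auto
  have int: "integrable (torus d) (\<lambda>y. h y * g y * wave d k y)" for k
  proof (rule Bochner_Integration.integrable_bound[OF h(2)])
    show "(\<lambda>y. h y * g y * wave d k y) \<in> borel_measurable (torus d)"
      using h(1) g continuous_wave unfolding annihilates_def
      by (intro measurable_torus continuous_intros) auto
    show "AE y in torus d. norm (h y * g y * wave d k y) \<le> norm (h y)"
      using g unfolding annihilates_def by (auto simp: norm_mult intro!: mult_left_le)
  qed
  have "(LINT y|torus d. h y * (?c y * g y) * wave d k y) = 0" for k
  proof -
    have cos_cis: "complex_of_real (cos \<theta>) = (cis \<theta> + cis (- \<theta>)) / 2" for \<theta>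
      by (simp add: complex_eq_iff)
    have shift: "wave d k y * cis (2 * pi * real_of_int j * y l) = wave d (k(l := k l + j)) y" for j y
    proof -
      have "(\<Sum>i<d. real_of_int ((k(l := k l + j)) i) * y i)
          = (\<Sum>i<d. real_of_int (k i) * y i + (if i = l then j * y l else 0))"
        by (intro sum.cong) (auto simp: algebra_simps)
      also have "\<dots> = (\<Sum>i<d. real_of_int (k i) * y i) + j * y l"
        using \<open>l < d\<close> by (simp add: sum.distrib)
      finally show ?thesis by (simp add: wave_def cis_mult algebra_simps)
    qed
    have eq: "h y * complex_of_real (?c y * g y) * wave d k y =
      (1/2) * (h y * g y * wave d k y)
      + (cis (- 2 * pi * t) / 4) * (h y * g y * wave d (k(l := k l + 1)) y)
      + (cis (2 * pi * t) / 4) * (h y * g y * wave d (k(l := k l + -1)) y)" for y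
    proof -
      have e: "cis (2 * pi * (y l - t)) = cis (2 * pi * real_of_int 1 * y l) * cis (- 2 * pi * t)"
           "cis (- (2 * pi * (y l - t))) = cis (2 * pi * real_of_int (-1) * y l) * cis (2 * pi * t)"
        by (simp_all add: cis_mult algebra_simps)
      show ?thesis
        unfolding shift[symmetric] of_real_mult of_real_divide of_real_add cos_cis e
        by (simp add: field_simps)
    qed
    show ?thesis
      unfolding eq using g int unfolding annihilates_def by simp
  qed
  with cont bound show ?thesis unfolding annihilates_def by blast
qed

lemma annihilates_bump:
  assumes h: "continuous_on UNIV h" "integrable (torus d) h" and g: "annihilates d h g"
  shows "annihilates d h (\<lambda>y. bump d x y * g y)"
proof -
  have "annihilates d h (\<lambda>y. (\<Prod>l<n. (1 + cos (2 * pi * (y l - x l))) / 2) * g y)" if "n \<le> d" for n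
    using that
  proof (induction n)
    case 0
    then show ?case using g by simp
  next
    case (Suc n)
    then have "annihilates d h (\<lambda>y. (1 + cos (2 * pi * (y n - x n))) / 2 *
                 ((\<Prod>l<n. (1 + cos (2 * pi * (y l - x l))) / 2) * g y))"
      by (intro annihilates_cos[OF h]) auto
    then show ?case
      by (rule back_subst[where P = "annihilates d h"]) (simp add: fun_eq_iff)
  qed
  then show ?thesis unfolding bump_def by simp
qed

lemma annihilates_bump_power:
  assumes h: "continuous_on UNIV h" "integrable (torus d) h"
    and zero: "\<And>k. k \<in> freqs d \<Longrightarrow> fourier_coeff d h k = 0"
  shows "annihilates d h (\<lambda>y. bump d x y ^ n)"
proof (induction n)
  case 0
  have "(LINT y|torus d. h y * wave d k y) = 0" for k
  proof -
    \<comment> \<open>Frequencies in \<open>annihilates\<close> are arbitrary functions; restricting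
      to \<open>{..<d}\<close> gives an index in \<open>freqs d\<close> with the same wave. The sign
      accounts for the conjugate wave in a Fourier coefficient.\<close>
    have "wave d (\<lambda>l. - restrict (\<lambda>l. - k l) {..<d} l) = wave d k"
      by (simp add: wave_def fun_eq_iff)
    then show ?thesis
      using zero[of "restrict (\<lambda>l. - k l) {..<d}"] by (simp add: fourier_coeff_wave_eq freqs_def)
  qed
  then show ?case by (simp add: annihilates_def)
next
  case (Suc n)
  then show ?case using annihilates_bump[OF h Suc.IH] by simp
qed

text \<open>If \<open>h x\<close> were nonzero, every power of the bump would integrate to 0 against
  \<open>h\<close>. But the part near the point contributes at least a constant times
  \<open>p ^ n\<close> and the far part at most \<open>B * q ^ n\<close> in magnitude, with
  \<open>q < p\<close>, which is impossible for large \<open>n\<close>.\<close>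

lemma fourier_unique:
  assumes h: "torus_fun d h" "continuous_on UNIV h" "integrable (torus d) h"
    and zero: "\<And>k. k \<in> freqs d \<Longrightarrow> fourier_coeff d h k = 0"
  shows "h x = 0"
proof (rule ccontr)
  assume nz: "h x \<noteq> 0"
  \<comment> \<open>Integration runs over the unit cube, so the point is replaced by its
    representative in it.\<close>
  define x0 where "x0 = (\<lambda>l. frac (x l))"
  have x0: "0 \<le> x0 l" "x0 l < 1" for l by (simp_all add: x0_def frac_lt_1)
  have "h x0 = h x"
    using h(1) unfolding torus_fun_def x0_def by (simp add: frac_def)
  with nz have nz: "h x0 \<noteq> 0" by simp
  define \<epsilon> where "\<epsilon> = norm (h x0) / 2"
  have \<epsilon>: "0 < \<epsilon>" using nz by (simp add: \<epsilon>_def)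
  obtain \<delta> where \<delta>: "0 < \<delta>" "\<delta> < 1/2"
    "\<And>y. (\<And>l. l < d \<Longrightarrow> \<exists>j::int. \<bar>y l - x0 l - j\<bar> < \<delta>) \<Longrightarrow> norm (h y - h x0) < \<epsilon>"
    using torus_fun_near[OF h(1,2) \<epsilon>] by blast
  \<comment> \<open>Multiplying by the conjugate phase of \<open>h x0\<close> makes the value at
    \<open>x0\<close> real and positive; \<open>H\<close> then stays above \<open>\<epsilon>\<close>
    nearby.\<close>
  define H where "H = (\<lambda>y. Re (cnj (h x0) / norm (h x0) * h y))"
  define B where "B = (LINT y|torus d. norm (h y))"
  \<comment> \<open>\<open>q\<close> bounds the bump outside the
    \<open>\<delta>\<close>-neighbourhood; \<open>p\<close>, the midpoint of \<open>q\<close> and 1,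
    is a lower bound on a small box at \<open>x0\<close>.\<close>
  define q where "q = (1 + cos (2 * pi * \<delta>)) / 2"
  define p where "p = (1 + q) / 2"
  interpret prob_space "torus d" by (rule prob_space_torus)
  have cos_lt: "cos (2 * pi * \<delta>) < 1" "cos (2 * pi * \<delta>) > -1"
    using cos_monotone_0_pi[of 0 "2 * pi * \<delta>"] cos_monotone_0_pi[of "2 * pi * \<delta>" pi] \<delta> by auto
  then have pq: "0 < q" "q < p" "p < 1" by (auto simp: q_def p_def)
  have H_le: "\<bar>H y\<bar> \<le> norm (h y)" for y
    unfolding H_def using abs_Re_le_cmod[of "cnj (h x0) / norm (h x0) * h y"] nz
    by (simp add: norm_mult norm_divide)
  have H_ge: "H y \<ge> \<epsilon>" if "norm (h y - h x0) < \<epsilon>" for y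
  proof -
    have "H y = norm (h x0) + Re (cnj (h x0) / norm (h x0) * (h y - h x0))"
      using nz by (simp add: H_def algebra_simps diff_divide_distrib complex_norm_square[symmetric] power2_eq_square)
    moreover have "\<bar>Re (cnj (h x0) / norm (h x0) * (h y - h x0))\<bar> \<le> norm (h y - h x0)"
      using abs_Re_le_cmod[of "cnj (h x0) / norm (h x0) * (h y - h x0)"] nz
      by (simp add: norm_mult norm_divide)
    ultimately show ?thesis using that unfolding \<epsilon>_def by linarith
  qed
  have far: "bump d x0 y \<le> q" if y: "\<not> (\<forall>l<d. \<exists>j::int. \<bar>y l - x0 l - j\<bar> < \<delta>)" for y
  proof -
    obtain l where l: "l < d" "\<And>j::int. \<bar>y l - x0 l - j\<bar> \<ge> \<delta>" using y by (meson not_le)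
    define u where "u = y l - x0 l - round (y l - x0 l)"
    have u: "\<delta> \<le> \<bar>u\<bar>" "\<bar>u\<bar> \<le> 1/2"
      using l(2)[of "round (y l - x0 l)"] of_int_round_abs_le[of "y l - x0 l"]
      by (auto simp: u_def abs_minus_commute)
    have "cos (2 * pi * (y l - x0 l)) = cos (2 * pi * u + 2 * pi * of_int (round (y l - x0 l)))"
      by (simp add: u_def algebra_simps)
    also have "\<dots> = cos (2 * pi * u)"
      by (simp add: cos_add sin_int_2pin cos_int_2pin)
    also have "\<dots> = cos (2 * pi * \<bar>u\<bar>)" by (cases "0 \<le> u") auto
    also have "\<dots> \<le> cos (2 * pi * \<delta>)"
      using u \<delta> by (intro cos_monotone_0_pi_le) auto
    finally show ?thesis using bump_le[OF l(1), of x0 y] by (simp add: q_def)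
  qed
  \<comment> \<open>On the box each factor of the bump is smallest at distance
    \<open>\<delta>'\<close>, so the \<open>d\<close>-th power of that factor bounds the whole
    product from below.\<close>
  obtain \<delta>' where \<delta>': "0 < \<delta>'" "\<delta>' < \<delta>" "\<And>l. l < d \<Longrightarrow> x0 l + \<delta>' < 1"
    "\<And>t. 0 \<le> t \<Longrightarrow> t \<le> \<delta>' \<Longrightarrow> ((1 + cos (2 * pi * t)) / 2) ^ d \<ge> p"
  proof -
    have "((\<lambda>t. ((1 + cos (2 * pi * t)) / 2) ^ d) \<longlongrightarrow> ((1 + cos (2 * pi * 0)) / 2) ^ d) (at (0::real))"
      by (intro tendsto_intros) auto
    then have "\<forall>\<^sub>F t in at (0::real). ((1 + cos (2 * pi * t)) / 2) ^ d > p"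
      by (rule order_tendstoD) (use pq in simp)
    then obtain r where r: "0 < r" "\<And>t. t \<noteq> 0 \<Longrightarrow> \<bar>t\<bar> < r \<Longrightarrow> ((1 + cos (2 * pi * t)) / 2) ^ d > p"
      unfolding eventually_at by (auto simp: dist_real_def)
    define \<delta>' where "\<delta>' = Min ({r / 2, \<delta> / 2} \<union> (\<lambda>l. (1 - x0 l) / 2) ` {..<d})"
    have b: "\<delta>' \<le> r / 2" "\<delta>' \<le> \<delta> / 2" "\<And>l. l < d \<Longrightarrow> \<delta>' \<le> (1 - x0 l) / 2"
      unfolding \<delta>'_def by (rule Min_le; auto)+
    show thesis
    proof
      show "0 < \<delta>'" unfolding \<delta>'_def using r(1) \<delta>(1) x0 by (subst Min_gr_iff) auto
      show "\<delta>' < \<delta>" using b(2) \<delta>(1) by simp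
      show "x0 l + \<delta>' < 1" if "l < d" for l
      proof -
        have "\<delta>' \<le> (1 - x0 l) / 2" "x0 l < 1" using b(3)[OF that] x0 by auto
        then show ?thesis by simp
      qed
      show "((1 + cos (2 * pi * t)) / 2) ^ d \<ge> p" if "0 \<le> t" "t \<le> \<delta>'" for t
        using r b(1) that pq by (cases "t = 0") (auto intro!: less_imp_le)
    qed
  qed
  \<comment> \<open>The box extends to one side only: coordinates of \<open>x0\<close> may be 0 but
    are below 1, so it stays in the unit cube.\<close>
  define V where "V = (\<Pi>\<^sub>E l\<in>{..<d}. {x0 l..x0 l + \<delta>'})"
  have V: "V \<in> sets (torus d)" "measure (torus d) V = \<delta>' ^ d"
  proof -
    interpret T: product_prob_space "\<lambda>_::nat. restrict_space lborel {0..1::real}" "{..<d}"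
      by (rule product_prob_space_unit_interval)
    have sub: "{x0 l..x0 l + \<delta>'} \<subseteq> {0..1}" if "l < d" for l
      using \<delta>'(3)[OF that] x0[of l] by auto
    then have s: "{x0 l..x0 l + \<delta>'} \<in> sets (restrict_space lborel {0..1})" if "l < d" for l
      using sub[OF that] by (subst sets_restrict_space_iff) simp_all
    show "V \<in> sets (torus d)"
      unfolding V_def torus_def using s by (intro sets_PiM_I_finite) auto
    have "emeasure (torus d) V = (\<Prod>l<d. emeasure (restrict_space lborel {0..1}) {x0 l..x0 l + \<delta>'})"
      unfolding V_def torus_def using s by (intro T.emeasure_PiM) auto
    also have "\<dots> = (\<Prod>l<d. ennreal \<delta>')"
    proof (rule prod.cong)
      fix l assume "l \<in> {..<d}"
      then show "emeasure (restrict_space lborel {0..1}) {x0 l..x0 l + \<delta>'} = ennreal \<delta>'"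
        using sub[of l] \<delta>'(1) by (subst emeasure_restrict_space) simp_all
    qed simp
    also have "\<dots> = ennreal (\<delta>' ^ d)" using \<delta>'(1) by (simp add: ennreal_power)
    finally show "measure (torus d) V = \<delta>' ^ d" using \<delta>'(1) by (simp add: measure_def)
  qed
  have near: "bump d x0 y \<ge> p" "norm (h y - h x0) < \<epsilon>" if y: "y \<in> V" for y
  proof -
    have y': "0 \<le> y l - x0 l" "y l - x0 l \<le> \<delta>'" if "l < d" for l
      using y that unfolding V_def by (auto dest!: PiE_mem[of _ _ _ l])
    have "p \<le> ((1 + cos (2 * pi * \<delta>')) / 2) ^ d" using \<delta>'(1,4) by simp
    also have "\<dots> = (\<Prod>l<d. (1 + cos (2 * pi * \<delta>')) / 2)" by simp
    also have "\<dots> \<le> bump d x0 y"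
      unfolding bump_def using y' half_cos_bounds[of "2 * pi * \<delta>'"] \<delta>' \<delta>
      by (intro prod_mono conjI divide_right_mono add_left_mono cos_monotone_0_pi_le) auto
    finally show "bump d x0 y \<ge> p" .
    show "norm (h y - h x0) < \<epsilon>"
      by (rule \<delta>(3)) (use y' \<delta>'(2) in \<open>force intro!: exI[of _ 0]\<close>)
  qed
  have key: "\<epsilon> * \<delta>' ^ d * p ^ n \<le> B * q ^ n" for n
  proof -
    let ?T = "\<lambda>y. bump d x0 y ^ n"
    \<comment> \<open>On \<open>V\<close> the bump is at least \<open>p\<close>; in the rest of the
      neighbourhood the right side is nonnegative; far away it is at least
      \<open>- norm (h y) * q ^ n\<close>.\<close>
    have le: "\<epsilon> * p ^ n * indicator V y - q ^ n * norm (h y) \<le> H y * ?T y" for y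
    proof (cases "\<forall>l<d. \<exists>j::int. \<bar>y l - x0 l - j\<bar> < \<delta>")
      case True
      then have H: "\<epsilon> \<le> H y" by (intro H_ge \<delta>(3)) auto
      have "\<epsilon> * (p ^ n * indicator V y) \<le> H y * ?T y"
        using H \<epsilon> pq near(1)[of y] bump_bounds[of d x0 y]
        by (intro mult_mono) (auto simp: indicator_def intro!: power_mono)
      moreover have "0 \<le> q ^ n * norm (h y)" using pq by simp
      ultimately show ?thesis by simp
    next
      case False
      have "y \<notin> V"
      proof
        assume "y \<in> V"
        then have "\<bar>y l - x0 l - of_int 0\<bar> < \<delta>" if "l < d" for l
          using that \<delta>'(2) unfolding V_def by (force dest!: PiE_mem[of _ _ _ l])
        with False show False by blast
      qed
      moreover have "\<bar>H y * ?T y\<bar> \<le> norm (h y) * q ^ n"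
        unfolding abs_mult using H_le far[OF False] bump_bounds[of d x0 y]
        by (intro mult_mono) (auto intro!: power_mono)
      ultimately show ?thesis by (simp add: mult.commute abs_le_iff)
    qed
    have ann: "annihilates d h ?T" by (rule annihilates_bump_power[OF h(2,3) zero])
    have int: "integrable (torus d) (\<lambda>y. h y * complex_of_real (?T y))"
      using bump_bounds continuous_bump
      by (intro Bochner_Integration.integrable_bound[OF h(3)] measurable_torus continuous_intros h(2))
         (auto simp: norm_mult norm_power power_le_one intro!: mult_left_le)
    have Heq: "H y * ?T y = Re (cnj (h x0) / norm (h x0) * (h y * complex_of_real (?T y)))" for y
      unfolding H_def by (metis Re_complex_of_real mult.assoc mult.commute scaleR_complex.sel(1) scaleR_conv_of_real)
    have "(LINT y|torus d. H y * ?T y) = Re (cnj (h x0) / norm (h x0) * (LINT y|torus d. h y * complex_of_real (?T y)))"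
      unfolding Heq using int by (subst integral_Re) (auto simp del: times_complex.sel)
    \<comment> \<open>The zero frequency of \<open>annihilates\<close>, whose wave is 1.\<close>
    also have "(LINT y|torus d. h y * complex_of_real (?T y)) = 0"
      using ann unfolding annihilates_def by (auto dest!: spec[of _ "\<lambda>_. 0"] simp: wave_def)
    finally have "0 = (LINT y|torus d. H y * ?T y)" by simp
    also have "\<dots> \<ge> (LINT y|torus d. \<epsilon> * p ^ n * indicator V y - q ^ n * norm (h y))"
    proof (rule integral_mono)
      show "integrable (torus d) (\<lambda>y. \<epsilon> * p ^ n * indicator V y - q ^ n * norm (h y))"
        using V(1) h(3) by (intro Bochner_Integration.integrable_diff integrable_mult_right integrable_norm) (auto simp: emeasure_eq_measure)
      show "integrable (torus d) (\<lambda>y. H y * ?T y)"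
        unfolding Heq using int by (intro integrable_Re integrable_mult_right) auto
    qed (rule le)
    also have "(LINT y|torus d. \<epsilon> * p ^ n * indicator V y - q ^ n * norm (h y)) = \<epsilon> * p ^ n * \<delta>' ^ d - q ^ n * B"
      using V h(3) sets.sets_into_space[OF V(1)]
      by (subst Bochner_Integration.integral_diff) (auto simp: B_def emeasure_eq_measure Int_absorb2)
    finally show ?thesis by (simp add: mult_ac)
  qed
  have "(\<lambda>n. \<epsilon> * \<delta>' ^ d * (p / q) ^ n) \<le> (\<lambda>_. B)"
    using key pq by (auto simp: le_fun_def power_divide field_simps)
  moreover obtain n where "B / (\<epsilon> * \<delta>' ^ d) < (p / q) ^ n"
    using real_arch_pow[of "p / q"] pq by auto
  ultimately show False
    using \<epsilon> \<delta>'(1) by (auto simp: le_fun_def field_simps not_le dest!: spec[of _ n])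
qed

section \<open>Absolutely convergent series of waves and Fourier inversion\<close>

lemma summable_norm_bound:
  assumes "(\<lambda>i. norm (c i)) summable_on A" "\<And>i. i \<in> A \<Longrightarrow> norm (w i) \<le> norm (c i)"
  shows "(\<lambda>i. norm (w i)) summable_on A" "norm (\<Sum>\<^sub>\<infinity>i\<in>A. w i :: complex) \<le> (\<Sum>\<^sub>\<infinity>i\<in>A. norm (c i))"
proof -
  show s: "(\<lambda>i. norm (w i)) summable_on A"
    by (rule summable_on_comparison_test[OF assms(1)]) (use assms(2) in auto)
  show "norm (\<Sum>\<^sub>\<infinity>i\<in>A. w i) \<le> (\<Sum>\<^sub>\<infinity>i\<in>A. norm (c i))"
    using norm_infsum_bound[OF s] infsum_mono[OF s assms] by linarith
qed

text \<open>The frequency map \<open>\<phi>\<close> may identify indices. The identity gives Fourier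
  series in dimension \<open>d\<close>; \<open>k \<mapsto> k \<cdot> z\<close> gives their
  restrictions to the lattice line, where different \<open>k\<close> can collide.\<close>

locale wave_series =
  fixes d :: nat and A :: "'i set" and c :: "'i \<Rightarrow> complex" and \<phi> :: "'i \<Rightarrow> nat \<Rightarrow> int"
  assumes summable: "(\<lambda>i. norm (c i)) summable_on A"
    and freqs: "\<And>i. i \<in> A \<Longrightarrow> \<phi> i \<in> freqs d"
begin

definition F :: "(nat \<Rightarrow> real) \<Rightarrow> complex" where
  "F x = (\<Sum>\<^sub>\<infinity>i\<in>A. c i * wave d (\<phi> i) x)"

lemma norm_F_le: "norm (F x) \<le> (\<Sum>\<^sub>\<infinity>i\<in>A. norm (c i))"
  unfolding F_def by (rule summable_norm_bound[OF summable]) (simp add: norm_mult)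

lemma uniform_limit_F:
  "uniform_limit UNIV (\<lambda>X y. \<Sum>i\<in>X. c i * wave d (\<phi> i) y) F (finite_subsets_at_top A)"
  unfolding F_def
  by (rule Weierstrass_m_test_general[OF _ summable]) (simp add: norm_mult)

lemma continuous_F: "continuous_on UNIV F"
  by (rule uniform_limit_theorem[OF _ uniform_limit_F])
     (auto intro!: always_eventually continuous_intros continuous_wave)

lemma torus_fun_F: "torus_fun d F"
proof -
  have "wave d k x = wave d k y" if "\<forall>l<d. x l - y l \<in> \<int>" for k x y
    using torus_fun_wave[of d k] that unfolding torus_fun_def by blast
  then show ?thesis unfolding torus_fun_def F_def by presburger
qed

lemma integrable_F: "integrable (torus d) F"
  using integrable_torus_bounded[OF continuous_F norm_F_le] .

text \<open>Orthogonality settles finite partial sums, and uniform convergence passes to the limit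
  under the integral over a probability space.\<close>

lemma has_sum_fourier_coeff_F:
  assumes m: "m \<in> freqs d"
  shows "((\<lambda>i. if \<phi> i = m then c i else 0) has_sum fourier_coeff d F m) A"
proof -
  interpret prob_space "torus d" by (rule prob_space_torus)
  let ?w = "wave d (\<lambda>l. - m l)"
  let ?S = "\<lambda>X y. \<Sum>i\<in>X. c i * wave d (\<phi> i) y"
  have coeff: "(LINT y|torus d. ?S X y * ?w y) = (\<Sum>i\<in>X. if \<phi> i = m then c i else 0)"
    if "finite X" "X \<subseteq> A" for X
  proof -
    have int: "integrable (torus d) (\<lambda>y. wave d (\<phi> i) y * ?w y)" for i
      unfolding wave_add by (rule integrable_torus_bounded[OF continuous_wave, where B = 1]) simp
    have "(LINT y|torus d. ?S X y * ?w y) = (\<Sum>i\<in>X. c i * fourier_coeff d (wave d (\<phi> i)) m)"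
      unfolding fourier_coeff_wave_eq sum_distrib_right mult.assoc using int
      by (subst Bochner_Integration.integral_sum) auto
    also have "\<dots> = (\<Sum>i\<in>X. if \<phi> i = m then c i else 0)"
      using that freqs by (intro sum.cong) (use m in \<open>auto simp: fourier_coeff_wave subset_eq\<close>)
    finally show ?thesis .
  qed
  have "((\<lambda>X. \<Sum>i\<in>X. if \<phi> i = m then c i else 0) \<longlongrightarrow> fourier_coeff d F m) (finite_subsets_at_top A)"
  proof (rule tendstoI)
    fix \<epsilon> :: real assume "0 < \<epsilon>"
    \<comment> \<open>Half of \<open>\<epsilon>\<close> restores the strict inequality that
      integration weakens.\<close>
    then have "\<forall>\<^sub>F X in finite_subsets_at_top A. \<forall>y\<in>UNIV. dist (?S X y) (F y) < \<epsilon> / 2"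
      using uniform_limitD[OF uniform_limit_F, of "\<epsilon> / 2"] by simp
    moreover have "\<forall>\<^sub>F X in finite_subsets_at_top A. finite X \<and> X \<subseteq> A"
      by (rule eventually_finite_subsets_at_top_weakI) auto
    ultimately show "\<forall>\<^sub>F X in finite_subsets_at_top A.
        dist (\<Sum>i\<in>X. if \<phi> i = m then c i else 0) (fourier_coeff d F m) < \<epsilon>"
    proof eventually_elim
      case (elim X)
      have cS: "continuous_on UNIV (?S X)" by (intro continuous_intros continuous_wave)
      have int: "integrable (torus d) (\<lambda>y. ?S X y * ?w y)" "integrable (torus d) (\<lambda>y. F y * ?w y)"
        by (rule integrable_torus_bounded[of _ "\<Sum>i\<in>X. norm (c i)"]
                 integrable_torus_bounded[of _ "\<Sum>\<^sub>\<infinity>i\<in>A. norm (c i)"];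
            use norm_F_le in \<open>auto intro!: continuous_intros continuous_wave cS continuous_F sum_norm_le simp: norm_mult\<close>)+
      have "(\<Sum>i\<in>X. if \<phi> i = m then c i else 0) - fourier_coeff d F m =
            (LINT y|torus d. (?S X y - F y) * ?w y)"
        unfolding coeff[OF elim(2)[THEN conjunct1] elim(2)[THEN conjunct2], symmetric]
          fourier_coeff_wave_eq left_diff_distrib
        using int by simp
      also have "norm \<dots> \<le> (LINT y|torus d. norm ((?S X y - F y) * ?w y))" by simp
      also have "\<dots> \<le> (LINT y|torus d. \<epsilon> / 2)"
      proof (rule integral_mono)
        show "integrable (torus d) (\<lambda>y. norm ((?S X y - F y) * ?w y))"
          unfolding left_diff_distrib using int by (intro integrable_norm Bochner_Integration.integrable_diff)
        show "norm ((?S X y - F y) * ?w y) \<le> \<epsilon> / 2" for y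
          using elim(1) by (simp add: norm_mult dist_norm less_imp_le)
      qed simp
      also have "\<dots> < \<epsilon>" using \<open>0 < \<epsilon>\<close> by (simp add: prob_space)
      finally show ?case by (simp add: dist_norm)
    qed
  qed
  then show ?thesis unfolding has_sum_def .
qed

text \<open>The Fourier coefficient at \<open>m\<close> is the sum of \<open>c\<close> over the
  fibre of \<open>\<phi>\<close> at \<open>m\<close>, so absolute summability survives grouping the
  family by fibres.\<close>

lemma summable_fourier_coeff_F: "(\<lambda>m. norm (fourier_coeff d F m)) summable_on freqs d"
proof -
  let ?B = "\<lambda>m. {i \<in> A. \<phi> i = m}"
  have bij: "bij_betw (\<lambda>i. (\<phi> i, i)) A (Sigma (freqs d) ?B)"
    by (rule bij_betw_byWitness[where f' = snd]) (use freqs in auto)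
  have "(\<lambda>i. norm ((c \<circ> snd) (\<phi> i, i))) summable_on A" using summable by simp
  then have "(\<lambda>p. norm ((c \<circ> snd) p)) summable_on Sigma (freqs d) ?B"
    using summable_on_reindex_bij_betw[OF bij, of "\<lambda>p. norm ((c \<circ> snd) p)"] by simp
  then have s: "(\<lambda>m. norm (\<Sum>\<^sub>\<infinity>i\<in>?B m. norm (c i))) summable_on freqs d"
    unfolding Infinite_Sum.abs_summable_on_Sigma_iff by simp
  have "norm (fourier_coeff d F m) \<le> (\<Sum>\<^sub>\<infinity>i\<in>?B m. norm (c i))" if "m \<in> freqs d" for m
  proof -
    have "fourier_coeff d F m = (\<Sum>\<^sub>\<infinity>i\<in>?B m. c i)"
      unfolding infsumI[OF has_sum_fourier_coeff_F[OF that], symmetric]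
      by (rule infsum_cong_neutral) auto
    moreover have "(\<lambda>i. norm (c i)) summable_on ?B m"
      by (rule summable_on_subset_banach[OF summable]) auto
    ultimately show ?thesis by (simp add: norm_infsum_bound)
  qed
  then show ?thesis
    by (intro Infinite_Sum.abs_summable_on_comparison_test[OF s]) (auto simp: infsum_nonneg)
qed

lemma F_wiener_continuous: "F \<in> wiener d \<inter> continuous_torus d"
  using continuous_F torus_fun_F integrable_F summable_fourier_coeff_F
  by (simp add: wiener_def continuous_torus_def)

end

lemma fourier_coeff_diff:
  assumes "continuous_on UNIV f" "integrable (torus d) f" "continuous_on UNIV g" "integrable (torus d) g"
  shows "fourier_coeff d (\<lambda>x. f x - g x) k = fourier_coeff d f k - fourier_coeff d g k"
proof -
  have "integrable (torus d) (\<lambda>y. g y * wave d m y)"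
    if "integrable (torus d) g" "continuous_on UNIV g" for g m
    by (rule Bochner_Integration.integrable_bound[OF that(1)])
       (auto intro!: measurable_torus continuous_intros continuous_wave that(2) simp: norm_mult)
  with assms show ?thesis
    unfolding fourier_coeff_wave_eq left_diff_distrib by simp
qed

text \<open>The Fourier series of \<open>f\<close> is continuous with the same coefficients as
  \<open>f\<close>, so uniqueness applies to the difference.\<close>

lemma fourier_inversion:
  assumes "f \<in> wiener d \<inter> continuous_torus d"
  shows "f x = (\<Sum>\<^sub>\<infinity>k\<in>freqs d. fourier_coeff d f k * wave d k x)"
proof -
  interpret wave_series d "freqs d" "fourier_coeff d f" "\<lambda>k. k"
    using assms by unfold_locales (auto simp: wiener_def)
  have f: "torus_fun d f" "continuous_on UNIV f" "integrable (torus d) f"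
    using assms by (auto simp: wiener_def continuous_torus_def)
  have "f x - F x = 0"
  proof (rule fourier_unique)
    show "torus_fun d (\<lambda>x. f x - F x)" using f(1) torus_fun_F unfolding torus_fun_def by metis
    show "continuous_on UNIV (\<lambda>x. f x - F x)" using f(2) continuous_F by (intro continuous_intros)
    show "integrable (torus d) (\<lambda>x. f x - F x)" using f(3) integrable_F by simp
    fix k assume k: "k \<in> freqs d"
    have "fourier_coeff d F k = (\<Sum>\<^sub>\<infinity>i\<in>freqs d. if i = k then fourier_coeff d f i else 0)"
      using infsumI[OF has_sum_fourier_coeff_F[OF k]] by simp
    also have "\<dots> = (\<Sum>\<^sub>\<infinity>i\<in>{k}. fourier_coeff d f i)"
      using k by (intro infsum_cong_neutral) auto
    finally have "fourier_coeff d F k = fourier_coeff d f k" by simp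
    then show "fourier_coeff d (\<lambda>x. f x - F x) k = 0"
      using fourier_coeff_diff[OF f(2,3) continuous_F integrable_F] by simp
  qed
  then show ?thesis by (simp add: F_def)
qed

section \<open>Sampling along a lattice\<close>

lemma has_sum_sum:
  fixes g :: "'j \<Rightarrow> 'i \<Rightarrow> 'a::topological_comm_monoid_add"
  assumes "finite J" "\<And>j. j \<in> J \<Longrightarrow> (g j has_sum S j) A"
  shows "((\<lambda>i. \<Sum>j\<in>J. g j i) has_sum (\<Sum>j\<in>J. S j)) A"
  using assms by (induction J rule: finite_induct) (auto intro!: has_sum_add)

lemma cis_eq_1_iff_Ints: "cis (2 * pi * x) = 1 \<longleftrightarrow> x \<in> \<int>"
proof
  assume "cis (2 * pi * x) = 1"
  then have "cos (2 * pi * x) = 1" by (metis cis.sel(1) one_complex.sel(1))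
  then obtain n :: int where "2 * pi * x = of_int n * 2 * pi" by (auto simp: cos_one_2pi_int)
  then have "x = of_int n" by simp
  then show "x \<in> \<int>" by simp
next
  assume "x \<in> \<int>"
  then show "cis (2 * pi * x) = 1" using cis_2pi_int_add[of x 0] by simp
qed

lemma sum_roots_of_unity:
  assumes "0 < M"
  shows "(\<Sum>j<M. cis (2 * pi * real_of_int m * real j / real M)) = (if int M dvd m then of_nat M else 0)"
proof -
  define w where "w = cis (2 * pi * (real_of_int m / real M))"
  have pow: "cis (2 * pi * real_of_int m * real j / real M) = w ^ j" for j
    unfolding w_def Complex.DeMoivre by (simp add: mult_ac)
  have w1: "w = 1 \<longleftrightarrow> int M dvd m"
  proof -
    have "real_of_int m / real M \<in> \<int> \<longleftrightarrow> int M dvd m"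
      using of_int_div_of_int_in_Ints_iff[of m "int M", where 'a = real] assms by simp
    then show ?thesis unfolding w_def cis_eq_1_iff_Ints .
  qed
  have "w ^ M = 1"
    using cis_eq_1_iff_Ints[of "real_of_int m"] assms by (simp add: w_def Complex.DeMoivre mult.commute mult.left_commute)
  then have "(\<Sum>j<M. w ^ j) = (if w = 1 then of_nat M else 0)"
    by (simp add: geometric_sum)
  then show ?thesis by (simp add: pow w1)
qed

section \<open>Representatives of residue classes in the band\<close>

text \<open>The half-open interval \<open>band N\<close> thus consists of \<open>N\<close>
  consecutive integers for either parity, one for each residue class.\<close>

lemma band_width: "\<lceil>real N / 2\<rceil> + \<lfloor>real N / 2\<rfloor> = int N"
proof -
  obtain n where "N = 2 * n \<or> N = 2 * n + 1" by (metis oddE evenE)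
  moreover have "\<lceil>real (2 * n + 1) / 2\<rceil> = int n + 1" "\<lfloor>real (2 * n + 1) / 2\<rfloor> = int n"
    by (intro ceiling_unique floor_unique; simp)+
  ultimately show ?thesis by auto
qed

lemma finite_band [simp]: "finite (band N)"
  by (simp add: band_def)

lemma wrap_ex1:
  assumes "0 < N"
  shows "\<exists>!k. k \<in> band N \<and> [k = j] (mod int N)"
proof -
  define a where "a = \<lceil>real N / 2\<rceil>"
  have band: "band N = {- a <.. int N - a}"
    using band_width[of N] by (auto simp: band_def a_def)
  \<comment> \<open>The standard residues start at 0, the band at \<open>1 - a\<close>; hence the
    shift by \<open>a - 1\<close> before reducing and back afterwards.\<close>
  define k where "k = (j + a - 1) mod int N - a + 1"
  have "0 \<le> (j + a - 1) mod int N" "(j + a - 1) mod int N < int N" using assms by simp_all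
  then have "k \<in> band N" unfolding band k_def by auto
  moreover have "[k = j] (mod int N)"
  proof -
    have "[(j + a - 1) mod int N + (1 - a) = j + a - 1 + (1 - a)] (mod int N)"
      by (intro cong_add) auto
    then show ?thesis by (simp add: k_def algebra_simps)
  qed
  moreover have "k = k'" if "k \<in> band N" "k' \<in> band N" "[k = k'] (mod int N)" for k k'
  proof -
    have "int N dvd k - k'" using that(3) by (simp add: cong_iff_dvd_diff)
    moreover have "\<bar>k - k'\<bar> < int N" using that(1,2) unfolding band by auto
    ultimately show ?thesis using zdvd_imp_le[of "int N" "\<bar>k - k'\<bar>"] by (cases "k = k'") auto
  qed
  ultimately show ?thesis by (metis cong_sym cong_trans)
qed

lemma wrap:
  assumes "0 < N"
  shows wrap_in_band: "wrap N j \<in> band N" and wrap_cong: "[wrap N j = j] (mod int N)"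
  unfolding wrap_def using theI'[OF wrap_ex1[OF assms, of j]] by blast+

lemma wrap_eq_iff: "0 < N \<Longrightarrow> wrap N j = k \<longleftrightarrow> k \<in> band N \<and> [k = j] (mod int N)"
  using wrap_in_band[of N j] wrap_cong[of N j] wrap_ex1[of N j] by blast

section \<open>The univariate functions on the lattice line and their aliasing\<close>

definition lattice_freq :: "nat \<Rightarrow> (nat \<Rightarrow> nat) \<Rightarrow> (nat \<Rightarrow> int) \<Rightarrow> int" where
  "lattice_freq d z k = (\<Sum>l<d. k l * int (z l))"

text \<open>The coefficients are a parameter because \<open>c\<close> and its modulations by the
  \<open>d\<close> shifts all produce functions of this kind.\<close>

definition line_series :: "nat \<Rightarrow> (nat \<Rightarrow> nat) \<Rightarrow> ((nat \<Rightarrow> int) \<Rightarrow> complex) \<Rightarrow> real \<Rightarrow> complex" where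
  "line_series d z g t =
     (\<Sum>\<^sub>\<infinity>k\<in>freqs d. g k * cis (2 * pi * (real_of_int (lattice_freq d z k) * t)))"

lemma wave_lattice_line:
  "wave d k (lattice_line z t) = cis (2 * pi * (real_of_int (lattice_freq d z k) * t))"
  by (simp add: wave_def lattice_line_def lattice_freq_def sum_distrib_left sum_distrib_right mult_ac)

lemma line_series_wiener_continuous:
  assumes "(\<lambda>k. norm (g k)) summable_on freqs d"
  shows "wiener_continuous1 (line_series d z g)"
proof -
  define \<phi> where "\<phi> k = restrict (\<lambda>_. lattice_freq d z k) {..<1::nat}" for k
  interpret wave_series 1 "freqs d" g \<phi>
    using assms by unfold_locales (auto simp: freqs_def \<phi>_def)
  have "(\<lambda>x. line_series d z g (x 0)) = F"
    by (simp add: F_def line_series_def wave_def \<phi>_def fun_eq_iff del: One_nat_def)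
       (simp add: lessThan_Suc)
  then show ?thesis
    unfolding wiener_continuous1_def using F_wiener_continuous by simp
qed

lemma sample_line:
  assumes "f \<in> wiener d \<inter> continuous_torus d"
  shows "f (lattice_line z t) = line_series d z (fourier_coeff d f) t"
  unfolding line_series_def fourier_inversion[OF assms, of "lattice_line z t"] wave_lattice_line ..

lemma sample_shifted_line:
  assumes "f \<in> wiener d \<inter> continuous_torus d" "l < d"
  shows "f (shift_point l \<alpha> (lattice_line z t)) =
           line_series d z (\<lambda>k. fourier_coeff d f k * cis (2 * pi * (real_of_int (k l) * \<alpha>))) t"
proof -
  let ?x = "lattice_line z t"
  have "wave d k (shift_point l \<alpha> ?x) = cis (2 * pi * (real_of_int (k l) * \<alpha>)) * wave d k ?x" for k
  proof -
    \<comment> \<open>By periodicity the wave does not see the \<open>frac\<close> in the shifted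
      point.\<close>
    have "wave d k (shift_point l \<alpha> ?x) = wave d k (?x(l := ?x l + \<alpha>))"
      using torus_fun_wave[of d k] unfolding torus_fun_def shift_point_def
      by (auto simp: frac_def)
    moreover have "(\<Sum>i<d. real_of_int (k i) * (?x(l := ?x l + \<alpha>)) i)
        = (\<Sum>i<d. real_of_int (k i) * ?x i + (if i = l then real_of_int (k l) * \<alpha> else 0))"
      by (intro sum.cong) (auto simp: algebra_simps)
    ultimately show ?thesis
      using assms(2) by (simp add: wave_def sum.distrib cis_mult algebra_simps)
  qed
  then show ?thesis
    unfolding line_series_def fourier_inversion[OF assms(1), of "shift_point l \<alpha> ?x"]
    by (simp add: wave_lattice_line mult.assoc)
qed

text \<open>The aliasing formula. Exchanging the finite sum over samples with the series leaves, for
  each \<open>k\<close>, a sum of roots of unity that is \<open>M\<close> or 0.\<close>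

lemma has_sum_dft_line_series:
  assumes "(\<lambda>k. norm (g k)) summable_on freqs d" "0 < M"
  shows "((\<lambda>k. if [lattice_freq d z k = \<omega>] (mod int M) then g k else 0)
            has_sum dft M (line_series d z g) \<omega>) (freqs d)"
proof -
  let ?m = "lattice_freq d z"
  have s: "(\<lambda>k. g k * cis (2 * pi * (real_of_int (?m k) * t))) summable_on freqs d" for t
    by (rule abs_summable_summable, rule summable_norm_bound(1)[OF assms(1)]) (simp add: norm_mult)
  have "((\<lambda>k. (\<Sum>j<M. g k * cis (2 * pi * (real_of_int (?m k) * (real j / real M)))
               * cis (- 2 * pi * real_of_int \<omega> * real j / real M)) * (1 / of_nat M))
         has_sum (\<Sum>j<M. line_series d z g (real j / real M)
               * cis (- 2 * pi * real_of_int \<omega> * real j / real M)) * (1 / of_nat M)) (freqs d)"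
    unfolding line_series_def
    by (intro has_sum_cmult_left has_sum_sum has_sum_infsum s) auto
  also have "(\<Sum>j<M. line_series d z g (real j / real M)
               * cis (- 2 * pi * real_of_int \<omega> * real j / real M)) * (1 / of_nat M)
           = dft M (line_series d z g) \<omega>"
    by (simp add: dft_def)
  also have "(\<lambda>k. (\<Sum>j<M. g k * cis (2 * pi * (real_of_int (?m k) * (real j / real M)))
               * cis (- 2 * pi * real_of_int \<omega> * real j / real M)) * (1 / of_nat M))
           = (\<lambda>k. if [?m k = \<omega>] (mod int M) then g k else 0)"
  proof
    fix k
    have "(\<Sum>j<M. g k * cis (2 * pi * (real_of_int (?m k) * (real j / real M)))
               * cis (- 2 * pi * real_of_int \<omega> * real j / real M))
        = g k * (\<Sum>j<M. cis (2 * pi * real_of_int (?m k - \<omega>) * real j / real M))"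
      unfolding sum_distrib_left mult.assoc cis_mult
      by (intro sum.cong refl arg_cong2[where f = times] arg_cong[where f = cis])
         (simp add: field_simps)
    then show "(\<Sum>j<M. g k * cis (2 * pi * (real_of_int (?m k) * (real j / real M)))
               * cis (- 2 * pi * real_of_int \<omega> * real j / real M)) * (1 / of_nat M)
        = (if [?m k = \<omega>] (mod int M) then g k else 0)"
      using assms(2) by (simp only: sum_roots_of_unity) (auto simp: cong_iff_dvd_diff)
  qed
  finally show ?thesis .
qed

lemma sum_band_cong:
  assumes "0 < M"
  shows "(\<Sum>\<omega>\<in>band M. if [j = \<omega>] (mod int M) then x else (0::'a::comm_monoid_add)) = x"
proof -
  have "(\<Sum>\<omega>\<in>band M. if [j = \<omega>] (mod int M) then x else 0)
      = (\<Sum>\<omega>\<in>band M. if \<omega> = wrap M j then x else 0)"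
  proof (rule sum.cong)
    fix \<omega> assume "\<omega> \<in> band M"
    then have "[j = \<omega>] (mod int M) \<longleftrightarrow> \<omega> = wrap M j"
      using wrap_eq_iff[OF assms, of j \<omega>] by (metis cong_sym)
    then show "(if [j = \<omega>] (mod int M) then x else 0) = (if \<omega> = wrap M j then x else 0)" by simp
  qed simp
  then show ?thesis using wrap_in_band[OF assms] by simp
qed

text \<open>The part of the DFT that comes from \<open>I\<close>. For a reconstructing lattice at
  most one term of the sum survives.\<close>

definition lattice_image ::
  "nat \<Rightarrow> (nat \<Rightarrow> nat) \<Rightarrow> nat \<Rightarrow> (nat \<Rightarrow> int) set \<Rightarrow> ((nat \<Rightarrow> int) \<Rightarrow> complex) \<Rightarrow> int \<Rightarrow> complex" where
  "lattice_image d z M I g \<omega> = (\<Sum>k\<in>I. if [lattice_freq d z k = \<omega>] (mod int M) then g k else 0)"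

text \<open>Each frequency outside \<open>I\<close> lands on exactly one \<open>\<omega>\<close> of
  the band. Summed over the band, aliasing therefore counts the mass outside \<open>I\<close> once
  and not \<open>M\<close> times.\<close>

lemma dft_lattice_image:
  assumes g: "(\<lambda>k. norm (g k)) summable_on freqs d" and "0 < M" "finite I" "I \<subseteq> freqs d"
  shows "(\<Sum>\<omega>\<in>band M. norm (dft M (line_series d z g) \<omega> - lattice_image d z M I g \<omega>))
           \<le> norm1 (freqs d) (\<lambda>k. g k - restr I g k)"
proof -
  let ?P = "\<lambda>\<omega> k. [lattice_freq d z k = \<omega>] (mod int M)" and ?r = "\<lambda>k. g k - restr I g k"
  have r: "(\<lambda>k. norm (?r k)) summable_on freqs d"
    by (rule summable_norm_bound(1)[OF g]) (simp add: restr_def)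
  have rP: "(\<lambda>k. norm (if ?P \<omega> k then ?r k else 0)) summable_on freqs d" for \<omega>
    by (rule summable_norm_bound(1)[OF r]) simp
  have "norm (dft M (line_series d z g) \<omega> - lattice_image d z M I g \<omega>)
          \<le> (\<Sum>\<^sub>\<infinity>k\<in>freqs d. norm (if ?P \<omega> k then ?r k else 0))" for \<omega>
  proof -
    have "((\<lambda>k. if ?P \<omega> k then g k else 0) has_sum lattice_image d z M I g \<omega>) I"
      unfolding lattice_image_def using assms(3) by (rule has_sum_finite)
    then have "((\<lambda>k. if ?P \<omega> k then restr I g k else 0) has_sum lattice_image d z M I g \<omega>) (freqs d)"
      by (rule has_sum_cong_neutral[THEN iffD1, rotated -1])
         (use assms(4) in \<open>auto simp: restr_def\<close>)
    with has_sum_dft_line_series[OF g assms(2)]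
    have "((\<lambda>k. (if ?P \<omega> k then g k else 0) + (-1) * (if ?P \<omega> k then restr I g k else 0))
            has_sum dft M (line_series d z g) \<omega> + (-1) * lattice_image d z M I g \<omega>) (freqs d)"
      by (intro has_sum_add has_sum_cmult_right)
    also have "(\<lambda>k. (if ?P \<omega> k then g k else 0) + (-1) * (if ?P \<omega> k then restr I g k else 0)) =
        (\<lambda>k. if ?P \<omega> k then ?r k else 0)" by auto
    finally have "dft M (line_series d z g) \<omega> - lattice_image d z M I g \<omega> =
      (\<Sum>\<^sub>\<infinity>k\<in>freqs d. if ?P \<omega> k then ?r k else 0)" by (simp add: infsumI)
    then show ?thesis using norm_infsum_bound[OF rP] by simp
  qed
  then have "(\<Sum>\<omega>\<in>band M. norm (dft M (line_series d z g) \<omega> - lattice_image d z M I g \<omega>))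
      \<le> (\<Sum>\<omega>\<in>band M. \<Sum>\<^sub>\<infinity>k\<in>freqs d. norm (if ?P \<omega> k then ?r k else 0))"
    by (intro sum_mono)
  also have "\<dots> = (\<Sum>\<^sub>\<infinity>k\<in>freqs d. \<Sum>\<omega>\<in>band M. norm (if ?P \<omega> k then ?r k else 0))"
    by (intro infsumI[symmetric] has_sum_sum has_sum_infsum rP) auto
  also have "\<dots> = (\<Sum>\<^sub>\<infinity>k\<in>freqs d. norm (?r k))"
  proof (rule infsum_cong)
    fix k
    have "(\<Sum>\<omega>\<in>band M. norm (if ?P \<omega> k then ?r k else 0)) = (\<Sum>\<omega>\<in>band M. if ?P \<omega> k then norm (?r k) else 0)"
      by (intro sum.cong) auto
    then show "(\<Sum>\<omega>\<in>band M. norm (if ?P \<omega> k then ?r k else 0)) = norm (?r k)"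
      by (simp only: sum_band_cong[OF assms(2)])
  qed
  finally show ?thesis by (simp add: norm1_def)
qed

text \<open>The lattice images of the \<open>s\<close> best frequencies compete with the \<open>s\<close> largest entries of the DFT.\<close>

lemma dft_opt_tail:
  assumes g: "(\<lambda>k. norm (g k)) summable_on freqs d" and "0 < M" "finite I" "I \<subseteq> freqs d"
    and S: "S \<subseteq> I" "card S \<le> s"
  shows "norm1 (band M) (\<lambda>\<omega>. dft M (line_series d z g) \<omega> - opt (band M) s (dft M (line_series d z g)) \<omega>)
           \<le> (\<Sum>k\<in>I - S. norm (g k)) + norm1 (freqs d) (\<lambda>k. g k - restr I g k)"
proof -
  let ?D = "dft M (line_series d z g)" and ?G = "lattice_image d z M I g"
  let ?P = "\<lambda>\<omega> k. [lattice_freq d z k = \<omega>] (mod int M)"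
  define T where "T = (\<lambda>k. wrap M (lattice_freq d z k)) ` S"
  have "finite S" using S(1) assms(3) finite_subset by blast
  then have T: "T \<subseteq> band M" "card T \<le> s"
    using S(2) card_image_le[of S] wrap_in_band[OF assms(2)] unfolding T_def
    by (auto intro: order_trans)
  have "norm1 (band M) (\<lambda>\<omega>. ?D \<omega> - opt (band M) s ?D \<omega>) \<le> (\<Sum>\<omega>\<in>band M - T. norm (?D \<omega>))"
    by (rule opt_best) (use T in auto)
  also have "\<dots> \<le> (\<Sum>\<omega>\<in>band M - T. norm (?D \<omega> - ?G \<omega>) + (\<Sum>k\<in>I - S. if ?P \<omega> k then norm (g k) else 0))"
  proof (rule sum_mono)
    fix \<omega> assume \<omega>: "\<omega> \<in> band M - T"
    have "?G \<omega> = (\<Sum>k\<in>I - S. if ?P \<omega> k then g k else 0)"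
      unfolding lattice_image_def
    proof (rule sum.mono_neutral_right[OF assms(3)])
      show "\<forall>k\<in>I - (I - S). (if ?P \<omega> k then g k else 0) = 0"
      proof
        fix k assume "k \<in> I - (I - S)"
        then have "wrap M (lattice_freq d z k) \<in> T" by (auto simp: T_def)
        then have "wrap M (lattice_freq d z k) \<noteq> \<omega>" using \<omega> by auto
        then have "\<not> ?P \<omega> k" using \<omega> wrap_eq_iff[OF assms(2)] by (metis DiffD1 cong_sym)
        then show "(if ?P \<omega> k then g k else 0) = 0" by simp
      qed
    qed auto
    then have "norm (?G \<omega>) \<le> (\<Sum>k\<in>I - S. norm (if ?P \<omega> k then g k else 0))"
      by (simp add: sum_norm_le)
    also have "\<dots> = (\<Sum>k\<in>I - S. if ?P \<omega> k then norm (g k) else 0)" by (intro sum.cong) auto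
    finally show "norm (?D \<omega>) \<le> norm (?D \<omega> - ?G \<omega>) + (\<Sum>k\<in>I - S. if ?P \<omega> k then norm (g k) else 0)"
      using norm_triangle_sub[of "?D \<omega>" "?G \<omega>"] by linarith
  qed
  also have "\<dots> \<le> (\<Sum>\<omega>\<in>band M. norm (?D \<omega> - ?G \<omega>) + (\<Sum>k\<in>I - S. if ?P \<omega> k then norm (g k) else 0))"
    by (intro sum_mono2) (auto intro!: add_nonneg_nonneg sum_nonneg)
  also have "\<dots> = (\<Sum>\<omega>\<in>band M. norm (?D \<omega> - ?G \<omega>)) + (\<Sum>k\<in>I - S. norm (g k))"
    unfolding sum.distrib
    using sum.swap[of "\<lambda>\<omega> k. if ?P \<omega> k then norm (g k) else 0" "I - S" "band M"]
    by (simp only: sum_band_cong[OF assms(2)])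
  finally show ?thesis
    using dft_lattice_image[OF g assms(2,3,4), of z] by linarith
qed

section \<open>Frequency recovery from phases\<close>

text \<open>For \<open>x = pi / N \<le> 7/20\<close> the Taylor remainder \<open>x ^ 3 / 6\<close>
  is at most \<open>49/2400 * x\<close>, so \<open>sin x\<close> keeps 97/100 of \<open>x\<close>,
  and 97/100 of \<open>pi\<close> still exceeds 3.\<close>

lemma sin_pi_div_ge:
  assumes "9 \<le> N"
  shows "3 / real N \<le> sin (pi / real N)"
proof -
  define x where "x = pi / real N"
  have x: "0 < x" "x \<le> (7/20)" using assms pi_approx by (auto simp: x_def field_simps)
  have "\<bar>sin x - (\<Sum>m<3. sin_coeff m * x ^ m)\<bar> \<le> inverse (fact 3) * \<bar>x\<bar> ^ 3"
    by (rule Maclaurin_sin_bound)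
  then have "\<bar>sin x - x\<bar> \<le> x ^ 3 / 6"
    using x by (simp add: sin_coeff_def numeral_3_eq_3 fact_numeral)
  then have "x - x ^ 3 / 6 \<le> sin x" by linarith
  moreover have "x ^ 3 \<le> 49/400 * x"
  proof -
    have "x * x \<le> (7/20) * (7/20)" using x by (intro mult_mono) auto
    then have "x * x * x \<le> 49/400 * x" using x by (intro mult_right_mono) auto
    then show ?thesis by (simp add: power3_eq_cube)
  qed
  ultimately have "97/100 * x \<le> sin x" using x by linarith
  moreover have "3 / real N \<le> 97/100 * x"
    using assms pi_approx divide_right_mono[of 3 "97/100 * pi" "real N"] by (simp add: x_def)
  ultimately show ?thesis by (simp add: x_def)
qed

text \<open>A ray of angle \<open>\<alpha> \<le> pi / 2\<close> has distance
  \<open>sin \<alpha>\<close> from 1, which is at least \<open>sin (pi / N) \<ge> 3 / N\<close> once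
  \<open>\<alpha>\<close> reaches \<open>pi / N\<close>. Beyond a right angle the distance is at
  least 1.\<close>

lemma Arg_near_one:
  assumes "9 \<le> N" "norm (w - 1) < 3 / real N"
  shows "\<bar>Arg w\<bar> < pi / real N"
proof (rule ccontr)
  assume "\<not> ?thesis"
  then have ge: "pi / real N \<le> \<bar>Arg w\<bar>" by simp
  have w: "w = rcis (norm w) (Arg w)" by (simp add: rcis_cmod_Arg)
  show False
  proof (cases "\<bar>Arg w\<bar> \<le> pi / 2")
    case True
    have "3 / real N \<le> sin (pi / real N)" by (rule sin_pi_div_ge[OF assms(1)])
    also have "\<dots> \<le> sin \<bar>Arg w\<bar>"
      using True ge assms(1) by (intro sin_monotone_2pi_le) (auto intro: order_trans[of _ 0])
    also have "\<dots> \<le> \<bar>sin (Arg w)\<bar>" by (cases "0 \<le> Arg w") auto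
    \<comment> \<open>Rotation by \<open>- Arg w\<close> makes \<open>w\<close> real, so the
      imaginary part comes from the rotated 1 alone.\<close>
    also have "\<dots> = \<bar>Im ((w - 1) * cis (- Arg w))\<bar>"
    proof -
      have "w * cis (- Arg w) = complex_of_real (norm w)"
        using w by (metis add.right_inverse cis_rcis_eq mult.right_neutral rcis_mult rcis_zero_arg)
      then show ?thesis by (simp add: left_diff_distrib del: times_complex.sel)
    qed
    also have "\<dots> \<le> norm ((w - 1) * cis (- Arg w))" by (rule abs_Im_le_cmod)
    also have "\<dots> = norm (w - 1)" by (simp add: norm_mult)
    finally show False using assms(2) by simp
  next
    case False
    have "cos \<bar>Arg w\<bar> \<le> cos (pi / 2)"
      using False Arg_bounded[of w] by (intro cos_monotone_0_pi_le) auto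
    then have "cos (Arg w) \<le> 0" by (cases "0 \<le> Arg w") auto
    then have "Re w \<le> 0" by (subst w) (auto simp: mult_nonneg_nonpos)
    then have "1 \<le> \<bar>Re (w - 1)\<bar>" by simp
    also have "\<dots> \<le> norm (w - 1)" by (rule abs_Re_le_cmod)
    finally have "1 < 3 / real N" using assms(2) by simp
    then show False using assms(1) by simp
  qed
qed

text \<open>
  The quotient of the two entries is within \<open>3 / N\<close> of \<open>cis (2 pi k / N)\<close> after normalization, so that
  its argument is off by less than \<open>pi / N\<close>.
\<close>

lemma phase_recovery:
  fixes u w c :: complex and \<epsilon> :: real
  assumes "9 \<le> N" "k \<in> band N"
    and u: "norm (u - c) \<le> \<epsilon>"
    and w: "norm (w - c * cis (2 * pi * (real_of_int k * (1 / real N)))) \<le> \<epsilon>"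
    and c: "(1 + 2 * real N / 3) * \<epsilon> < norm c"
  shows "wrap N (round (real N * Arg (w / u) / (2 * pi))) = k"
proof -
  define \<theta> where "\<theta> = 2 * pi * (real_of_int k * (1 / real N))"
  have N: "0 < real N" using assms(1) by simp
  have \<epsilon>: "0 \<le> \<epsilon>" using norm_ge_zero u by (rule order_trans)
  have "norm c \<le> norm u + norm (u - c)" by (metis norm_minus_commute norm_triangle_sub)
  \<comment> \<open>The coefficient 2 N / 3 is chosen so that \<open>2 * \<epsilon> / norm u\<close>
    falls below \<open>3 / N\<close>.\<close>
  then have u_gt: "2 * real N / 3 * \<epsilon> < norm u" using u c by (simp add: algebra_simps)
  then have "0 < norm u" using \<epsilon> N by (smt (verit) divide_nonneg_nonneg mult_nonneg_nonneg)
  then have u0: "u \<noteq> 0" by auto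
  define q where "q = w / u * cis (- \<theta>)"
  have "norm (w - u * cis \<theta>) \<le> 2 * \<epsilon>"
  proof -
    have "w - u * cis \<theta> = (w - c * cis \<theta>) - (u - c) * cis \<theta>" by (simp add: algebra_simps)
    then have "norm (w - u * cis \<theta>) \<le> norm (w - c * cis \<theta>) + norm ((u - c) * cis \<theta>)"
      using norm_triangle_ineq4 by metis
    then show ?thesis using u w unfolding \<theta>_def[symmetric] by (simp add: norm_mult)
  qed
  moreover have "q - 1 = (w - u * cis \<theta>) * cis (- \<theta>) / u"
    using u0 by (simp add: q_def field_simps cis_mult)
  ultimately have "norm (q - 1) \<le> 2 * \<epsilon> / norm u"
    by (simp add: norm_mult norm_divide divide_right_mono)
  also have "\<dots> < 3 / real N" using u_gt N \<open>0 < norm u\<close> by (simp add: field_simps)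
  finally have q: "norm (q - 1) < 3 / real N" .
  then have Arg_q: "\<bar>Arg q\<bar> < pi / real N" by (rule Arg_near_one[OF assms(1)])
  have "3 / real N \<le> 1" using assms(1) by simp
  with q have "q \<noteq> 0" by auto
  then have w0: "w \<noteq> 0" by (auto simp: q_def)
  have "w / u = q * cis \<theta>" by (simp add: q_def mult.assoc cis_mult)
  then have "sgn (w / u) = cis (Arg q) * cis \<theta>"
    using \<open>q \<noteq> 0\<close> by (simp add: sgn_mult cis_Arg)
  then have "cis (Arg (w / u)) = cis (Arg q + \<theta>)"
    using u0 w0 by (simp add: cis_Arg cis_mult)
  then have "cis (Arg (w / u)) * cis (- (Arg q + \<theta>)) = 1"
    by (simp only: cis_mult) simp
  moreover have "Arg (w / u) + - (Arg q + \<theta>) = 2 * pi * ((Arg (w / u) - Arg q - \<theta>) / (2 * pi))"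
    by simp
  ultimately have "cis (2 * pi * ((Arg (w / u) - Arg q - \<theta>) / (2 * pi))) = 1"
    by (simp only: cis_mult)
  \<comment> \<open>\<open>Arg\<close> is additive only up to full turns. Scaled by
    \<open>N / (2 * pi)\<close>, these become multiples of \<open>N\<close>, which
    \<open>wrap\<close> removes.\<close>
  then obtain m :: int where "(Arg (w / u) - Arg q - \<theta>) / (2 * pi) = of_int m"
    unfolding cis_eq_1_iff_Ints by (auto elim: Ints_cases)
  then have "Arg (w / u) = Arg q + \<theta> + 2 * pi * of_int m" by (simp add: field_simps)
  then have eq: "real N * Arg (w / u) / (2 * pi) - of_int (k + int N * m) = real N * Arg q / (2 * pi)"
    using N by (simp add: \<theta>_def field_simps)
  have "\<bar>real N * Arg q / (2 * pi)\<bar> < 1 / 2"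
    using Arg_q N by (simp add: abs_mult field_simps)
  then have "round (real N * Arg (w / u) / (2 * pi)) = k + int N * m"
    by (intro round_unique') (simp only: eq)
  then show ?thesis
    using assms(1,2) by (simp add: wrap_eq_iff cong_def)
qed

section \<open>The error of the assembled vector\<close>

text \<open>
  \<open>G\<close> is the transform of \<open>c\<close> under the injection \<open>\<psi>\<close>, \<open>v\<close> its approximation and \<open>\<kappa>\<close> the recovered
  frequency. The error splits into the transported error \<open>v - G\<close> and the frequencies that were
  recovered wrongly, of which there are at most \<open>4 s\<close>, each of magnitude at most \<open>\<theta>\<close>.
\<close>

lemma assembly_error:
  fixes v G :: "'w \<Rightarrow> complex" and c :: "'k \<Rightarrow> complex"
  assumes "finite I" "finite B" "finite J" "I \<subseteq> J" "\<kappa> ` supp v \<subseteq> J"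
    and v: "supp v \<subseteq> B" "card (supp v) \<le> 2 * s"
    and \<psi>: "inj_on \<psi> I" "\<psi> ` J \<subseteq> B"
    and G: "\<And>k. k \<in> I \<Longrightarrow> G (\<psi> k) = c k" "\<And>\<omega>. \<omega> \<notin> \<psi> ` I \<Longrightarrow> G \<omega> = 0"
    and "0 \<le> \<theta>"
    and rec: "\<And>k. k \<in> I \<Longrightarrow> \<psi> k \<in> supp v \<Longrightarrow> \<theta> < norm (c k) \<Longrightarrow> \<kappa> (\<psi> k) = k"
    and b: "\<And>k. b k = (if \<psi> k \<in> supp v \<and> \<kappa> (\<psi> k) = k then v (\<psi> k) else 0)"
  shows "norm2 J (\<lambda>k. b k - restr I c k)
           \<le> norm2 B (\<lambda>\<omega>. v \<omega> - G \<omega>) + 2 * sqrt (real s) * \<theta>"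
proof -
  define R where "R = {k. \<psi> k \<in> supp v \<and> \<kappa> (\<psi> k) = k}"
  \<comment> \<open>Where the error is a transported entry of \<open>v - G\<close>: at recorded
    frequencies, and at frequencies of \<open>I\<close> missed by \<open>v\<close>, where
    \<open>b k\<close> and \<open>v (\<psi> k)\<close> are both 0.\<close>
  define P where "P = R \<union> {k \<in> I. \<psi> k \<notin> supp v}"
  define p where "p k = (if k \<in> P then v (\<psi> k) - G (\<psi> k) else 0)" for k
  define q where "q k = b k - restr I c k - p k" for k
  \<comment> \<open>The remaining error sits at recorded frequencies outside \<open>I\<close> and at
    frequencies of \<open>I\<close> whose entry was found but not recorded there.\<close>
  define Q where "Q = (R - I) \<union> {k \<in> I - R. \<psi> k \<in> supp v}"
  have fin: "finite (supp v)" using assms(2) v(1) finite_subset by blast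
  have RJ: "R \<subseteq> J" using assms(5) by (force simp: R_def)
  have PJ: "P \<subseteq> J" using RJ assms(4) by (auto simp: P_def)
  have QJ: "Q \<subseteq> J" using RJ assms(4) by (auto simp: Q_def)
  have injR: "inj_on \<psi> R" by (rule inj_on_inverseI[of _ \<kappa>]) (simp add: R_def)
  have injP: "inj_on \<psi> P"
  proof (rule inj_onI)
    fix x y assume "x \<in> P" "y \<in> P" "\<psi> x = \<psi> y"
    then show "x = y" using inj_onD[OF injR] inj_onD[OF \<psi>(1)] by (auto simp: P_def R_def)
  qed
  have p: "L2_set (\<lambda>k. norm (p k)) J \<le> L2_set (\<lambda>\<omega>. norm (v \<omega> - G \<omega>)) B"
  proof -
    have "(\<Sum>k\<in>J. (norm (p k))\<^sup>2) = (\<Sum>k\<in>P. (norm (v (\<psi> k) - G (\<psi> k)))\<^sup>2)"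
      using PJ assms(3) by (intro sum.mono_neutral_cong_right) (auto simp: p_def)
    also have "\<dots> = (\<Sum>\<omega>\<in>\<psi> ` P. (norm (v \<omega> - G \<omega>))\<^sup>2)" by (simp add: sum.reindex[OF injP])
    also have "\<dots> \<le> (\<Sum>\<omega>\<in>B. (norm (v \<omega> - G \<omega>))\<^sup>2)"
      using PJ \<psi>(2) assms(2) by (intro sum_mono2) auto
    finally show ?thesis by (simp add: L2_set_def)
  qed
  have q0: "q k = 0" if "k \<notin> Q" for k
    using that G(1)[of k] by (auto simp: q_def p_def P_def Q_def R_def b restr_def supp_def)
  have q\<theta>: "norm (q k) \<le> \<theta>" if k: "k \<in> Q" for k
  proof (cases "k \<in> R - I")
    case True
    then have "q k = G (\<psi> k)" by (auto simp: q_def p_def P_def R_def b restr_def)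
    \<comment> \<open>A larger value would belong to some \<open>k'\<close> in \<open>I\<close> with
      the same image under \<open>\<psi>\<close>. Correct recovery of \<open>k'\<close> then forces
      \<open>k = k'\<close>, although \<open>k\<close> lies outside \<open>I\<close>.\<close>
    moreover have "norm (G (\<psi> k)) \<le> \<theta>"
    proof (rule ccontr)
      assume "\<not> ?thesis"
      then have gt: "\<theta> < norm (G (\<psi> k))" by simp
      then have "G (\<psi> k) \<noteq> 0" using \<open>0 \<le> \<theta>\<close> by auto
      then obtain k' where k': "k' \<in> I" "\<psi> k = \<psi> k'" using G(2)[of "\<psi> k"] by blast
      then have "\<kappa> (\<psi> k') = k'" using True gt G(1)[of k'] by (intro rec) (auto simp: R_def)
      then show False using True k' by (auto simp: R_def)
    qed
    ultimately show ?thesis by simp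
  next
    case False
    then have k': "k \<in> I" "k \<notin> R" "\<psi> k \<in> supp v" using k by (auto simp: Q_def)
    then have "q k = - c k" by (auto simp: q_def p_def P_def R_def b restr_def)
    moreover have "norm (c k) \<le> \<theta>" using rec[of k] k' by (force simp: R_def)
    ultimately show ?thesis by simp
  qed
  \<comment> \<open>Both parts inject into \<open>supp v\<close> by \<open>\<psi>\<close>; the
    square root of \<open>4 * s\<close> is the factor in the claim.\<close>
  have cardQ: "card Q \<le> 4 * s"
  proof -
    have "card (R - I) \<le> card (supp v)"
      by (rule card_inj_on_le[of \<psi>]) (use injR fin in \<open>auto simp: R_def inj_on_def\<close>)
    moreover have "card {k \<in> I - R. \<psi> k \<in> supp v} \<le> card (supp v)"
      by (rule card_inj_on_le[of \<psi>]) (use \<psi>(1) fin in \<open>auto simp: inj_on_def\<close>)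
    ultimately show ?thesis
      using v(2) card_Un_le[of "R - I" "{k \<in> I - R. \<psi> k \<in> supp v}"] unfolding Q_def by linarith
  qed
  have q: "L2_set (\<lambda>k. norm (q k)) J \<le> 2 * sqrt (real s) * \<theta>"
  proof -
    have "(\<Sum>k\<in>J. (norm (q k))\<^sup>2) = (\<Sum>k\<in>Q. (norm (q k))\<^sup>2)"
      using QJ assms(3) q0 by (intro sum.mono_neutral_right) auto
    also have "\<dots> \<le> (\<Sum>k\<in>Q. \<theta>\<^sup>2)" using q\<theta> by (intro sum_mono power_mono) auto
    also have "\<dots> \<le> real (4 * s) * \<theta>\<^sup>2"
      using cardQ by (simp del: of_nat_mult add: mult_right_mono)
    also have "\<dots> = (2 * sqrt (real s) * \<theta>)\<^sup>2" by (simp add: power_mult_distrib)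
    finally show ?thesis
      unfolding L2_set_def using \<open>0 \<le> \<theta>\<close> by (intro real_le_lsqrt) auto
  qed
  have "norm2 J (\<lambda>k. b k - restr I c k) = L2_set (\<lambda>k. norm (p k + q k)) J"
    by (simp add: norm2_finite[OF assms(3)] q_def)
  also have "\<dots> \<le> L2_set (\<lambda>k. norm (p k) + norm (q k)) J"
    by (intro L2_set_mono norm_triangle_ineq) auto
  also have "\<dots> \<le> L2_set (\<lambda>k. norm (p k)) J + L2_set (\<lambda>k. norm (q k)) J"
    by (rule L2_set_triangle_ineq)
  finally show ?thesis using p q by (simp add: norm2_finite[OF assms(2)])
qed

section \<open>Error budget of the univariate transforms\<close>

text \<open>\<open>E\<close> bounds the term from \<open>M powr (- r)\<close> and the noise,
  simultaneously for the unshifted and all shifted transforms.\<close>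

locale lattice_recovery =
  fixes d :: nat and z :: "nat \<Rightarrow> nat" and M s :: nat and I :: "(nat \<Rightarrow> int) set"
    and c :: "(nat \<Rightarrow> int) \<Rightarrow> complex" and E :: real
  assumes summable: "(\<lambda>k. norm (c k)) summable_on freqs d"
    and I: "finite I" "I \<subseteq> freqs d" "reconstructing d z M I"
    and s: "1 \<le> s" "2 * s \<le> M"
    and E: "0 \<le> E"
begin

definition \<tau> :: real where "\<tau> = norm1 (freqs d) (\<lambda>k. c k - restr I c k)"
definition \<rho> :: real where "\<rho> = norm1 (freqs d) (\<lambda>k. restr I c k - opt I s (restr I c) k)"
text \<open>Common bound for \<open>sft_delta\<close> of all transforms: their DFT tails are at most
  \<open>\<rho> + \<tau>\<close>, best \<open>s\<close>-term error plus aliasing.\<close>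

definition \<Delta> :: real where "\<Delta> = (\<rho> + \<tau>) / (2 * real s) + 2 * E"
definition \<psi> :: "(nat \<Rightarrow> int) \<Rightarrow> int" where "\<psi> k = wrap M (lattice_freq d z k)"

lemma M_pos: "0 < M" using s by simp

lemma \<tau>_nonneg: "0 \<le> \<tau>" by (simp add: \<tau>_def norm1_def infsum_nonneg)

lemma \<rho>_nonneg: "0 \<le> \<rho>" by (simp add: \<rho>_def norm1_def infsum_nonneg)

lemma \<psi>_band: "\<psi> k \<in> band M" by (simp add: \<psi>_def wrap_in_band M_pos)

lemma lattice_freq_\<psi>: "[lattice_freq d z k = \<psi> k] (mod int M)"
  unfolding \<psi>_def by (rule cong_sym, rule wrap_cong[OF M_pos])

lemma \<psi>_eq: "\<omega> \<in> band M \<Longrightarrow> [lattice_freq d z k = \<omega>] (mod int M) \<Longrightarrow> \<psi> k = \<omega>"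
  unfolding \<psi>_def wrap_eq_iff[OF M_pos] by (simp add: cong_sym)

lemma lattice_freq_inj:
  "k \<in> I \<Longrightarrow> k' \<in> I \<Longrightarrow> [lattice_freq d z k = lattice_freq d z k'] (mod int M) \<Longrightarrow> k = k'"
  using I(3) unfolding reconstructing_def inj_on_def cong_def lattice_freq_def by blast

lemma inj_\<psi>: "inj_on \<psi> I"
proof (rule inj_onI)
  fix k k' assume *: "k \<in> I" "k' \<in> I" "\<psi> k = \<psi> k'"
  then have "[lattice_freq d z k = lattice_freq d z k'] (mod int M)"
    using lattice_freq_\<psi>[of k] lattice_freq_\<psi>[of k'] by (metis cong_sym cong_trans)
  then show "k = k'" using * lattice_freq_inj by blast
qed

lemma lattice_image_\<psi>: "k \<in> I \<Longrightarrow> lattice_image d z M I g (\<psi> k) = g k"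
proof -
  assume k: "k \<in> I"
  have "[lattice_freq d z k' = \<psi> k] (mod int M) \<longleftrightarrow> k' = k" if "k' \<in> I" for k'
    using lattice_freq_inj[OF that k] lattice_freq_\<psi>[of k] by (metis cong_sym cong_trans)
  then have "lattice_image d z M I g (\<psi> k) = (\<Sum>k'\<in>I. if k' = k then g k' else 0)"
    unfolding lattice_image_def by (intro sum.cong) auto
  then show ?thesis using k I(1) by simp
qed

lemma lattice_image_outside: "\<omega> \<in> band M \<Longrightarrow> \<omega> \<notin> \<psi> ` I \<Longrightarrow> lattice_image d z M I g \<omega> = 0"
  unfolding lattice_image_def using \<psi>_eq by (intro sum.neutral) auto

text \<open>Turns \<open>\<rho>\<close> into a sum of magnitudes over a fixed set, so that one
  \<open>S\<close> serves \<open>c\<close> and all its modulations.\<close>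

lemma best_support:
  obtains S where "S \<subseteq> I" "card S \<le> s" "(\<Sum>k\<in>I - S. norm (c k)) = \<rho>"
proof -
  obtain S where S: "opt I s (restr I c) = restr S (restr I c)" "S \<subseteq> I"
    "card S = s \<or> card S < s \<and> S = I"
    using optE[OF I(1)] by metis
  have "\<rho> = (\<Sum>\<^sub>\<infinity>k\<in>I - S. norm (c k))"
    unfolding \<rho>_def norm1_def S(1)
    by (rule infsum_cong_neutral) (use I(2) S(2) in \<open>auto simp: restr_def\<close>)
  moreover have "card S \<le> s" using S(3) by auto
  ultimately show ?thesis using that[of S] S(2) I(1) by simp
qed

text \<open>\<open>g\<close> is \<open>c\<close> or one of its modulations by a shift; these change
  only phases.\<close>

context
  fixes g :: "(nat \<Rightarrow> int) \<Rightarrow> complex" and \<mu> :: "real \<Rightarrow> complex" and r :: real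
    and v :: "int \<Rightarrow> complex"
  assumes g: "\<And>k. norm (g k) = norm (c k)"
    and noise: "max_norm M (line_series d z g) * real M powr (- r) + max_norm M \<mu> \<le> E"
    and guarantee: "sft_guarantee s M r (line_series d z g) \<mu> v"
begin

private abbreviation "D \<equiv> dft M (line_series d z g)"
private abbreviation "G \<equiv> lattice_image d z M I g"

lemma summable_g: "(\<lambda>k. norm (g k)) summable_on freqs d"
  using summable by (simp add: g)

lemma tail_g: "norm1 (freqs d) (\<lambda>k. g k - restr I g k) = \<tau>"
  unfolding \<tau>_def norm1_def by (rule infsum_cong) (simp add: restr_def g)

lemma dft_close_sum: "(\<Sum>\<omega>\<in>band M. norm (D \<omega> - G \<omega>)) \<le> \<tau>"
  using dft_lattice_image[OF summable_g M_pos I(1,2)] by (simp add: tail_g)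

lemma dft_close: "\<omega> \<in> band M \<Longrightarrow> norm (D \<omega> - G \<omega>) \<le> \<tau>"
  using member_le_sum[of \<omega> "band M" "\<lambda>\<omega>. norm (D \<omega> - G \<omega>)"] dft_close_sum by simp

lemma dft_tail: "norm1 (band M) (\<lambda>\<omega>. D \<omega> - opt (band M) s D \<omega>) \<le> \<rho> + \<tau>"
proof -
  obtain S where S: "S \<subseteq> I" "card S \<le> s" "(\<Sum>k\<in>I - S. norm (c k)) = \<rho>" by (rule best_support)
  show ?thesis
    using dft_opt_tail[OF summable_g M_pos I(1,2) S(1,2), of z] S(3) by (simp add: g tail_g)
qed

lemma delta_le: "sft_delta s M r (line_series d z g) \<mu> \<le> \<Delta>"
  unfolding sft_delta_def \<Delta>_def using dft_tail noise s
  by (intro add_mono divide_right_mono mult_left_mono) auto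

lemma entry_close:
  assumes "k \<in> I" "\<psi> k \<in> supp v"
  shows "norm (v (\<psi> k) - g k) \<le> 3 * sqrt 2 * \<Delta> + \<tau>"
proof -
  have "norm (D (\<psi> k) - v (\<psi> k)) \<le> 3 * sqrt 2 * sft_delta s M r (line_series d z g) \<mu>"
    using guarantee assms(2) unfolding sft_guarantee_def by blast
  also have "\<dots> \<le> 3 * sqrt 2 * \<Delta>" using delta_le by (intro mult_left_mono) auto
  finally have "norm (v (\<psi> k) - D (\<psi> k)) \<le> 3 * sqrt 2 * \<Delta>" by (simp add: norm_minus_commute)
  moreover have "norm (D (\<psi> k) - g k) \<le> \<tau>"
    using dft_close[OF \<psi>_band[of k]] lattice_image_\<psi>[OF assms(1)] by simp
  ultimately show ?thesis
    using norm_triangle_ineq[of "v (\<psi> k) - D (\<psi> k)" "D (\<psi> k) - g k"] by simp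
qed

text \<open>Aliasing lowers an entry by at most \<open>\<tau>\<close>, so it still exceeds the
  detection level of the univariate guarantee. For the shifted transforms this also excludes a zero
  entry, and with it the arbitrary coordinate value.\<close>

lemma large_entry:
  assumes "k \<in> I" "12 * (1 + sqrt 2) * \<Delta> + \<tau> < norm (c k)"
  shows "\<psi> k \<in> supp v"
proof -
  have "12 * (1 + sqrt 2) * sft_delta s M r (line_series d z g) \<mu> \<le> 12 * (1 + sqrt 2) * \<Delta>"
    using delta_le by (intro mult_left_mono) auto
  also have "\<dots> < norm (g k) - \<tau>" using assms(2) by (simp add: g)
  also have "\<dots> \<le> norm (D (\<psi> k))"
    using dft_close[OF \<psi>_band[of k]] lattice_image_\<psi>[OF assms(1)]
      norm_triangle_ineq2[of "g k" "D (\<psi> k)"] by (simp add: norm_minus_commute)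
  finally show ?thesis using guarantee \<psi>_band unfolding sft_guarantee_def by blast
qed

lemma transform_error:
  assumes "supp v \<subseteq> band M"
  shows "norm2 (band M) (\<lambda>\<omega>. v \<omega> - G \<omega>)
           \<le> 39 * (\<rho> + \<tau>) / sqrt (real s) + 152 * sqrt (real s) * E + \<tau>"
proof -
  let ?T = "norm1 (band M) (\<lambda>\<omega>. D \<omega> - opt (band M) s D \<omega>)"
  have "norm2 (band M) (\<lambda>\<omega>. D \<omega> - v \<omega>)
      \<le> norm2 (band M) (\<lambda>\<omega>. D \<omega> - opt (band M) (2 * s) D \<omega>) + 38 * ?T / sqrt (real s)
        + 152 * sqrt (real s) * (max_norm M (line_series d z g) * real M powr (- r) + max_norm M \<mu>)"
    using guarantee unfolding sft_guarantee_def by blast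
  \<comment> \<open>\<open>opt_tail\<close> turns the \<open>2 * s\<close>-term tail into one more
    copy of the \<open>norm1\<close> tail over \<open>sqrt s\<close>: 38 becomes 39.\<close>
  also have "\<dots> \<le> ?T / sqrt (real s) + 38 * ?T / sqrt (real s) + 152 * sqrt (real s) * E"
    using opt_tail[of "band M" s D] noise s(1) by (intro add_mono mult_left_mono) auto
  also have "\<dots> = 39 * ?T / sqrt (real s) + 152 * sqrt (real s) * E" by (simp add: field_simps)
  also have "\<dots> \<le> 39 * (\<rho> + \<tau>) / sqrt (real s) + 152 * sqrt (real s) * E"
    using dft_tail s by (intro add_mono divide_right_mono) auto
  finally have 1: "L2_set (\<lambda>\<omega>. norm (D \<omega> - v \<omega>)) (band M)
      \<le> 39 * (\<rho> + \<tau>) / sqrt (real s) + 152 * sqrt (real s) * E" by (simp add: norm2_finite)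
  have 2: "L2_set (\<lambda>\<omega>. norm (D \<omega> - G \<omega>)) (band M) \<le> \<tau>"
    using L2_set_le_sum[of "band M" "\<lambda>\<omega>. norm (D \<omega> - G \<omega>)"] dft_close_sum by simp
  have "L2_set (\<lambda>\<omega>. norm (v \<omega> - G \<omega>)) (band M)
      \<le> L2_set (\<lambda>\<omega>. norm (D \<omega> - v \<omega>) + norm (D \<omega> - G \<omega>)) (band M)"
  proof (rule L2_set_mono)
    fix \<omega>
    have "v \<omega> - G \<omega> = (D \<omega> - G \<omega>) - (D \<omega> - v \<omega>)" by simp
    then show "norm (v \<omega> - G \<omega>) \<le> norm (D \<omega> - v \<omega>) + norm (D \<omega> - G \<omega>)"
      using norm_triangle_ineq4[of "D \<omega> - G \<omega>" "D \<omega> - v \<omega>"] by simp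
  qed simp
  also have "\<dots> \<le> L2_set (\<lambda>\<omega>. norm (D \<omega> - v \<omega>)) (band M) + L2_set (\<lambda>\<omega>. norm (D \<omega> - G \<omega>)) (band M)"
    by (rule L2_set_triangle_ineq)
  finally show ?thesis using 1 2 by (simp add: norm2_finite)
qed

end

text \<open>
  The constants are chosen such that \<open>2 sqrt s\<close> times the threshold is what the claimed estimate leaves
  after subtracting the error of the univariate transform.
\<close>

definition threshold :: "nat \<Rightarrow> real" where
  "threshold N = (9 / 2 + 2 * real N) * (\<rho> / real s) + (18 + 8 * real N) * E + (74 + 8 * real N) * \<tau>"

text \<open>Above the threshold an entry is detected in every transform (first bound) and precise
  enough for its phase to be rounded correctly (second bound).\<close>

lemma threshold_bounds:
  assumes "9 \<le> N"
  shows "12 * (1 + sqrt 2) * \<Delta> + \<tau> \<le> threshold N"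
    and "(1 + 2 * real N / 3) * (3 * sqrt 2 * \<Delta> + \<tau>) \<le> threshold N"
    and "0 \<le> threshold N"
proof -
  define x where "x = \<rho> / real s"
  define y where "y = \<tau> / real s"
  have x: "0 \<le> x" using \<rho>_nonneg by (simp add: x_def)
  have y: "0 \<le> y" "y \<le> \<tau>" using \<tau>_nonneg s by (auto simp: y_def divide_le_eq mult_le_cancel_left1)
  have \<Delta>: "\<Delta> = x / 2 + y / 2 + 2 * E"
    by (simp add: \<Delta>_def x_def y_def add_divide_distrib)
  have \<Delta>0: "0 \<le> \<Delta>" using x y E by (simp add: \<Delta>)
  have N: "9 \<le> real N" using assms by simp
  \<comment> \<open>With this bound on \<open>sqrt 2\<close> the two constants become
    \<open>12 * (1 + 17/12) = 29\<close> and \<open>3 * 17/12 = 17/4\<close>.\<close>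
  have sq: "sqrt 2 \<le> 17 / 12" by (rule real_le_lsqrt) (auto simp: power2_eq_square)
  have "12 * (1 + sqrt 2) * \<Delta> \<le> 29 * \<Delta>"
    using sq \<Delta>0 by (intro mult_right_mono) auto
  moreover have "9 * x \<le> real N * x" "9 * E \<le> real N * E" "9 * \<tau> \<le> real N * \<tau>"
    using N x E \<tau>_nonneg by (auto intro: mult_right_mono)
  ultimately show "12 * (1 + sqrt 2) * \<Delta> + \<tau> \<le> threshold N"
    unfolding threshold_def x_def[symmetric] \<Delta> using x y E \<tau>_nonneg by (simp add: algebra_simps)
  have "3 * sqrt 2 * \<Delta> \<le> 17 / 4 * \<Delta>" using sq \<Delta>0 by (intro mult_right_mono) auto
  \<comment> \<open>For \<open>N \<ge> 9\<close> the summand 1 is at most \<open>N / 9\<close>, and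
    2/3 + 1/9 = 7/9.\<close>
  then have "(1 + 2 * real N / 3) * (3 * sqrt 2 * \<Delta> + \<tau>) \<le> (7 / 9 * real N) * (17 / 4 * \<Delta> + \<tau>)"
    using N \<Delta>0 \<tau>_nonneg by (intro mult_mono) auto
  also have "\<dots> = 119 / 72 * (real N * x) + 119 / 72 * (real N * y) + 119 / 18 * (real N * E)
      + 7 / 9 * (real N * \<tau>)"
    by (simp add: \<Delta> algebra_simps)
  also have "\<dots> \<le> threshold N"
  proof -
    have "real N * y \<le> real N * \<tau>" using y by (intro mult_left_mono) auto
    moreover have "0 \<le> real N * x" "0 \<le> real N * E" "0 \<le> real N * \<tau>" using x E \<tau>_nonneg by auto
    moreover have "threshold N = 9 / 2 * x + 2 * (real N * x) + 18 * E + 8 * (real N * E) + 74 * \<tau> + 8 * (real N * \<tau>)"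
      unfolding threshold_def x_def[symmetric] by (simp add: algebra_simps)
    ultimately show ?thesis using x E \<tau>_nonneg by linarith
  qed
  finally show "(1 + 2 * real N / 3) * (3 * sqrt 2 * \<Delta> + \<tau>) \<le> threshold N" .
  show "0 \<le> threshold N" unfolding threshold_def using \<rho>_nonneg E \<tau>_nonneg by simp
qed

text \<open>The constants add up as 39 + 9 = 48 for \<open>\<rho>\<close>, 152 + 36 = 188 for
  \<open>E\<close>, and 39 + 1 + 148 = 188 for \<open>\<tau>\<close>, where both
  \<open>\<tau> / sqrt s\<close> and \<open>\<tau>\<close> are bounded by
  \<open>sqrt s * \<tau>\<close>.\<close>

lemma total_error:
  "39 * (\<rho> + \<tau>) / sqrt (real s) + 152 * sqrt (real s) * E + \<tau> + 2 * sqrt (real s) * threshold N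
     \<le> (48 + 4 * real N) * (\<rho> / sqrt (real s)) + (188 + 16 * real N) * sqrt (real s) * (E + \<tau>)"
proof -
  define t where "t = sqrt (real s)"
  have t: "1 \<le> t" "real s = t * t" using s by (auto simp: t_def)
  have "\<tau> / t \<le> t * \<tau>"
  proof -
    have "\<tau> / t \<le> \<tau> / 1" using t \<tau>_nonneg by (intro divide_left_mono) auto
    also have "\<dots> \<le> t * \<tau>" using t \<tau>_nonneg mult_right_mono[of 1 t \<tau>] by simp
    finally show ?thesis .
  qed
  moreover have "\<tau> \<le> t * \<tau>" using t \<tau>_nonneg mult_right_mono[of 1 t \<tau>] by simp
  moreover have "2 * t * threshold N
      = (9 + 4 * real N) * (\<rho> / t) + (36 + 16 * real N) * (t * E) + (148 + 16 * real N) * (t * \<tau>)"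
    using t by (simp add: threshold_def field_simps)
  then have "2 * t * threshold N = 9 * (\<rho> / t) + 4 * (real N * (\<rho> / t)) + 36 * (t * E)
      + 16 * (real N * (t * E)) + 148 * (t * \<tau>) + 16 * (real N * (t * \<tau>))"
    by (simp add: algebra_simps)
  moreover have "39 * (\<rho> + \<tau>) / t = 39 * (\<rho> / t) + 39 * (\<tau> / t)"
    by (simp add: add_divide_distrib)
  moreover have "152 * t * E = 152 * (t * E)" by simp
  moreover have "(48 + 4 * real N) * (\<rho> / t) + (188 + 16 * real N) * t * (E + \<tau>)
      = 48 * (\<rho> / t) + 4 * (real N * (\<rho> / t)) + 188 * (t * E) + 188 * (t * \<tau>)
        + 16 * (real N * (t * E)) + 16 * (real N * (t * \<tau>))"
    by (simp add: algebra_simps)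
  ultimately show ?thesis unfolding t_def[symmetric] by linarith
qed

end

section \<open>Analysis of the program\<close>

definition coordinate ::
  "nat \<Rightarrow> (nat \<Rightarrow> int \<Rightarrow> int) \<Rightarrow> (int \<Rightarrow> complex) \<Rightarrow> (int \<Rightarrow> complex) list \<Rightarrow> int \<Rightarrow> nat \<Rightarrow> int" where
  "coordinate N arb v vs \<omega> l =
     (if (vs ! l) \<omega> = 0 then arb l \<omega>
      else wrap N (round (real N * Arg ((vs ! l) \<omega> / v \<omega>) / (2 * pi))))"

definition recovered ::
  "nat \<Rightarrow> nat \<Rightarrow> (nat \<Rightarrow> int \<Rightarrow> int) \<Rightarrow> (int \<Rightarrow> complex) \<Rightarrow> (int \<Rightarrow> complex) list \<Rightarrow> int \<Rightarrow> nat \<Rightarrow> int" where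
  "recovered d N arb v vs \<omega> = restrict (coordinate N arb v vs \<omega>) {..<d}"

text \<open>The loop for an arbitrary recovery map \<open>\<kappa>\<close>, which separates the
  placement of entries from the computation of phases.\<close>

definition assembled ::
  "nat \<Rightarrow> (nat \<Rightarrow> nat) \<Rightarrow> nat \<Rightarrow> (int \<Rightarrow> nat \<Rightarrow> int) \<Rightarrow> (int \<Rightarrow> complex) \<Rightarrow> (nat \<Rightarrow> int) \<Rightarrow> complex" where
  "assembled d z M \<kappa> v =
     fold (\<lambda>\<omega> b. if [lattice_freq d z (\<kappa> \<omega>) = \<omega>] (mod int M) then b(\<kappa> \<omega> := b (\<kappa> \<omega>) + v \<omega>) else b)
       (sorted_list_of_set (supp v)) (\<lambda>_. 0)"

text \<open>The congruence test lets \<open>k\<close> receive only the entry at the representative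
  of \<open>k \<cdot> z\<close>, so the accumulation never adds two entries.\<close>

lemma assembled_eq:
  assumes "0 < M" "supp v \<subseteq> band M"
  shows "assembled d z M \<kappa> v k =
    (let \<omega> = wrap M (lattice_freq d z k) in if \<omega> \<in> supp v \<and> \<kappa> \<omega> = k then v \<omega> else 0)"
proof -
  let ?P = "\<lambda>\<omega>. [lattice_freq d z (\<kappa> \<omega>) = \<omega>] (mod int M)"
  have fold: "fold (\<lambda>\<omega> b. if ?P \<omega> then b(\<kappa> \<omega> := b (\<kappa> \<omega>) + v \<omega>) else b) xs b k
      = b k + (\<Sum>\<omega> | \<omega> \<in> set xs \<and> ?P \<omega> \<and> \<kappa> \<omega> = k. v \<omega>)" if "distinct xs" for xs b
    using that
  proof (induction xs arbitrary: b)
    case (Cons x xs)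
    have "{\<omega>. \<omega> \<in> set (x # xs) \<and> ?P \<omega> \<and> \<kappa> \<omega> = k} =
        (if ?P x \<and> \<kappa> x = k then insert x {\<omega>. \<omega> \<in> set xs \<and> ?P \<omega> \<and> \<kappa> \<omega> = k}
         else {\<omega>. \<omega> \<in> set xs \<and> ?P \<omega> \<and> \<kappa> \<omega> = k})" by auto
    moreover have "x \<notin> {\<omega>. \<omega> \<in> set xs \<and> ?P \<omega> \<and> \<kappa> \<omega> = k}" using Cons.prems by simp
    ultimately show ?case using Cons by simp
  qed simp
  have fin: "finite (supp v)" by (rule finite_subset[OF assms(2) finite_band])
  have "{\<omega>. \<omega> \<in> supp v \<and> ?P \<omega> \<and> \<kappa> \<omega> = k} =
    (let \<omega> = wrap M (lattice_freq d z k) in if \<omega> \<in> supp v \<and> \<kappa> \<omega> = k then {\<omega>} else {})"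
    (is "?L = ?R")
  proof -
    define w where "w = wrap M (lattice_freq d z k)"
    have w: "[lattice_freq d z k = w] (mod int M)"
      unfolding w_def by (rule cong_sym, rule wrap_cong[OF assms(1)])
    have eq: "\<omega> = w" if "\<omega> \<in> supp v" "?P \<omega>" "\<kappa> \<omega> = k" for \<omega>
    proof -
      have "\<omega> \<in> band M" "[lattice_freq d z k = \<omega>] (mod int M)" using that assms(2) by auto
      then have "w = \<omega>" unfolding w_def wrap_eq_iff[OF assms(1)] by (simp add: cong_sym)
      then show ?thesis ..
    qed
    show ?thesis
    proof (cases "w \<in> supp v \<and> \<kappa> w = k")
      case True
      then have "?L = {w}" using eq w by blast
      then show ?thesis unfolding Let_def w_def[symmetric] if_P[OF True] .
    next
      case False
      then have "?L = {}" using eq by blast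
      then show ?thesis unfolding Let_def w_def[symmetric] if_not_P[OF False] .
    qed
  qed
  then show ?thesis
    unfolding assembled_def using fin by (simp add: fold Let_def)
qed

lemma finite_cube: "finite (cube d N)"
  by (simp add: cube_def finite_PiE)

lemma cube_freqs: "cube d N \<subseteq> freqs d"
  by (auto simp: cube_def freqs_def PiE_iff)

lemma recovered_cube: "0 < N \<Longrightarrow> (\<And>l \<omega>. arb l \<omega> \<in> band N) \<Longrightarrow> recovered d N arb v vs \<omega> \<in> cube d N"
  by (auto simp: recovered_def cube_def coordinate_def wrap_in_band)

lemma sparse_assembled:
  assumes "0 < M" "sparse_on (band M) m v" "\<And>\<omega>. \<kappa> \<omega> \<in> cube d N"
  shows "sparse_on (cube d N) m (assembled d z M \<kappa> v)"
proof -
  have v: "supp v \<subseteq> band M" "finite (supp v)" "card (supp v) \<le> m"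
    using assms(2) by (auto simp: sparse_on_def)
  have sub: "supp (assembled d z M \<kappa> v) \<subseteq> \<kappa> ` supp v"
  proof
    fix k assume "k \<in> supp (assembled d z M \<kappa> v)"
    then have "wrap M (lattice_freq d z k) \<in> supp v \<and> \<kappa> (wrap M (lattice_freq d z k)) = k"
      unfolding supp_def mem_Collect_eq assembled_eq[OF assms(1) v(1)] Let_def
      by (simp split: if_splits)
    then show "k \<in> \<kappa> ` supp v" by (metis image_eqI)
  qed
  then have "card (supp (assembled d z M \<kappa> v)) \<le> card (supp v)"
    using v(2) by (meson card_image_le card_mono finite_imageI order_trans)
  moreover have "finite (supp (assembled d z M \<kappa> v))"
    using finite_subset[OF sub] v(2) by simp
  moreover have "supp (assembled d z M \<kappa> v) \<subseteq> cube d N" using sub assms(3) by blast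
  ultimately show ?thesis using v(3) unfolding sparse_on_def by simp
qed

text \<open>The \<open>SUP\<close> is meaningful only for bounded \<open>f\<close>; the absolutely
  convergent Fourier series supplies a bound.\<close>

lemma norm_le_sup_norm:
  assumes "f \<in> wiener d \<inter> continuous_torus d"
  shows "norm (f x) \<le> sup_norm f"
proof -
  interpret wave_series d "freqs d" "fourier_coeff d f" "\<lambda>k. k"
    using assms by unfold_locales (auto simp: wiener_def)
  have "f = F" using fourier_inversion[OF assms] by (simp add: F_def fun_eq_iff)
  then have "bdd_above (range (\<lambda>x. norm (f x)))"
    using norm_F_le by (auto intro!: bdd_aboveI)
  then show ?thesis unfolding sup_norm_def by (rule cSUP_upper[OF UNIV_I])
qed

lemma max_norm_le: "0 < M \<Longrightarrow> (\<And>x. norm (a x) \<le> B) \<Longrightarrow> max_norm M a \<le> B"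
  unfolding max_norm_def by (subst Max_le_iff) auto

definition line0 :: "(nat \<Rightarrow> nat) \<Rightarrow> ((nat \<Rightarrow> real) \<Rightarrow> complex) \<Rightarrow> real \<Rightarrow> complex" where
  "line0 z f t = f (lattice_line z t)"

definition line_shifted ::
  "nat \<Rightarrow> (nat \<Rightarrow> nat) \<Rightarrow> ((nat \<Rightarrow> real) \<Rightarrow> complex) \<Rightarrow> nat \<Rightarrow> real \<Rightarrow> complex" where
  "line_shifted N z f l t = f (shift_point l (1 / real N) (lattice_line z t))"

lemma line_shifted_series:
  assumes "f \<in> wiener d \<inter> continuous_torus d" "l < d"
  shows "line_shifted N z f l =
    line_series d z (\<lambda>k. fourier_coeff d f k * cis (2 * pi * (real_of_int (k l) * (1 / real N))))"
  unfolding line_shifted_def using sample_shifted_line[OF assms] by blast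

lemma line0_series:
  assumes "f \<in> wiener d \<inter> continuous_torus d"
  shows "line0 z f = line_series d z (fourier_coeff d f)"
  unfolding line0_def using sample_line[OF assms] by blast

lemma line_wiener_continuous:
  assumes "f \<in> wiener d \<inter> continuous_torus d"
  shows "wiener_continuous1 (line0 z f)" "l < d \<Longrightarrow> wiener_continuous1 (line_shifted N z f l)"
  using assms unfolding line0_series[OF assms]
  by (auto simp: line_shifted_series wiener_def norm_mult intro!: line_series_wiener_continuous)

definition good_transform ::
  "nat \<Rightarrow> nat \<Rightarrow> real \<Rightarrow> (real \<Rightarrow> complex) \<Rightarrow> (real \<Rightarrow> complex) \<Rightarrow> (int \<Rightarrow> complex) \<Rightarrow> bool" where
  "good_transform s M r a \<mu> v \<longleftrightarrow> sparse_on (band M) (2 * s) v \<and> sft_guarantee s M r a \<mu> v"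

text \<open>The part without randomness: the success of all \<open>d + 1\<close> transforms is
  assumed in \<open>v\<close> and \<open>vs\<close>.\<close>

lemma phase_encoding_error:
  assumes setting: "pe_setting d N z M I f e \<eta> arb" and params: "sft_params s M r"
    and v: "good_transform s M r (line0 z f) (\<lambda>t. e (0, t)) v"
    and vs: "\<And>l. l < d \<Longrightarrow> good_transform s M r (line_shifted N z f l) (\<lambda>t. e (Suc l, t)) (vs ! l)"
  shows "pe_error_bound d N M I f \<eta> s r (assembled d z M (recovered d N arb v vs) v)"
proof -
  have set: "1 \<le> d" "9 \<le> N" "I \<subseteq> cube d N" "reconstructing d z M I"
    "f \<in> wiener d \<inter> continuous_torus d" "0 \<le> \<eta>" "\<And>q. norm (e q) \<le> \<eta>" "\<And>l \<omega>. arb l \<omega> \<in> band N"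
    using setting unfolding pe_setting_def by blast+
  have sMr: "1 \<le> s" "2 * s \<le> M" using params by (auto simp: sft_params_def)
  then have M: "0 < M" by simp
  define c where "c = fourier_coeff d f"
  define E where "E = sup_norm f * real M powr (- r) + \<eta>"
  define \<kappa> where "\<kappa> = recovered d N arb v vs"
  define b where "b = assembled d z M \<kappa> v"
  have f_le: "norm (f x) \<le> sup_norm f" for x by (rule norm_le_sup_norm[OF set(5)])
  have sup0: "0 \<le> sup_norm f" using norm_ge_zero f_le by (rule order_trans)
  interpret lattice_recovery d z M s I c E
  proof
    show "(\<lambda>k. norm (c k)) summable_on freqs d" using set(5) by (simp add: c_def wiener_def)
    show "finite I" using set(3) finite_cube finite_subset by blast
    show "I \<subseteq> freqs d" using set(3) cube_freqs by blast
    show "reconstructing d z M I" by (rule set(4))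
    show "1 \<le> s" "2 * s \<le> M" by (rule sMr)+
    show "0 \<le> E" using set(6) sup0 by (simp add: E_def)
  qed
  define gl where "gl l k = c k * cis (2 * pi * (real_of_int (k l) * (1 / real N)))" for l k
  have noise: "max_norm M a * real M powr (- r) + max_norm M \<mu> \<le> E"
    if "\<And>t. norm (a t) \<le> sup_norm f" "\<And>t. norm (\<mu> t) \<le> \<eta>" for a \<mu> :: "real \<Rightarrow> complex"
    unfolding E_def using max_norm_le[OF M that(1)] max_norm_le[OF M that(2)]
    by (intro add_mono mult_right_mono) auto
  have line0: "line0 z f = line_series d z c" unfolding c_def by (rule line0_series[OF set(5)])
  have noise0: "max_norm M (line_series d z c) * real M powr (- r) + max_norm M (\<lambda>t. e (0, t)) \<le> E"
    unfolding line0[symmetric] by (rule noise) (auto simp: line0_def f_le set(7))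
  have linel: "line_shifted N z f l = line_series d z (gl l)" if "l < d" for l
    unfolding gl_def c_def by (rule line_shifted_series[OF set(5) that])
  have noisel: "max_norm M (line_series d z (gl l)) * real M powr (- r) + max_norm M (\<lambda>t. e (Suc l, t)) \<le> E"
    if "l < d" for l
    unfolding linel[OF that, symmetric] by (rule noise) (auto simp: line_shifted_def f_le set(7))
  have gl: "norm (gl l k) = norm (c k)" for l k by (simp add: gl_def norm_mult)
  have v': "supp v \<subseteq> band M" "card (supp v) \<le> 2 * s" "sft_guarantee s M r (line_series d z c) (\<lambda>t. e (0, t)) v"
    using v by (auto simp: good_transform_def sparse_on_def line0)
  have vs': "sft_guarantee s M r (line_series d z (gl l)) (\<lambda>t. e (Suc l, t)) (vs ! l)" if "l < d" for l
    using vs[OF that] by (simp add: good_transform_def linel[OF that])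
  have rec: "\<kappa> (\<psi> k) = k" if k: "k \<in> I" "\<psi> k \<in> supp v" "threshold N < norm (c k)" for k
  proof -
    have kc: "k \<in> cube d N" using set(3) k(1) by blast
    have "coordinate N arb v vs (\<psi> k) l = k l" if l: "l < d" for l
    proof -
      have "12 * (1 + sqrt 2) * \<Delta> + \<tau> < norm (c k)"
        using threshold_bounds(1)[OF set(2)] k(3) by linarith
      then have sup: "\<psi> k \<in> supp (vs ! l)"
        by (rule large_entry[OF gl noisel[OF l] vs'[OF l] k(1)])
      have "wrap N (round (real N * Arg ((vs ! l) (\<psi> k) / v (\<psi> k)) / (2 * pi))) = k l"
      proof (rule phase_recovery[OF set(2)])
        show "k l \<in> band N" using kc l by (auto simp: cube_def)
        show "norm (v (\<psi> k) - c k) \<le> 3 * sqrt 2 * \<Delta> + \<tau>"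
          by (rule entry_close[OF refl noise0 v'(3) k(1,2)])
        show "norm ((vs ! l) (\<psi> k) - c k * cis (2 * pi * (real_of_int (k l) * (1 / real N)))) \<le> 3 * sqrt 2 * \<Delta> + \<tau>"
          using entry_close[OF gl noisel[OF l] vs'[OF l] k(1) sup] by (simp add: gl_def)
        show "(1 + 2 * real N / 3) * (3 * sqrt 2 * \<Delta> + \<tau>) < norm (c k)"
          using threshold_bounds(2)[OF set(2)] k(3) by linarith
      qed
      then show ?thesis using sup by (simp add: coordinate_def supp_def)
    qed
    then show ?thesis
      unfolding \<kappa>_def recovered_def using kc
      by (intro ext) (auto simp: cube_def PiE_def extensional_def restrict_def)
  qed
  have b_eq: "b k = (if \<psi> k \<in> supp v \<and> \<kappa> (\<psi> k) = k then v (\<psi> k) else 0)" for k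
    unfolding b_def assembled_eq[OF M v'(1)] Let_def \<psi>_def ..
  have \<kappa>_cube: "\<kappa> \<omega> \<in> cube d N" for \<omega>
    unfolding \<kappa>_def using set(2,8) by (intro recovered_cube) auto
  let ?G = "restr (band M) (lattice_image d z M I c)"
  have "norm2 (cube d N) (\<lambda>k. b k - restr I c k)
      \<le> norm2 (band M) (\<lambda>\<omega>. v \<omega> - ?G \<omega>) + 2 * sqrt (real s) * threshold N"
  proof (rule assembly_error[where \<psi> = \<psi> and \<kappa> = \<kappa>])
    show "?G (\<psi> k) = c k" if "k \<in> I" for k
      using lattice_image_\<psi>[OF that] \<psi>_band by (simp add: restr_def)
    show "?G \<omega> = 0" if "\<omega> \<notin> \<psi> ` I" for \<omega>
      using lattice_image_outside[OF _ that] by (simp add: restr_def)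
  qed (use I(1) finite_cube set(3) \<kappa>_cube v'(1,2) inj_\<psi> \<psi>_band threshold_bounds(3)[OF set(2)] rec b_eq in auto)
  also have "norm2 (band M) (\<lambda>\<omega>. v \<omega> - ?G \<omega>) = norm2 (band M) (\<lambda>\<omega>. v \<omega> - lattice_image d z M I c \<omega>)"
    unfolding norm2_def by (intro arg_cong[where f = sqrt] infsum_cong) (simp add: restr_def)
  \<comment> \<open>Nothing is lost outside the cube: \<open>I\<close> lies in it and
    \<open>\<kappa>\<close> takes values in it.\<close>
  also have "norm2 (cube d N) (\<lambda>k. b k - restr I c k) = norm2 (freqs d) (\<lambda>k. b k - restr I c k)"
    unfolding norm2_def
  proof (intro arg_cong[where f = sqrt] infsum_cong_neutral)
    fix k assume "k \<in> freqs d - cube d N"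
    then show "(norm (b k - restr I c k))\<^sup>2 = 0"
      using \<kappa>_cube[of "\<psi> k"] set(3) by (auto simp: b_eq restr_def)
  qed (use cube_freqs in auto)
  finally have main: "norm2 (freqs d) (\<lambda>k. b k - restr I c k)
      \<le> (48 + 4 * real N) * (\<rho> / sqrt (real s)) + (188 + 16 * real N) * sqrt (real s) * (E + \<tau>)"
    using transform_error[OF refl noise0 v'(3,1)] total_error[of N] by linarith
  have sq: "(\<lambda>k. (norm (restr I c k - c k))\<^sup>2) summable_on freqs d"
    by (rule square_summable, rule summable_norm_bound(1)[OF summable]) (simp add: restr_def)
  have sqb: "(\<lambda>k. (norm (b k - restr I c k))\<^sup>2) summable_on freqs d"
  proof -
    have "(\<lambda>k. (norm (b k - restr I c k))\<^sup>2) summable_on cube d N"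
      using finite_cube by (rule summable_on_finite)
    then show ?thesis
    proof (rule summable_on_cong_neutral[THEN iffD1, rotated -1])
      fix k assume "k \<in> freqs d - cube d N"
      then show "(norm (b k - restr I c k))\<^sup>2 = 0"
        using \<kappa>_cube[of "\<psi> k"] set(3) by (auto simp: b_eq restr_def)
    qed (use cube_freqs in auto)
  qed
  have "norm2 (freqs d) (\<lambda>k. b k - c k)
      \<le> norm2 (freqs d) (\<lambda>k. b k - restr I c k) + norm2 (freqs d) (\<lambda>k. restr I c k - c k)"
    using norm2_triangle[OF sqb sq] by simp
  also have "norm2 (freqs d) (\<lambda>k. restr I c k - c k) = norm2 (freqs d) (\<lambda>k. c k - restr I c k)"
    by (simp add: norm2_def norm_minus_commute)
  finally have "norm2 (freqs d) (\<lambda>k. b k - c k)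
      \<le> norm2 (freqs d) (\<lambda>k. c k - restr I c k) + (48 + 4 * real N) * (\<rho> / sqrt (real s))
        + (188 + 16 * real N) * sqrt (real s) * (E + \<tau>)"
    using main by linarith
  moreover have "E + \<tau> = sup_norm f * real M powr - r + norm1 (freqs d) (\<lambda>k. c k - restr I c k) + \<eta>"
    by (simp add: E_def \<tau>_def)
  ultimately show ?thesis
    unfolding pe_error_bound_def Let_def b_def[symmetric] \<kappa>_def[symmetric] c_def[symmetric] \<rho>_def
    by simp
qed

section \<open>Failure probability and cost of the program\<close>

lemma always_map_prog: "always y (map_prog h id p) P \<longleftrightarrow> always (y \<circ> h) p P"
  by (auto simp: always_def run_map_prog)

lemma failure_map_prog: "failure y (map_prog h id p) Q = failure (y \<circ> h) p Q"
  by (simp add: failure_def run_map_prog vimage_def case_prod_unfold)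

lemma failure_conj: "failure y p (\<lambda>x. P x \<and> Q x) \<le> failure y p P + failure y p Q"
proof -
  have "failure y p (\<lambda>x. P x \<and> Q x)
      = measure_pmf.prob (run y p) ({(x, n, t). \<not> P x} \<union> {(x, n, t). \<not> Q x})"
    unfolding failure_def by (rule arg_cong[where f = "measure_pmf.prob _"]) auto
  also have "\<dots> \<le> failure y p P + failure y p Q"
    unfolding failure_def by (rule measure_Un_le) auto
  finally show ?thesis .
qed

lemma noisy_query0: "noisy f e \<circ> query0 z = (\<lambda>t. line0 z f t + e (0, t))"
  by (auto simp: noisy_def query0_def line0_def)

lemma noisy_query_shifted:
  "noisy f e \<circ> query_shifted N z l = (\<lambda>t. line_shifted N z f l t + e (Suc l, t))"
  by (auto simp: noisy_def query_shifted_def line_shifted_def)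

text \<open>The summands are the lookup in \<open>v\<close>, the \<open>d\<close> coordinates, the
  congruence test and the update of \<open>b\<close>, with \<open>L\<close> bounding each tree
  access.\<close>

definition frequency_cost :: "nat \<Rightarrow> nat \<Rightarrow> nat" where
  "frequency_cost d L = L + d * (L + 8) + (2 * d + 2) + (d * L + 2)"

lemma computes_add_frequency:
  assumes "access_cost v \<le> L" "\<And>l. l < d \<Longrightarrow> access_cost (vs ! l) \<le> L"
  shows "computes y (add_frequency d N z M arb v vs \<omega> b)
    (let k = recovered d N arb v vs \<omega> in
       if [lattice_freq d z k = \<omega>] (mod int M) then b(k := b k + v \<omega>) else b)
    (frequency_cost d L)"
proof -
  have lookup: "computes y (lookup w \<omega>) (w \<omega>) L" if "access_cost w \<le> L" for w
    unfolding lookup_def using that by (auto simp: computes_def)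
  have coord: "computes y (freq_coordinate N arb vs \<omega> (v \<omega>) l) (coordinate N arb v vs \<omega> l) (L + 8)"
    if "l \<in> set [0..<d]" for l
  proof -
    have "computes y (if (vs ! l) \<omega> = 0 then Tick 1 (Return (arb l \<omega>))
        else Tick 8 (Return (wrap N (round (real N * Arg ((vs ! l) \<omega> / v \<omega>) / (2 * pi))))))
      (coordinate N arb v vs \<omega> l) 8"
      unfolding coordinate_def by (auto simp: computes_def)
    then show ?thesis
      unfolding freq_coordinate_def using that by (intro computes_bind[OF lookup] assms(2)) auto
  qed
  let ?k = "recovered d N arb v vs \<omega>"
  have k: "restrict (\<lambda>l. map (coordinate N arb v vs \<omega>) [0..<d] ! l) {..<d} = ?k"
    by (auto simp: recovered_def)
  have "computes y (Tick (2 * d + 2)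
       (if [(\<Sum>l<d. ?k l * int (z l)) = \<omega>] (mod int M)
        then Tick (d * access_cost v + 2) (Return (b(?k := b ?k + v \<omega>))) else Return b))
     (if [lattice_freq d z ?k = \<omega>] (mod int M) then b(?k := b ?k + v \<omega>) else b)
     ((2 * d + 2) + (d * L + 2))"
    unfolding lattice_freq_def using assms(1)
    by (intro computes_Tick) (auto simp: computes_def)
  then have "computes y (add_frequency d N z M arb v vs \<omega> b)
     (if [lattice_freq d z ?k = \<omega>] (mod int M) then b(?k := b ?k + v \<omega>) else b)
     (L + (length [0..<d] * (L + 8) + ((2 * d + 2) + (d * L + 2))))"
    unfolding add_frequency_def Let_def
    by (intro computes_bind[OF lookup[OF assms(1)]] computes_bind[OF computes_mapM[OF coord]])
       (simp_all only: k)
  then show ?thesis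
    unfolding Let_def frequency_cost_def by (simp add: add.assoc)
qed

lemma access_cost_le: "sparse_on A m v \<Longrightarrow> access_cost v \<le> Suc (floor_log m)"
  unfolding access_cost_def sparse_on_def using floor_log_mono by (auto simp: mono_def)

lemma computes_assembly:
  assumes v: "sparse_on (band M) m v" and vs: "\<And>l. l < d \<Longrightarrow> sparse_on (band M) m (vs ! l)"
  shows "computes y (foldM (add_frequency d N z M arb v vs) (sorted_list_of_set (supp v)) (\<lambda>_. 0))
    (assembled d z M (recovered d N arb v vs) v) (m * frequency_cost d (Suc (floor_log m)))"
proof -
  let ?xs = "sorted_list_of_set (supp v)"
  have "computes y (foldM (add_frequency d N z M arb v vs) ?xs (\<lambda>_. 0))
    (assembled d z M (recovered d N arb v vs) v) (length ?xs * frequency_cost d (Suc (floor_log m)))"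
    unfolding assembled_def
    by (rule computes_foldM,
        rule computes_add_frequency[OF access_cost_le[OF v] access_cost_le[OF vs], unfolded Let_def])
  moreover have "length ?xs \<le> m" using v by (simp add: sparse_on_def)
  ultimately show ?thesis by (rule computes_mono[OF _ mult_right_mono]) simp
qed

text \<open>Generic in \<open>R\<close>: the full guarantee gives the error estimate, sparsity alone
  with \<open>\<epsilon> = 0\<close> gives sparsity of every output. The factor counts the unshifted
  and the \<open>d\<close> shifted transforms.\<close>

lemma phase_encoding_failure:
  assumes f: "f \<in> wiener d \<inter> continuous_torus d" and "0 \<le> \<epsilon>"
    and sft: "\<And>a \<mu>. wiener_continuous1 a \<Longrightarrow> failure (\<lambda>x. a x + \<mu> x) sft (R a \<mu>) \<le> \<epsilon>"
    and sparse: "\<And>a \<mu> v. R a \<mu> v \<Longrightarrow> sparse_on (band M) m v"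
    and Q: "\<And>v vs. R (line0 z f) (\<lambda>t. e (0, t)) v \<Longrightarrow>
        (\<And>l. l < d \<Longrightarrow> R (line_shifted N z f l) (\<lambda>t. e (Suc l, t)) (vs ! l)) \<Longrightarrow>
        Q (assembled d z M (recovered d N arb v vs) v)"
  shows "failure (noisy f e) (phase_encoding d N z M arb sft) Q \<le> (real d + 1) * \<epsilon>"
proof -
  let ?U = "R (line0 z f) (\<lambda>t. e (0, t))"
  let ?R = "\<lambda>l. R (line_shifted N z f l) (\<lambda>t. e (Suc l, t))"
  have 0: "failure (noisy f e) (map_prog (query0 z) id sft) ?U \<le> \<epsilon>"
    unfolding failure_map_prog noisy_query0 by (rule sft) (rule line_wiener_continuous(1)[OF f])
  have "failure (noisy f e) (map_prog (query_shifted N z l) id sft) (?R l) \<le> \<epsilon>"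
    if "l \<in> set [0..<d]" for l
    unfolding failure_map_prog noisy_query_shifted
    by (rule sft) (use that in \<open>auto intro: line_wiener_continuous(2)[OF f]\<close>)
  then have "failure (noisy f e) (mapM (\<lambda>l. map_prog (query_shifted N z l) id sft) [0..<d])
      (list_all2 ?R [0..<d]) \<le> real (length [0..<d]) * \<epsilon>"
    by (rule failure_mapM[OF assms(2)])
  then have 1: "failure (noisy f e) (mapM (\<lambda>l. map_prog (query_shifted N z l) id sft) [0..<d])
      (list_all2 ?R [0..<d]) \<le> d * \<epsilon>" by simp
  have "failure (noisy f e)
      (foldM (add_frequency d N z M arb v vs) (sorted_list_of_set (supp v)) (\<lambda>_. 0)) Q \<le> 0"
    if v: "?U v" and vs: "list_all2 ?R [0..<d] vs" for v vs
  proof -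
    have vs': "?R l (vs ! l)" if "l < d" for l
      using list_all2_nthD[OF vs, of l] that by simp
    have "computes (noisy f e) (foldM (add_frequency d N z M arb v vs) (sorted_list_of_set (supp v)) (\<lambda>_. 0))
        (assembled d z M (recovered d N arb v vs) v) (m * frequency_cost d (Suc (floor_log m)))"
      using sparse[OF v] sparse[OF vs'] by (rule computes_assembly)
    from failure_computes[where Q = Q, OF this Q[OF v vs']] show ?thesis by simp
  qed
  then have "failure (noisy f e) (phase_encoding d N z M arb sft) Q \<le> \<epsilon> + (d * \<epsilon> + 0)"
    unfolding phase_encoding_def using assms(2)
    by (intro failure_bind[OF 0] failure_bind[OF 1]) auto
  then show ?thesis by (simp add: algebra_simps)
qed

lemma phase_encoding_cost:
  assumes f: "f \<in> wiener d \<inter> continuous_torus d"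
    and sft: "\<And>a \<mu>. wiener_continuous1 a \<Longrightarrow> always (\<lambda>x. a x + \<mu> x) sft
        (\<lambda>v n t. sparse_on (band M) m v \<and> real n \<le> B \<and> real t \<le> B)"
  shows "always (noisy f e) (phase_encoding d N z M arb sft)
    (\<lambda>b n t. real n \<le> (real d + 1) * B \<and>
        real t \<le> (real d + 1) * B + real (m * frequency_cost d (Suc (floor_log m))))"
proof -
  have 0: "always (noisy f e) (map_prog (query0 z) id sft)
      (\<lambda>v n t. sparse_on (band M) m v \<and> real n \<le> B \<and> real t \<le> B)"
    unfolding always_map_prog noisy_query0 by (rule sft) (rule line_wiener_continuous(1)[OF f])
  have "always (noisy f e) (map_prog (query_shifted N z l) id sft)
      (\<lambda>v n t. sparse_on (band M) m v \<and> real n \<le> B \<and> real t \<le> B)"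
    if "l \<in> set [0..<d]" for l
    unfolding always_map_prog noisy_query_shifted
    by (rule sft) (use that in \<open>auto intro: line_wiener_continuous(2)[OF f]\<close>)
  then have 1: "always (noisy f e) (mapM (\<lambda>l. map_prog (query_shifted N z l) id sft) [0..<d])
      (\<lambda>vs n t. list_all2 (\<lambda>_. sparse_on (band M) m) [0..<d] vs \<and>
         real n \<le> length [0..<d] * B \<and> real t \<le> length [0..<d] * B)"
    by (rule always_mapM)
  show ?thesis
    unfolding phase_encoding_def
  proof (rule always_bind[OF 0], rule always_bind[OF 1])
    fix v n t vs n' t'
    assume v: "sparse_on (band M) m v \<and> real n \<le> B \<and> real t \<le> B"
      and vs: "list_all2 (\<lambda>_. sparse_on (band M) m) [0..<d] vs \<and>
         real n' \<le> length [0..<d] * B \<and> real t' \<le> length [0..<d] * B"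
    have "sparse_on (band M) m (vs ! l)" if "l < d" for l
      using list_all2_nthD[OF vs[THEN conjunct1], of l] that by simp
    note always_computes[OF computes_assembly[OF v[THEN conjunct1] this]]
    then show "always (noisy f e)
        (foldM (add_frequency d N z M arb v vs) (sorted_list_of_set (supp v)) (\<lambda>_. 0))
        (\<lambda>b n'' t''. real (n + (n' + n'')) \<le> (real d + 1) * B \<and>
           real (t + (t' + t'')) \<le> (real d + 1) * B + real (m * frequency_cost d (Suc (floor_log m))))"
    proof (rule always_mono)
      fix b :: "(nat \<Rightarrow> int) \<Rightarrow> complex" and n'' t'' :: nat
      assume *: "b = assembled d z M (recovered d N arb v vs) v \<and> n'' = 0 \<and>
        t'' \<le> m * frequency_cost d (Suc (floor_log m))"
      then have "real t'' \<le> real (m * frequency_cost d (Suc (floor_log m)))"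
        by (simp only: of_nat_le_iff)
      then show "real (n + (n' + n'')) \<le> (real d + 1) * B \<and>
           real (t + (t' + t'')) \<le> (real d + 1) * B + real (m * frequency_cost d (Suc (floor_log m)))"
        using v vs * by (simp add: algebra_simps del: of_nat_mult)
    qed
  qed
qed

section \<open>Absorbing the assembly into the asymptotic bounds\<close>

text \<open>The parameter range for \<open>r\<close> forces \<open>M \<ge> 36\<close>. The tree
  depth is at most the binary logarithm of \<open>M\<close>, hence at most 3/2 times
  \<open>ln M\<close>, and the additional 1 is at most \<open>ln M\<close>.\<close>

lemma ln_M_ge:
  assumes "sft_params s M r"
  shows "1 \<le> ln (real M)" "real (Suc (floor_log (2 * s))) \<le> 3 * ln (real M)"
proof -
  have M: "36 \<le> real M" and s: "1 \<le> s" "2 * s \<le> M" using assms by (auto simp: sft_params_def)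
  show 1: "1 \<le> ln (real M)"
    using M exp_le by (subst ln_ge_iff) auto
  have "2 ^ floor_log (2 * s) \<le> M"
    using floor_log_exp2_le[of "2 * s"] s by linarith
  then have "(2::real) ^ floor_log (2 * s) \<le> real M"
    by (metis of_nat_le_iff of_nat_numeral of_nat_power)
  then have "ln ((2::real) ^ floor_log (2 * s)) \<le> ln (real M)"
    by (subst ln_le_cancel_iff) (use M in auto)
  then have "real (floor_log (2 * s)) * ln 2 \<le> ln (real M)" by (simp add: ln_realpow)
  moreover have "real (floor_log (2 * s)) * (2 / 3) \<le> real (floor_log (2 * s)) * ln 2"
    using ln2_ge_two_thirds by (intro mult_left_mono) auto
  ultimately show "real (Suc (floor_log (2 * s))) \<le> 3 * ln (real M)" using 1 by simp
qed

text \<open>\<open>L\<close>, \<open>d\<close> and 1 are all at most \<open>d * L\<close>, and the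
  coefficients in \<open>frequency_cost\<close> add up to 17; then 102 = 2 * 17 * 3.\<close>

lemma assembly_cost:
  assumes "sft_params s M r" "1 \<le> d"
  shows "real (2 * s * frequency_cost d (Suc (floor_log (2 * s)))) \<le> 102 * (real d * real s * ln (real M))"
proof -
  define L where "L = Suc (floor_log (2 * s))"
  have "1 \<le> L" by (simp add: L_def)
  then have "d \<le> d * L" "L \<le> d * L" "1 \<le> d * L" using assms(2) by auto
  then have "frequency_cost d L \<le> 17 * (d * L)"
    unfolding frequency_cost_def distrib_left by linarith
  then have "real (frequency_cost d L) \<le> 17 * (real d * real L)"
    by (metis of_nat_le_iff of_nat_mult of_nat_numeral)
  also have "\<dots> \<le> 17 * (real d * (3 * ln (real M)))"
    using ln_M_ge(2)[OF assms(1)] by (intro mult_left_mono) (auto simp: L_def)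
  finally have "2 * real s * real (frequency_cost d L) \<le> 2 * real s * (17 * (real d * (3 * ln (real M))))"
    by (intro mult_left_mono) auto
  then show ?thesis by (simp add: L_def mult_ac)
qed

text \<open>The constants in the cost assumptions carry no sign, but monotonicity arguments need
  nonnegative ones.\<close>

lemma bound_mono_abs: "0 \<le> X \<Longrightarrow> (C::real) * X \<le> \<bar>C\<bar> * X"
  by (intro mult_right_mono) auto

text \<open>The division by \<open>ln s\<close> is harmless since \<open>ln s \<le> s\<close>; the
  remaining surplus factors are at least 1.\<close>

lemma disc_bound_ge:
  assumes "sft_params s M r" "2 \<le> s"
  shows "real s * ln (real M) \<le> (real s)\<^sup>2 * r powr (3/2) * ln (real M) powr (11/2) / ln (real s)"
proof -
  have r: "1 \<le> r" and lnM: "1 \<le> ln (real M)"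
    using assms(1) ln_M_ge(1)[OF assms(1)] by (auto simp: sft_params_def)
  have lns: "0 < ln (real s)" "ln (real s) \<le> real s"
    using assms(2) ln_le_minus_one[of "real s"] by auto
  have "ln (real M) = ln (real M) powr 1" using lnM by simp
  also have "\<dots> \<le> ln (real M) powr (11/2)" using lnM by (intro powr_mono) auto
  finally have 1: "1 * ln (real M) \<le> r powr (3/2) * ln (real M) powr (11/2)"
    using r lnM by (intro mult_mono ge_one_powr_ge_zero) auto
  have 2: "real s * ln (real s) \<le> (real s)\<^sup>2"
    using lns by (simp add: power2_eq_square mult_left_mono)
  have "(real s * ln (real s)) * (1 * ln (real M))
      \<le> (real s)\<^sup>2 * (r powr (3/2) * ln (real M) powr (11/2))"
    by (rule mult_mono[OF 2 1]) (use lnM in auto)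
  then show ?thesis using lns(1) by (simp add: pos_le_divide_eq mult_ac)
qed

lemma mc_bound_ge:
  assumes "sft_params s M r" "1 \<le> y"
  shows "real s * ln (real M) \<le> real s * r powr (3/2) * ln (real M) powr (9/2) * y"
proof -
  have r: "1 \<le> r" and lnM: "1 \<le> ln (real M)"
    using assms(1) ln_M_ge(1)[OF assms(1)] by (auto simp: sft_params_def)
  have "ln (real M) = ln (real M) powr 1" using lnM by simp
  also have "\<dots> \<le> ln (real M) powr (9/2)" using lnM by (intro powr_mono) auto
  finally have "1 * ln (real M) * 1 \<le> r powr (3/2) * ln (real M) powr (9/2) * y"
    using r lnM assms(2) by (intro mult_mono ge_one_powr_ge_zero) auto
  then have "real s * (1 * ln (real M) * 1) \<le> real s * (r powr (3/2) * ln (real M) powr (9/2) * y)"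
    by (intro mult_left_mono) auto
  then show ?thesis by (simp add: mult_ac)
qed

text \<open>\<open>2 * K\<close> comes from \<open>d + 1 \<le> 2 * d\<close> transforms and 102 from
  the assembly, whose cost is absorbed by \<open>X\<close>.\<close>

lemma phase_encoding_cost_le:
  assumes setting: "pe_setting d N z M I f e \<eta> arb" and params: "sft_params s M r"
    and sft: "\<And>a \<mu>. wiener_continuous1 a \<Longrightarrow> always (\<lambda>x. a x + \<mu> x) sft
        (\<lambda>v n t. sparse_on (band M) (2 * s) v \<and> real n \<le> K * X \<and> real t \<le> K * X)"
    and X: "real s * ln (real M) \<le> X" and "0 \<le> K"
  shows "always (noisy f e) (phase_encoding d N z M arb sft)
    (\<lambda>b n t. real n \<le> (2 * K + 102) * (real d * X) \<and> real t \<le> (2 * K + 102) * (real d * X))"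
proof -
  have f: "f \<in> wiener d \<inter> continuous_torus d" and d: "1 \<le> d"
    using setting unfolding pe_setting_def by blast+
  have "0 \<le> real s * ln (real M)" using ln_M_ge(1)[OF params] by simp
  then have X0: "0 \<le> X" using X by linarith
  have KX: "0 \<le> K * X" using X0 assms(5) by simp
  have "(real d + 1) * (K * X) \<le> (2 * real d) * (K * X)"
    using d KX by (intro mult_right_mono) auto
  moreover have "102 * (real d * real s * ln (real M)) \<le> 102 * (real d * X)"
    using X by (simp add: mult.assoc mult_left_mono)
  moreover have "0 \<le> 102 * (real d * X)" using X0 by simp
  moreover have "(2 * K + 102) * (real d * X) = 2 * real d * (K * X) + 102 * (real d * X)"
    by (simp add: algebra_simps)
  moreover note assembly_cost[OF params d]
  ultimately have le: "(real d + 1) * (K * X) \<le> (2 * K + 102) * (real d * X)"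
    "(real d + 1) * (K * X) + real (2 * s * frequency_cost d (Suc (floor_log (2 * s))))
       \<le> (2 * K + 102) * (real d * X)"
    by linarith+
  show ?thesis
    by (rule always_mono[OF phase_encoding_cost[OF f sft]]) (use le in linarith)+
qed

section \<open>The deterministic and the Monte Carlo variant\<close>

lemma phase_encoding_success:
  assumes setting: "pe_setting d N z M I f e \<eta> arb" and params: "sft_params s M r" and "0 \<le> \<epsilon>"
    and sft: "\<And>a \<mu>. wiener_continuous1 a \<Longrightarrow>
        failure (\<lambda>x. a x + \<mu> x) sft (good_transform s M r a \<mu>) \<le> \<epsilon>"
  shows "failure (noisy f e) (phase_encoding d N z M arb sft)
    (\<lambda>b. sparse_on (cube d N) (2 * s) b \<and> pe_error_bound d N M I f \<eta> s r b) \<le> (real d + 1) * \<epsilon>"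
proof (rule phase_encoding_failure[where R = "good_transform s M r" and m = "2 * s", OF _ assms(3) sft])
  show "f \<in> wiener d \<inter> continuous_torus d" using setting unfolding pe_setting_def by blast
  show "sparse_on (band M) (2 * s) v" if "good_transform s M r a \<mu> v" for a \<mu> v
    using that by (simp add: good_transform_def)
  fix v vs assume v: "good_transform s M r (line0 z f) (\<lambda>t. e (0, t)) v"
    and vs: "\<And>l. l < d \<Longrightarrow> good_transform s M r (line_shifted N z f l) (\<lambda>t. e (Suc l, t)) (vs ! l)"
  have "0 < M" using params by (auto simp: sft_params_def)
  moreover have "0 < N" "\<And>l \<omega>. arb l \<omega> \<in> band N" using setting unfolding pe_setting_def by auto
  ultimately have "sparse_on (cube d N) (2 * s) (assembled d z M (recovered d N arb v vs) v)"
    using v by (intro sparse_assembled recovered_cube) (auto simp: good_transform_def)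
  then show "sparse_on (cube d N) (2 * s) (assembled d z M (recovered d N arb v vs) v) \<and>
      pe_error_bound d N M I f \<eta> s r (assembled d z M (recovered d N arb v vs) v)"
    using phase_encoding_error[OF setting params v vs] by blast
qed

text \<open>Sparsity is claimed on every run, including those that miss the error bound, and so
  cannot be read off the success event.\<close>

lemma phase_encoding_sparse:
  assumes setting: "pe_setting d N z M I f e \<eta> arb" and params: "sft_params s M r"
    and sft: "\<And>a \<mu>. wiener_continuous1 a \<Longrightarrow>
        failure (\<lambda>x. a x + \<mu> x) sft (sparse_on (band M) (2 * s)) \<le> 0"
  shows "failure (noisy f e) (phase_encoding d N z M arb sft) (sparse_on (cube d N) (2 * s)) \<le> 0"
proof -
  have "failure (noisy f e) (phase_encoding d N z M arb sft) (sparse_on (cube d N) (2 * s))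
      \<le> (real d + 1) * 0"
  proof (rule phase_encoding_failure[where R = "\<lambda>_ _. sparse_on (band M) (2 * s)" and m = "2 * s"])
    show "f \<in> wiener d \<inter> continuous_torus d" using setting unfolding pe_setting_def by blast
    fix v and vs :: "(int \<Rightarrow> complex) list" assume v: "sparse_on (band M) (2 * s) v"
    have "0 < M" using params by (auto simp: sft_params_def)
    moreover have "0 < N" "\<And>l \<omega>. arb l \<omega> \<in> band N" using setting unfolding pe_setting_def by auto
    ultimately show "sparse_on (cube d N) (2 * s) (assembled d z M (recovered d N arb v vs) v)"
      using v by (intro sparse_assembled recovered_cube) auto
  qed (use sft in auto)
  then show ?thesis by simp
qed

lemma phase_encoding_deterministic:
  assumes A: "disc_sft A"
  shows "(\<forall>d N z M I f e \<eta> arb s r.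
          pe_setting d N z M I f e \<eta> arb \<and> sft_params s M r \<longrightarrow>
          (\<forall>(b, n, t) \<in> set_pmf (run (noisy f e) (phase_encoding d N z M arb (A s M r))).
             sparse_on (cube d N) (2 * s) b \<and> pe_error_bound d N M I f \<eta> s r b)) \<and>
       (\<exists>C. \<forall>d N z M I f e \<eta> arb s r.
          pe_setting d N z M I f e \<eta> arb \<and> sft_params s M r \<and> 2 \<le> s \<longrightarrow>
          (\<forall>(b, n, t) \<in> set_pmf (run (noisy f e) (phase_encoding d N z M arb (A s M r))).
             (let bound = C * (real d * (real s)\<^sup>2 * r powr (3/2) * ln (real M) powr (11/2) / ln (real s))
              in real n \<le> bound \<and> real t \<le> bound)))"
proof (intro conjI allI impI)
  fix d N z M I f e \<eta> arb s r
  assume *: "pe_setting d N z M I f e \<eta> arb \<and> sft_params s M r"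
  have "failure (\<lambda>x. a x + \<mu> x) (A s M r) (good_transform s M r a \<mu>) \<le> 0"
    if "wiener_continuous1 a" for a \<mu>
    unfolding failure_le_zero_iff always_def good_transform_def
    using A that * unfolding disc_sft_def by fastforce
  then have "failure (noisy f e) (phase_encoding d N z M arb (A s M r))
    (\<lambda>b. sparse_on (cube d N) (2 * s) b \<and> pe_error_bound d N M I f \<eta> s r b) \<le> (real d + 1) * 0"
    using * by (intro phase_encoding_success) auto
  then have "always (noisy f e) (phase_encoding d N z M arb (A s M r))
    (\<lambda>b n t. sparse_on (cube d N) (2 * s) b \<and> pe_error_bound d N M I f \<eta> s r b)"
    by (simp add: failure_le_zero_iff)
  then show "\<forall>(b, n, t) \<in> set_pmf (run (noisy f e) (phase_encoding d N z M arb (A s M r))).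
             sparse_on (cube d N) (2 * s) b \<and> pe_error_bound d N M I f \<eta> s r b"
    unfolding always_def .
next
  define X where "X s M r = (real s)\<^sup>2 * r powr (3/2) * ln (real M) powr (11/2) / ln (real s)"
    for s M :: nat and r :: real
  have "\<exists>C. \<forall>s M r a \<mu>. sft_params s M r \<and> 2 \<le> s \<and> wiener_continuous1 a \<longrightarrow>
      always (\<lambda>x. a x + \<mu> x) (A s M r) (\<lambda>v n t. real n \<le> C * X s M r \<and> real t \<le> C * X s M r)"
    using A unfolding disc_sft_def always_def X_def Let_def by (rule conjunct2)
  then obtain C where C: "\<And>s M r a \<mu>. sft_params s M r \<Longrightarrow> 2 \<le> s \<Longrightarrow> wiener_continuous1 a \<Longrightarrow>
      always (\<lambda>x. a x + \<mu> x) (A s M r) (\<lambda>v n t. real n \<le> C * X s M r \<and> real t \<le> C * X s M r)"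
    by blast
  have "\<forall>d N z M I f e \<eta> arb s r.
          pe_setting d N z M I f e \<eta> arb \<and> sft_params s M r \<and> 2 \<le> s \<longrightarrow>
          always (noisy f e) (phase_encoding d N z M arb (A s M r))
            (\<lambda>b n t. real n \<le> (2 * \<bar>C\<bar> + 102) * (real d * X s M r) \<and>
                     real t \<le> (2 * \<bar>C\<bar> + 102) * (real d * X s M r))"
  proof (intro allI impI)
    fix d N z M I f e \<eta> arb s r
    assume *: "pe_setting d N z M I f e \<eta> arb \<and> sft_params s M r \<and> 2 \<le> s"
    have X: "real s * ln (real M) \<le> X s M r" using * by (auto simp: X_def intro: disc_bound_ge)
    moreover have "0 \<le> real s * ln (real M)" using * ln_M_ge(1)[of s M r] by simp
    ultimately have CX: "C * X s M r \<le> \<bar>C\<bar> * X s M r" by (intro bound_mono_abs) linarith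
    have "always (\<lambda>x. a x + \<mu> x) (A s M r)
        (\<lambda>v n t. sparse_on (band M) (2 * s) v \<and> real n \<le> \<bar>C\<bar> * X s M r \<and> real t \<le> \<bar>C\<bar> * X s M r)"
      if "wiener_continuous1 a" for a \<mu>
    proof -
      have "always (\<lambda>x. a x + \<mu> x) (A s M r) (\<lambda>v n t. sparse_on (band M) (2 * s) v)"
        using A that * unfolding disc_sft_def always_def by fastforce
      with C[of s M r a \<mu>] that * CX show ?thesis unfolding always_def by fastforce
    qed
    with * X show "always (noisy f e) (phase_encoding d N z M arb (A s M r))
            (\<lambda>b n t. real n \<le> (2 * \<bar>C\<bar> + 102) * (real d * X s M r) \<and>
                     real t \<le> (2 * \<bar>C\<bar> + 102) * (real d * X s M r))"
      by (intro phase_encoding_cost_le) auto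
  qed
  then show "\<exists>C. \<forall>d N z M I f e \<eta> arb s r.
          pe_setting d N z M I f e \<eta> arb \<and> sft_params s M r \<and> 2 \<le> s \<longrightarrow>
          (\<forall>(b, n, t) \<in> set_pmf (run (noisy f e) (phase_encoding d N z M arb (A s M r))).
             (let bound = C * (real d * (real s)\<^sup>2 * r powr (3/2) * ln (real M) powr (11/2) / ln (real s))
              in real n \<le> bound \<and> real t \<le> bound))"
    by (intro exI[where x = "2 * \<bar>C\<bar> + 102"])
       (simp only: always_def X_def Let_def times_divide_eq_right mult.assoc)
qed

text \<open>The factor 3 meets two demands at once: \<open>d + 1 \<le> 3 * d\<close> for the union
  bound, and a share of at most 1/3 even if \<open>\<sigma> = 1\<close>.\<close>

definition failure_share :: "nat \<Rightarrow> real \<Rightarrow> real" where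
  "failure_share d \<sigma> = \<sigma> / (3 * real d)"

lemma failure_share:
  assumes "1 \<le> d" "0 < \<sigma>" "\<sigma> \<le> 1"
  shows "0 < failure_share d \<sigma>" "failure_share d \<sigma> \<le> 1/3" "(real d + 1) * failure_share d \<sigma> \<le> \<sigma>"
proof -
  show "0 < failure_share d \<sigma>" using assms by (simp add: failure_share_def)
  show "failure_share d \<sigma> \<le> 1/3" using assms by (simp add: failure_share_def field_simps)
  have "(real d + 1) * \<sigma> \<le> (3 * real d) * \<sigma>" using assms by (intro mult_right_mono) auto
  then show "(real d + 1) * failure_share d \<sigma> \<le> \<sigma>"
    using assms by (simp add: failure_share_def field_simps)
qed

lemma ln_failure_share:
  assumes "sft_params s M r" "1 \<le> d" "0 < \<sigma>" "\<sigma> \<le> 1"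
  shows "1 \<le> ln (real d * real M / \<sigma>)"
    and "ln (real M / failure_share d \<sigma>) \<le> 2 * ln (real d * real M / \<sigma>)"
    and "0 \<le> ln (real M / failure_share d \<sigma>)"
proof -
  define y where "y = real d * real M / \<sigma>"
  have M: "36 \<le> real M" using assms(1) by (auto simp: sft_params_def)
  have "real M * \<sigma> \<le> real M * real d" using assms(2-4) by (intro mult_left_mono) auto
  moreover have "36 * \<sigma> \<le> real M * \<sigma>" using M assms(3) by (intro mult_right_mono) auto
  ultimately have "36 * \<sigma> \<le> real d * real M" by (simp add: mult.commute)
  then have y: "36 \<le> y" using assms(3) by (simp add: y_def pos_le_divide_eq)
  show "1 \<le> ln (real d * real M / \<sigma>)"
    unfolding y_def[symmetric] using y exp_le by (subst ln_ge_iff) auto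
  have eq: "real M / failure_share d \<sigma> = 3 * y"
    using assms by (simp add: failure_share_def y_def)
  \<comment> \<open>As \<open>y \<ge> 3\<close>, the factor 3 from the share only doubles the
    logarithm.\<close>
  have "ln (3 * y) \<le> ln (y * y)" using y by (subst ln_le_cancel_iff) auto
  also have "\<dots> = 2 * ln y" using y by (simp add: ln_mult)
  finally show "ln (real M / failure_share d \<sigma>) \<le> 2 * ln (real d * real M / \<sigma>)"
    unfolding eq y_def .
  show "0 \<le> ln (real M / failure_share d \<sigma>)" unfolding eq using y by simp
qed

lemma phase_encoding_monte_carlo:
  assumes A: "mc_sft A"
  shows "(\<forall>d N z M I f e \<eta> arb s r \<sigma>.
             pe_setting d N z M I f e \<eta> arb \<and> sft_params s M r \<and> 0 < \<sigma> \<and> \<sigma> \<le> 1 \<longrightarrow>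
             (\<forall>(b, n, t) \<in> set_pmf (run (noisy f e) (phase_encoding d N z M arb (A s M r (failure_share d \<sigma>)))).
                sparse_on (cube d N) (2 * s) b) \<and>
             measure_pmf.prob (run (noisy f e) (phase_encoding d N z M arb (A s M r (failure_share d \<sigma>))))
               {(b, n, t). pe_error_bound d N M I f \<eta> s r b} \<ge> 1 - \<sigma>)" (is ?error)
    and "\<exists>C. \<forall>d N z M I f e \<eta> arb s r \<sigma>.
             pe_setting d N z M I f e \<eta> arb \<and> sft_params s M r \<and> 0 < \<sigma> \<and> \<sigma> \<le> 1 \<longrightarrow>
             (\<forall>(b, n, t) \<in> set_pmf (run (noisy f e) (phase_encoding d N z M arb (A s M r (failure_share d \<sigma>)))).
                (let bound = C * (real d * real s * r powr (3/2) * ln (real M) powr (9/2) * ln (real d * real M / \<sigma>))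
                 in real n \<le> bound \<and> real t \<le> bound))" (is ?cost)
proof -
  have sparse: "always (\<lambda>x. a x + \<mu> x) (A s M r p) (\<lambda>v n t. sparse_on (band M) (2 * s) v)"
    and prob: "failure (\<lambda>x. a x + \<mu> x) (A s M r p) (sft_guarantee s M r a \<mu>) \<le> p"
    if "sft_params s M r" "0 < p" "p \<le> 1/3" "wiener_continuous1 a" for s M r p a \<mu>
  proof -
    have "(\<forall>(v, n, t) \<in> set_pmf (run (\<lambda>x. a x + \<mu> x) (A s M r p)). sparse_on (band M) (2 * s) v) \<and>
           measure_pmf.prob (run (\<lambda>x. a x + \<mu> x) (A s M r p))
             {(v, n, t). sft_guarantee s M r a \<mu> v} \<ge> 1 - p"
      using A that unfolding mc_sft_def by blast
    then show "always (\<lambda>x. a x + \<mu> x) (A s M r p) (\<lambda>v n t. sparse_on (band M) (2 * s) v)"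
      "failure (\<lambda>x. a x + \<mu> x) (A s M r p) (sft_guarantee s M r a \<mu>) \<le> p"
      unfolding always_def prob_success by auto
  qed
  show ?error
  proof (intro allI impI, elim conjE)
    fix d N z M I f e \<eta> arb s r \<sigma>
    assume setting: "pe_setting d N z M I f e \<eta> arb" and params: "sft_params s M r"
      and \<sigma>: "0 < \<sigma>" "\<sigma> \<le> (1::real)"
    have d: "1 \<le> d" using setting unfolding pe_setting_def by blast
    note p = failure_share[OF d \<sigma>]
    let ?A = "A s M r (failure_share d \<sigma>)"
    have sp0: "failure (\<lambda>x. a x + \<mu> x) ?A (sparse_on (band M) (2 * s)) \<le> 0"
      if "wiener_continuous1 a" for a \<mu>
      using sparse[OF params p(1,2) that] by (simp add: failure_le_zero_iff)
    \<comment> \<open>Sparsity is sure, so demanding it in addition leaves the failure probability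
      unchanged.\<close>
    have "failure (\<lambda>x. a x + \<mu> x) ?A (good_transform s M r a \<mu>) \<le> failure_share d \<sigma>"
      if "wiener_continuous1 a" for a \<mu>
      using failure_conj[of "\<lambda>x. a x + \<mu> x" ?A "sparse_on (band M) (2 * s)" "sft_guarantee s M r a \<mu>"]
        sp0[OF that, of \<mu>] prob[OF params p(1,2) that, of \<mu>]
      unfolding good_transform_def[abs_def] by linarith
    then have "failure (noisy f e) (phase_encoding d N z M arb ?A)
        (\<lambda>b. sparse_on (cube d N) (2 * s) b \<and> pe_error_bound d N M I f \<eta> s r b)
        \<le> (real d + 1) * failure_share d \<sigma>"
      using p by (intro phase_encoding_success[OF setting params]) auto
    then have "failure (noisy f e) (phase_encoding d N z M arb ?A) (pe_error_bound d N M I f \<eta> s r) \<le> \<sigma>"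
      using p(3) failure_mono[of "\<lambda>b. sparse_on (cube d N) (2 * s) b \<and> pe_error_bound d N M I f \<eta> s r b"
          "pe_error_bound d N M I f \<eta> s r" "noisy f e" "phase_encoding d N z M arb ?A"] by auto
    moreover have "always (noisy f e) (phase_encoding d N z M arb ?A) (\<lambda>b n t. sparse_on (cube d N) (2 * s) b)"
      unfolding failure_le_zero_iff[symmetric] by (rule phase_encoding_sparse[OF setting params sp0])
    ultimately show "(\<forall>(b, n, t) \<in> set_pmf (run (noisy f e) (phase_encoding d N z M arb ?A)).
                sparse_on (cube d N) (2 * s) b) \<and>
             measure_pmf.prob (run (noisy f e) (phase_encoding d N z M arb ?A))
               {(b, n, t). pe_error_bound d N M I f \<eta> s r b} \<ge> 1 - \<sigma>"
      unfolding always_def prob_success by auto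
  qed
  define Y where "Y s M r y = real s * r powr (3/2) * ln (real M) powr (9/2) * y"
    for s M :: nat and r y :: real
  have "\<exists>C. \<forall>s M r p a \<mu>. sft_params s M r \<and> 0 < p \<and> p \<le> 1/3 \<and> wiener_continuous1 a \<longrightarrow>
      always (\<lambda>x. a x + \<mu> x) (A s M r p)
        (\<lambda>v n t. real n \<le> C * Y s M r (ln (real M / p)) \<and> real t \<le> C * Y s M r (ln (real M / p)))"
    using A unfolding mc_sft_def always_def Y_def Let_def by (rule conjunct2)
  then obtain C where C: "\<And>s M r p a \<mu>. sft_params s M r \<Longrightarrow> 0 < p \<Longrightarrow> p \<le> 1/3 \<Longrightarrow> wiener_continuous1 a \<Longrightarrow>
      always (\<lambda>x. a x + \<mu> x) (A s M r p)
        (\<lambda>v n t. real n \<le> C * Y s M r (ln (real M / p)) \<and> real t \<le> C * Y s M r (ln (real M / p)))"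
    by blast
  have "\<forall>d N z M I f e \<eta> arb s r \<sigma>.
          pe_setting d N z M I f e \<eta> arb \<and> sft_params s M r \<and> 0 < \<sigma> \<and> \<sigma> \<le> 1 \<longrightarrow>
          always (noisy f e) (phase_encoding d N z M arb (A s M r (failure_share d \<sigma>)))
            (\<lambda>b n t. real n \<le> (2 * (2 * \<bar>C\<bar>) + 102) * (real d * Y s M r (ln (real d * real M / \<sigma>))) \<and>
                     real t \<le> (2 * (2 * \<bar>C\<bar>) + 102) * (real d * Y s M r (ln (real d * real M / \<sigma>))))"
  proof (intro allI impI, elim conjE)
    fix d N z M I f e \<eta> arb s r \<sigma>
    assume setting: "pe_setting d N z M I f e \<eta> arb" and params: "sft_params s M r"
      and \<sigma>: "0 < \<sigma>" "\<sigma> \<le> (1::real)"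
    have d: "1 \<le> d" using setting unfolding pe_setting_def by blast
    note p = failure_share[OF d \<sigma>] and ln = ln_failure_share[OF params d \<sigma>]
    let ?A = "A s M r (failure_share d \<sigma>)" and ?y = "ln (real d * real M / \<sigma>)"
    let ?y' = "ln (real M / failure_share d \<sigma>)"
    have X: "real s * ln (real M) \<le> Y s M r ?y"
      using mc_bound_ge[OF params ln(1)] by (simp add: Y_def)
    have "C * Y s M r ?y' \<le> \<bar>C\<bar> * Y s M r ?y'"
      using ln(3) by (intro bound_mono_abs) (auto simp: Y_def)
    also have "\<dots> \<le> \<bar>C\<bar> * (2 * Y s M r ?y)"
    proof (rule mult_left_mono)
      have "Y s M r ?y' \<le> Y s M r (2 * ?y)"
        unfolding Y_def using ln(2) by (intro mult_left_mono) auto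
      then show "Y s M r ?y' \<le> 2 * Y s M r ?y" by (simp add: Y_def mult_ac)
    qed simp
    finally have CX: "C * Y s M r ?y' \<le> 2 * \<bar>C\<bar> * Y s M r ?y" by simp
    have "always (\<lambda>x. a x + \<mu> x) ?A (\<lambda>v n t. sparse_on (band M) (2 * s) v \<and>
          real n \<le> 2 * \<bar>C\<bar> * Y s M r ?y \<and> real t \<le> 2 * \<bar>C\<bar> * Y s M r ?y)"
      if "wiener_continuous1 a" for a \<mu>
      using sparse[OF params p(1,2) that, of \<mu>] C[OF params p(1,2) that, of \<mu>] CX
      unfolding always_def by fastforce
    with X show "always (noisy f e) (phase_encoding d N z M arb ?A)
            (\<lambda>b n t. real n \<le> (2 * (2 * \<bar>C\<bar>) + 102) * (real d * Y s M r ?y) \<and>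
                     real t \<le> (2 * (2 * \<bar>C\<bar>) + 102) * (real d * Y s M r ?y))"
      by (intro phase_encoding_cost_le[OF setting params]) auto
  qed
  then show ?cost
    by (intro exI[where x = "2 * (2 * \<bar>C\<bar>) + 102"])
       (simp only: always_def Y_def Let_def mult.assoc)
qed

theorem corollary1:
  fixes A :: "nat \<Rightarrow> nat \<Rightarrow> real \<Rightarrow> (real, int \<Rightarrow> complex) prog"
    and A_MC :: "nat \<Rightarrow> nat \<Rightarrow> real \<Rightarrow> real \<Rightarrow> (real, int \<Rightarrow> complex) prog"
  shows
    "(disc_sft A \<longrightarrow>
       (\<forall>d N z M I f e \<eta> arb s r.
          pe_setting d N z M I f e \<eta> arb \<and> sft_params s M r \<longrightarrow>
          (\<forall>(b, n, t) \<in> set_pmf (run (noisy f e) (phase_encoding d N z M arb (A s M r))).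
             sparse_on (cube d N) (2 * s) b \<and> pe_error_bound d N M I f \<eta> s r b)) \<and>
       (\<exists>C. \<forall>d N z M I f e \<eta> arb s r.
          pe_setting d N z M I f e \<eta> arb \<and> sft_params s M r \<and> 2 \<le> s \<longrightarrow>
          (\<forall>(b, n, t) \<in> set_pmf (run (noisy f e) (phase_encoding d N z M arb (A s M r))).
             (let bound = C * (real d * (real s)\<^sup>2 * r powr (3/2) * ln (real M) powr (11/2) / ln (real s))
              in real n \<le> bound \<and> real t \<le> bound))))
     \<and>
     (mc_sft A_MC \<longrightarrow>
       (\<exists>p :: nat \<Rightarrow> real \<Rightarrow> real.
          (\<forall>d \<sigma>. 1 \<le> d \<and> 0 < \<sigma> \<and> \<sigma> \<le> 1 \<longrightarrow> 0 < p d \<sigma> \<and> p d \<sigma> \<le> 1/3) \<and>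
          (\<forall>d N z M I f e \<eta> arb s r \<sigma>.
             pe_setting d N z M I f e \<eta> arb \<and> sft_params s M r \<and> 0 < \<sigma> \<and> \<sigma> \<le> 1 \<longrightarrow>
             (\<forall>(b, n, t) \<in> set_pmf (run (noisy f e) (phase_encoding d N z M arb (A_MC s M r (p d \<sigma>)))).
                sparse_on (cube d N) (2 * s) b) \<and>
             measure_pmf.prob (run (noisy f e) (phase_encoding d N z M arb (A_MC s M r (p d \<sigma>))))
               {(b, n, t). pe_error_bound d N M I f \<eta> s r b} \<ge> 1 - \<sigma>) \<and>
          (\<exists>C. \<forall>d N z M I f e \<eta> arb s r \<sigma>.
             pe_setting d N z M I f e \<eta> arb \<and> sft_params s M r \<and> 0 < \<sigma> \<and> \<sigma> \<le> 1 \<longrightarrow>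
             (\<forall>(b, n, t) \<in> set_pmf (run (noisy f e) (phase_encoding d N z M arb (A_MC s M r (p d \<sigma>)))).
                (let bound = C * (real d * real s * r powr (3/2) * ln (real M) powr (9/2) * ln (real d * real M / \<sigma>))
                 in real n \<le> bound \<and> real t \<le> bound)))))"
proof (rule conjI; rule impI)
  assume "disc_sft A"
  from phase_encoding_deterministic[OF this] show
    "(\<forall>d N z M I f e \<eta> arb s r.
          pe_setting d N z M I f e \<eta> arb \<and> sft_params s M r \<longrightarrow>
          (\<forall>(b, n, t) \<in> set_pmf (run (noisy f e) (phase_encoding d N z M arb (A s M r))).
             sparse_on (cube d N) (2 * s) b \<and> pe_error_bound d N M I f \<eta> s r b)) \<and>
       (\<exists>C. \<forall>d N z M I f e \<eta> arb s r.
          pe_setting d N z M I f e \<eta> arb \<and> sft_params s M r \<and> 2 \<le> s \<longrightarrow>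
          (\<forall>(b, n, t) \<in> set_pmf (run (noisy f e) (phase_encoding d N z M arb (A s M r))).
             (let bound = C * (real d * (real s)\<^sup>2 * r powr (3/2) * ln (real M) powr (11/2) / ln (real s))
              in real n \<le> bound \<and> real t \<le> bound)))" .
next
  assume mc: "mc_sft A_MC"
  have "\<forall>d \<sigma>. 1 \<le> d \<and> 0 < \<sigma> \<and> \<sigma> \<le> 1 \<longrightarrow> 0 < failure_share d \<sigma> \<and> failure_share d \<sigma> \<le> 1/3"
    by (intro allI impI conjI failure_share) auto
  from conjI[OF this conjI[OF phase_encoding_monte_carlo[OF mc]]] show
    "\<exists>p :: nat \<Rightarrow> real \<Rightarrow> real.
          (\<forall>d \<sigma>. 1 \<le> d \<and> 0 < \<sigma> \<and> \<sigma> \<le> 1 \<longrightarrow> 0 < p d \<sigma> \<and> p d \<sigma> \<le> 1/3) \<and>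
          (\<forall>d N z M I f e \<eta> arb s r \<sigma>.
             pe_setting d N z M I f e \<eta> arb \<and> sft_params s M r \<and> 0 < \<sigma> \<and> \<sigma> \<le> 1 \<longrightarrow>
             (\<forall>(b, n, t) \<in> set_pmf (run (noisy f e) (phase_encoding d N z M arb (A_MC s M r (p d \<sigma>)))).
                sparse_on (cube d N) (2 * s) b) \<and>
             measure_pmf.prob (run (noisy f e) (phase_encoding d N z M arb (A_MC s M r (p d \<sigma>))))
               {(b, n, t). pe_error_bound d N M I f \<eta> s r b} \<ge> 1 - \<sigma>) \<and>
          (\<exists>C. \<forall>d N z M I f e \<eta> arb s r \<sigma>.
             pe_setting d N z M I f e \<eta> arb \<and> sft_params s M r \<and> 0 < \<sigma> \<and> \<sigma> \<le> 1 \<longrightarrow>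
             (\<forall>(b, n, t) \<in> set_pmf (run (noisy f e) (phase_encoding d N z M arb (A_MC s M r (p d \<sigma>)))).
                (let bound = C * (real d * real s * r powr (3/2) * ln (real M) powr (9/2) * ln (real d * real M / \<sigma>))
                 in real n \<le> bound \<and> real t \<le> bound)))"
    by (rule exI[where x = failure_share])
qed

end
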